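(* Let $\Omega\subseteq\mathbb{C}^m$ be a bounded domain and $\mathcal{Z}\subseteq\Omega$ an analytic hypersurface. Let $\mathcal{Q}$ and $\tilde{\mathcal{Q}}$ be two quotient modules over the algebra $\mathcal{A}(\Omega)$ in the class $B_2(\Omega,\mathcal{Z})$, arising from resolutions $$0\longleftarrow\mathcal{Q}\longleftarrow\mathcal{M}\longleftarrow\mathcal{M}_0\longleftarrow 0,\qquad 0\longleftarrow\tilde{\mathcal{Q}}\longleftarrow\tilde{\mathcal{M}}\longleftarrow\tilde{\mathcal{M}}_0\longleftarrow 0,$$ where the reproducing kernels $K$ of $\mathcal{M}$ and $\tilde K$ of $\tilde{\mathcal{M}}$ are both normalised at the same point $w_0\in\mathcal{Z}$. Let $e(w),\mathcal{K}_{\rm tan},\mathcal{K}_{\rm trans}$ be the frame vector and the tangential and transversal curvatures attached to $K$, and let $\tilde e(w),\tilde{\mathcal{K}}_{\rm tan},\tilde{\mathcal{K}}_{\rm trans}$ be those attached to $\tilde K$ (all as defined in the context). Then $\mathcal{Q}$ and $\tilde{\mathcal{Q}}$ are isomorphic (there is a unitary $\mathcal{A}(\Omega)$-module map between them) if and only if the following three conditions hold on $\mathcal{Z}$: (tan) $\mathcal{K}_{\rm tan}=\tilde{\mathcal{K}}_{\rm tan}$; (trans) $\mathcal{K}_{\rm trans}=\tilde{\mathcal{K}}_{\rm trans}$; (angle) $\langle(\bar\partial e)(w),e(w)\rangle=\langle(\bar\partial\tilde e)(w),\tilde e(w)\rangle$ for $w\in\mathcal{Z}$.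
   Context: **Algebra and modules.** $\mathcal{A}(\Omega)$ is the closure, in the supremum norm on $\Omega$, of the functions holomorphic on a neighbourhood of (the closure of) $\Omega$. A Hilbert module $\mathcal{M}$ here is a Hilbert space of holomorphic functions on $\Omega$ with bounded point evaluations, on which $\mathcal{A}(\Omega)$ acts continuously by pointwise multiplication. It has a reproducing kernel $K$, with $K(\cdot,w)\in\mathcal{M}$ and $h(w)=\langle h,K(\cdot,w)\rangle$; $K$ is holomorphic in the first variable and anti-holomorphic in the second. Two modules over $\mathcal{A}(\Omega)$ are isomorphic if there is a unitary operator between them intertwining the actions of $\mathcal{A}(\Omega)$. **Class $B_n$.** For a domain $\Omega\subseteq\mathbb{C}^m$ put $\Omega^*=\{w:\bar w\in\Omega\}$. Let $M_i$ be multiplication by the coordinate $z_i$, and for $w\in\Omega^*$ let $D_{\mathbf{M}^*-w}h=((M_1^*-w_1)h,\dots,(M_m^*-w_m)h)$. The module $\mathcal{M}$ is in $B_n(\Omega^* )$ if (1) $\operatorname{ran}D_{\mathbf{M}^*-w}$ is closed for all $w\in\Omega^*$; (2) the span of $\{\ker D_{\mathbf{M}^*-w}:w\in\Omega^*\}$ is dense in $\mathcal{M}$; (3) $\dim\ker D_{\mathbf{M}^*-w}=n$ for all $w\in\Omega^*$. The same definition is used for modules over $\mathcal{A}(\mathcal{Z})$, with coordinates of $\mathcal{Z}$ in place of those of $\Omega$. **Hypersurface and normal derivative.** $\mathcal{Z}$ is, at least locally, the zero set of a single analytic function $\varphi$ (a local defining function). All considerations are local on $\mathcal{Z}$: one fixes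 an open set $U\subseteq\Omega$ containing $w_0$, with $U\cap\mathcal{Z}$ connected, and holomorphic coordinates $(z_1,\dots,z_m)$ on $U$ with $U\cap\mathcal{Z}=\{z_1=0\}$, where $z_1$ is the coordinate normal to $\mathcal{Z}$. These choices are the same for $\mathcal{Q}$ and $\tilde{\mathcal{Q}}$. Write $\partial=\partial/\partial z_1$ (differentiation in the direction normal to $\mathcal{Z}$) and $\bar\partial=\partial/\partial\bar z_1$; when applied to $K(z,w)$, $\partial$ acts in $z$ and $\bar\partial$ acts in $\bar w$. Statements "on $\mathcal{Z}$" mean on $U\cap\mathcal{Z}$. **Jets (order $k=2$).** $\mathcal{M}_0=\{f\in\mathcal{M}: f=\partial f=0 \text{ on } U\cap\mathcal{Z}\}$ is the submodule of functions vanishing to order $2$ on $\mathcal{Z}$, and $\mathcal{Q}=\mathcal{M}\ominus\mathcal{M}_0$ with the quotient (compressed) module action. The map $J:h\mapsto(h,\partial h)$ is made unitary onto its range $J\mathcal{M}$, a Hilbert space of $\mathbb{C}^2$-valued holomorphic functions with reproducing kernel $(JK)_{\ell,j}(z,w)=(\partial^\ell\bar\partial^jK)(z,w)$, $0\le\ell,j\le1$. An element $f\in\mathcal{A}(\Omega)$ acts on $J\mathcal{M}$ by multiplication by the matrix function $Jf=\begin{pmatrix}f&0\\ \partial f&f\end{pmatrix}$. The module $\mathcal{Q}$ is isomorphic to the restriction $J\mathcal{M}|_{\mathrm{res}\,\mathcal{Z}}$, i.e. the Hilbert space with reproducing kernel $JK|_{\mathcal{Z}\times\mathcal{Z}}$,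 with $f$ acting as multiplication by $(Jf)|_{\mathcal{Z}}$. **Class $B_2(\Omega,\mathcal{Z})$.** $\mathcal{Q}$ is a quotient module in $B_2(\Omega,\mathcal{Z})$ if: (i) there is a resolution $0\leftarrow\mathcal{Q}\leftarrow\mathcal{M}\leftarrow\mathcal{M}_0\leftarrow0$ with $\mathcal{M}$ in $B_1(\Omega^* )$ and $\mathcal{M}_0$ the submodule of functions vanishing to order $2$ on $\mathcal{Z}$; (ii) the module action on $\mathcal{Q}$ translates to the action on the isomorphic copy $J\mathcal{M}|_{\mathrm{res}\,\mathcal{Z}}$ in which each $f\in\mathcal{A}(\Omega)$ acts as multiplication by $(Jf)|_{\mathcal{Z}}$, where $Jf=\begin{pmatrix}f&0\\ \partial f&f\end{pmatrix}$, the local defining function $\varphi$ acting as the nilpotent multiplication by $(J\varphi)|_{\mathcal{Z}}$; (iii) $\mathcal{Q}$, viewed as a module over the algebra $\mathcal{A}(\mathcal{Z})$ of restrictions to $\mathcal{Z}$ of functions in $\mathcal{A}(\Omega)$ (acting on $J\mathcal{M}|_{\mathrm{res}\,\mathcal{Z}}$ by scalar multiplication), is in $B_2(\mathcal{Z}^* )$. **Normalisation (standing hypothesis).** The kernel $K$ of the module $\mathcal{M}$ in the resolution is normalised at a fixed point $w_0\in\mathcal{Z}$: $K(z,w_0)=1$ for all $z$. Likewise $\tilde K(z,w_0)=1$ for all $z$, with the same $w_0$. **Frame vectors.** For $w\in\mathcal{Z}$, $e(w)=\begin{pmatrix}K(\cdot,w)\\ \partial K(\cdot,w)\end{pmatrix}$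 and $(\bar\partial e)(w)=\begin{pmatrix}\bar\partial K(\cdot,w)\\ \partial\bar\partial K(\cdot,w)\end{pmatrix}$ are the two columns of $JK(\cdot,w)$. Inner products are taken in $J\mathcal{M}$ (equivalently in $J\mathcal{M}|_{\mathrm{res}\,\mathcal{Z}}$), so $\|e(w)\|^2=K(w,w)$ and $\langle(\bar\partial e)(w),e(w)\rangle=(\bar\partial K)(w,w)$. The vectors $\tilde e$, $\bar\partial\tilde e$ are defined in the same way from $\tilde K$. **Curvatures.** Let $\mathcal{K}(w)=\sum_{i,j=1}^m\partial_i\bar\partial_j\log K(w,w)\,dz_i\wedge d\bar z_j$, the curvature (up to a universal constant) of the line bundle with frame $w\mapsto K(\cdot,w)$ and metric $K(w,w)$. Along $\mathcal{Z}$, split the cotangent space of $\Omega$ into the conormal part (spanned by $dz_1$) and the part $T^*\mathcal{Z}$ (spanned by $dz_2,\dots,dz_m$). $\mathcal{K}_{\rm trans}$ is the component of $\mathcal{K}|_{\mathcal{Z}}$ in the transversal direction, $\partial_1\bar\partial_1\log K(w,w)\,dz_1\wedge d\bar z_1$, and $\mathcal{K}_{\rm tan}$ is the component in the tangential directions, $\sum_{i,j=2}^m\partial_i\bar\partial_j\log K(w,w)\,dz_i\wedge d\bar z_j$, both evaluated at $w\in\mathcal{Z}$. $\tilde{\mathcal{K}}_{\rm trans}$ and $\tilde{\mathcal{K}}_{\rm tan}$ are defined in the same way from $\tilde K$. *)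

theory Defs
  imports "HOL-Analysis.Analysis" "HOL-Library.Function_Algebras"
begin

class scaleC =
  fixes scaleC :: "complex \<Rightarrow> 'a \<Rightarrow> 'a" (infixr \<open>*\<^sub>C\<close> 75)

class complex_vector = scaleC + ab_group_add +
  assumes scaleC_add_right: "a *\<^sub>C (x + y) = a *\<^sub>C x + a *\<^sub>C y"
    and scaleC_add_left: "(a + b) *\<^sub>C x = a *\<^sub>C x + b *\<^sub>C x"
    and scaleC_scaleC: "a *\<^sub>C (b *\<^sub>C x) = (a * b) *\<^sub>C x"
    and scaleC_one: "1 *\<^sub>C x = x"

global_interpretation complex_vector: vector_space "scaleC :: complex \<Rightarrow> 'a \<Rightarrow> 'a::complex_vector"
  by unfold_locales
    (simp_all add: scaleC_add_right scaleC_add_left scaleC_scaleC scaleC_one)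

instantiation complex :: complex_vector
begin
definition scaleC_complex :: "complex \<Rightarrow> complex \<Rightarrow> complex"
  where "scaleC_complex c x = c * x"
instance by standard (simp_all add: scaleC_complex_def algebra_simps)
end

instantiation vec :: (complex_vector, finite) complex_vector
begin
definition scaleC_vec :: "complex \<Rightarrow> 'a ^ 'b \<Rightarrow> 'a ^ 'b"
  where "scaleC_vec c x = (\<chi> i. c *\<^sub>C (x $ i))"
instance
  by standard
    (simp_all add: scaleC_vec_def vec_eq_iff scaleC_add_right scaleC_add_left scaleC_scaleC scaleC_one)
end

instantiation "fun" :: (type, complex_vector) complex_vector
begin
definition scaleC_fun :: "complex \<Rightarrow> ('a \<Rightarrow> 'b) \<Rightarrow> 'a \<Rightarrow> 'b"
  where "scaleC_fun c f = (\<lambda>x. c *\<^sub>C f x)"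
instance
  by standard
    (simp_all add: scaleC_fun_def fun_eq_iff scaleC_add_right scaleC_add_left scaleC_scaleC scaleC_one)
end

text \<open>The inner product is linear in the first argument; its values outside the carrier
  are irrelevant.\<close>

record 'h hspace =
  hcarrier :: "'h set"
  hinner :: "'h \<Rightarrow> 'h \<Rightarrow> complex"

definition hnorm :: "'h hspace \<Rightarrow> 'h \<Rightarrow> real" where
  "hnorm H x = sqrt (Re (hinner H x x))"

definition hilbert_space :: "'h::complex_vector hspace \<Rightarrow> bool" where
  "hilbert_space H \<longleftrightarrow>
     complex_vector.subspace (hcarrier H) \<and>
     (\<forall>x\<in>hcarrier H. \<forall>y\<in>hcarrier H. \<forall>z\<in>hcarrier H.
        hinner H (x + y) z = hinner H x z + hinner H y z) \<and>
     (\<forall>c. \<forall>x\<in>hcarrier H. \<forall>y\<in>hcarrier H. hinner H (c *\<^sub>C x) y = c * hinner H x y) \<and>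
     (\<forall>x\<in>hcarrier H. \<forall>y\<in>hcarrier H. hinner H y x = cnj (hinner H x y)) \<and>
     (\<forall>x\<in>hcarrier H. 0 \<le> Re (hinner H x x)) \<and>
     (\<forall>x\<in>hcarrier H. hinner H x x = 0 \<longrightarrow> x = 0) \<and>
     (\<forall>s :: nat \<Rightarrow> 'h.
        (\<forall>n. s n \<in> hcarrier H) \<and>
        (\<forall>e>0. \<exists>N. \<forall>i\<ge>N. \<forall>j\<ge>N. hnorm H (s i - s j) < e) \<longrightarrow>
        (\<exists>x\<in>hcarrier H. (\<lambda>n. hnorm H (s n - x)) \<longlonglongrightarrow> 0))"

definition hclosed :: "'h::complex_vector hspace \<Rightarrow> 'h set \<Rightarrow> bool" where
  "hclosed H S \<longleftrightarrow> S \<subseteq> hcarrier H \<and>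
     (\<forall>s x. (\<forall>n::nat. s n \<in> S) \<and> x \<in> hcarrier H \<and> (\<lambda>n. hnorm H (s n - x)) \<longlonglongrightarrow> 0 \<longrightarrow> x \<in> S)"

definition hdense :: "'h::complex_vector hspace \<Rightarrow> 'h set \<Rightarrow> bool" where
  "hdense H S \<longleftrightarrow> S \<subseteq> hcarrier H \<and> (\<forall>x\<in>hcarrier H. \<forall>e>0. \<exists>y\<in>S. hnorm H (x - y) < e)"

definition bounded_op :: "'h::complex_vector hspace \<Rightarrow> ('h \<Rightarrow> 'h) \<Rightarrow> bool" where
  "bounded_op H T \<longleftrightarrow>
     (\<forall>x\<in>hcarrier H. T x \<in> hcarrier H) \<and>
     (\<forall>x\<in>hcarrier H. \<forall>y\<in>hcarrier H. T (x + y) = T x + T y) \<and>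
     (\<forall>c. \<forall>x\<in>hcarrier H. T (c *\<^sub>C x) = c *\<^sub>C T x) \<and>
     (\<exists>C. \<forall>x\<in>hcarrier H. hnorm H (T x) \<le> C * hnorm H x)"

definition hadjoint :: "'h hspace \<Rightarrow> ('h \<Rightarrow> 'h) \<Rightarrow> 'h \<Rightarrow> 'h" where
  "hadjoint H T h = (THE g. g \<in> hcarrier H \<and> (\<forall>k\<in>hcarrier H. hinner H (T k) h = hinner H k g))"

definition unitary_map :: "'h::complex_vector hspace \<Rightarrow> 'k::complex_vector hspace \<Rightarrow> ('h \<Rightarrow> 'k) \<Rightarrow> bool" where
  "unitary_map H K T \<longleftrightarrow>
     bij_betw T (hcarrier H) (hcarrier K) \<and>
     (\<forall>x\<in>hcarrier H. \<forall>y\<in>hcarrier H. T (x + y) = T x + T y) \<and>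
     (\<forall>c. \<forall>x\<in>hcarrier H. T (c *\<^sub>C x) = c *\<^sub>C T x) \<and>
     (\<forall>x\<in>hcarrier H. \<forall>y\<in>hcarrier H. hinner K (T x) (T y) = hinner H x y)"

definition horth :: "'h hspace \<Rightarrow> 'h set \<Rightarrow> 'h set" where
  "horth H S = {x \<in> hcarrier H. \<forall>y\<in>S. hinner H x y = 0}"

definition hproj :: "'h::complex_vector hspace \<Rightarrow> 'h set \<Rightarrow> 'h \<Rightarrow> 'h" where
  "hproj H S x = (THE q. q \<in> S \<and> x - q \<in> horth H S)"

definition hsum :: "'i set \<Rightarrow> 'h::complex_vector hspace \<Rightarrow> ('i \<Rightarrow> 'h) hspace" where
  "hsum I H = \<lparr>hcarrier = {g. (\<forall>i\<in>I. g i \<in> hcarrier H) \<and> (\<forall>i. i \<notin> I \<longrightarrow> g i = 0)},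
               hinner = (\<lambda>g k. \<Sum>i\<in>I. hinner H (g i) (k i))\<rparr>"

text \<open>For open \<open>S\<close>: complex Frechet differentiability.\<close>

definition holo_on :: "(complex ^ 'm::finite \<Rightarrow> complex) \<Rightarrow> (complex ^ 'm) set \<Rightarrow> bool" where
  "holo_on f S \<longleftrightarrow>
     (\<forall>z\<in>S. \<exists>D. (f has_derivative D) (at z) \<and> (\<forall>c v. D (c *s v) = c * D v))"

definition bounded_domain :: "(complex ^ 'm::finite) set \<Rightarrow> bool" where
  "bounded_domain \<Omega> \<longleftrightarrow> open \<Omega> \<and> connected \<Omega> \<and> \<Omega> \<noteq> {} \<and> bounded \<Omega>"

definition analytic_hypersurface :: "(complex ^ 'm::finite) set \<Rightarrow> (complex ^ 'm) set \<Rightarrow> bool" where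
  "analytic_hypersurface \<Omega> Z \<longleftrightarrow>
     closedin (top_of_set \<Omega>) Z \<and>
     (\<forall>p\<in>Z. \<exists>V \<phi>. open V \<and> connected V \<and> p \<in> V \<and> V \<subseteq> \<Omega> \<and> holo_on \<phi> V \<and>
        (\<exists>z\<in>V. \<phi> z \<noteq> 0) \<and> V \<inter> Z = {z \<in> V. \<phi> z = 0})"

definition local_defining_function ::
  "(complex ^ 'm::finite) set \<Rightarrow> (complex ^ 'm) set \<Rightarrow> (complex ^ 'm \<Rightarrow> complex) \<Rightarrow> bool" where
  "local_defining_function U Z \<phi> \<longleftrightarrow> holo_on \<phi> U \<and> U \<inter> Z = {z \<in> U. \<phi> z = 0}"

text \<open>\<open>\<zeta>\<close> is the coordinate map on \<open>U\<close>; the index \<open>\<nu>\<close> is the one of the coordinate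
  normal to \<open>Z\<close> (usually written as the first one).\<close>

definition adapted_coordinates ::
  "(complex ^ 'm::finite) set \<Rightarrow> (complex ^ 'm) set \<Rightarrow> (complex ^ 'm) set \<Rightarrow>
   (complex ^ 'm \<Rightarrow> complex ^ 'm) \<Rightarrow> 'm \<Rightarrow> complex ^ 'm \<Rightarrow> bool" where
  "adapted_coordinates \<Omega> Z U \<zeta> \<nu> w0 \<longleftrightarrow>
     open U \<and> U \<subseteq> \<Omega> \<and> w0 \<in> U \<and> w0 \<in> Z \<and> connected (U \<inter> Z) \<and>
     inj_on \<zeta> U \<and> open (\<zeta> ` U) \<and>
     (\<forall>i. holo_on (\<lambda>z. \<zeta> z $ i) U) \<and>
     (\<forall>i. holo_on (\<lambda>v. inv_into U \<zeta> v $ i) (\<zeta> ` U)) \<and>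
     U \<inter> Z = {z \<in> U. \<zeta> z $ \<nu> = 0}"

text \<open>Wirtinger derivatives with respect to the coordinate \<open>\<zeta>\<^sub>i\<close>, applicable to functions that
  are merely smooth (such as \<open>log K(w,w)\<close>).\<close>

definition shift_coord ::
  "(complex ^ 'm::finite) set \<Rightarrow> (complex ^ 'm \<Rightarrow> complex ^ 'm) \<Rightarrow> 'm \<Rightarrow> complex ^ 'm \<Rightarrow> complex \<Rightarrow> complex ^ 'm" where
  "shift_coord U \<zeta> i z t = inv_into U \<zeta> (\<zeta> z + axis i t)"

definition dz ::
  "(complex ^ 'm::finite) set \<Rightarrow> (complex ^ 'm \<Rightarrow> complex ^ 'm) \<Rightarrow> 'm \<Rightarrow>
   (complex ^ 'm \<Rightarrow> complex) \<Rightarrow> complex ^ 'm \<Rightarrow> complex" where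
  "dz U \<zeta> i f z =
     (vector_derivative (\<lambda>t. f (shift_coord U \<zeta> i z (of_real t))) (at 0)
      - \<i> * vector_derivative (\<lambda>t. f (shift_coord U \<zeta> i z (\<i> * of_real t))) (at 0)) / 2"

definition dzbar ::
  "(complex ^ 'm::finite) set \<Rightarrow> (complex ^ 'm \<Rightarrow> complex ^ 'm) \<Rightarrow> 'm \<Rightarrow>
   (complex ^ 'm \<Rightarrow> complex) \<Rightarrow> complex ^ 'm \<Rightarrow> complex" where
  "dzbar U \<zeta> i f z =
     (vector_derivative (\<lambda>t. f (shift_coord U \<zeta> i z (of_real t))) (at 0)
      + \<i> * vector_derivative (\<lambda>t. f (shift_coord U \<zeta> i z (\<i> * of_real t))) (at 0)) / 2"

text \<open>Spaces of functions on a set \<open>X\<close> consist of functions that vanish off \<open>X\<close>.\<close>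

definition restrict0 :: "'x set \<Rightarrow> ('x \<Rightarrow> 'e::zero) \<Rightarrow> 'x \<Rightarrow> 'e" where
  "restrict0 X F = (\<lambda>z. if z \<in> X then F z else 0)"

text \<open>The values of the elements of \<open>fun_algebra \<Omega>\<close> off \<open>\<Omega>\<close> are irrelevant.\<close>

definition fun_algebra :: "(complex ^ 'm::finite) set \<Rightarrow> (complex ^ 'm \<Rightarrow> complex) set" where
  "fun_algebra \<Omega> =
     {f. \<forall>e>0. \<exists>V g. open V \<and> closure \<Omega> \<subseteq> V \<and> holo_on g V \<and> (\<forall>z\<in>\<Omega>. cmod (f z - g z) < e)}"

definition sup_norm :: "'x set \<Rightarrow> ('x \<Rightarrow> complex) \<Rightarrow> real" where
  "sup_norm \<Omega> f = (SUP z\<in>\<Omega>. cmod (f z))"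

definition restricted_algebra ::
  "(complex ^ 'm::finite) set \<Rightarrow> (complex ^ 'm) set \<Rightarrow> (complex ^ 'm \<Rightarrow> complex) set" where
  "restricted_algebra \<Omega> X = restrict0 X ` fun_algebra \<Omega>"

text \<open>The quotient norm: a smaller norm on the algebra of restrictions would
  only make continuity of a module action more restrictive.\<close>

definition restricted_norm ::
  "(complex ^ 'm::finite) set \<Rightarrow> (complex ^ 'm) set \<Rightarrow> (complex ^ 'm \<Rightarrow> complex) \<Rightarrow> real" where
  "restricted_norm \<Omega> X f = Inf (sup_norm \<Omega> ` {g \<in> fun_algebra \<Omega>. \<forall>z\<in>X. g z = f z})"

definition pointwise_mult :: "('x \<Rightarrow> complex) \<Rightarrow> ('x \<Rightarrow> 'e::complex_vector) \<Rightarrow> 'x \<Rightarrow> 'e" where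
  "pointwise_mult f h = (\<lambda>z. f z *\<^sub>C h z)"

definition pointwise_module ::
  "('x \<Rightarrow> complex) set \<Rightarrow> (('x \<Rightarrow> complex) \<Rightarrow> real) \<Rightarrow> ('x \<Rightarrow> 'e::complex_vector) hspace \<Rightarrow> bool" where
  "pointwise_module A nrm H \<longleftrightarrow>
     hilbert_space H \<and>
     (\<forall>f\<in>A. \<forall>h\<in>hcarrier H. pointwise_mult f h \<in> hcarrier H) \<and>
     (\<exists>C. \<forall>f\<in>A. \<forall>h\<in>hcarrier H. hnorm H (pointwise_mult f h) \<le> C * nrm f * hnorm H h)"

definition holomorphic_hilbert_module ::
  "(complex ^ 'm::finite) set \<Rightarrow> (complex ^ 'm \<Rightarrow> complex) hspace \<Rightarrow> bool" where
  "holomorphic_hilbert_module \<Omega> M \<longleftrightarrow>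
     (\<forall>h\<in>hcarrier M. holo_on h \<Omega> \<and> (\<forall>z. z \<notin> \<Omega> \<longrightarrow> h z = 0)) \<and>
     (\<forall>z\<in>\<Omega>. \<exists>C. \<forall>h\<in>hcarrier M. cmod (h z) \<le> C * hnorm M h) \<and>
     pointwise_module (fun_algebra \<Omega>) (sup_norm \<Omega>) M"

definition reproducing_kernel ::
  "'x set \<Rightarrow> ('x \<Rightarrow> complex) hspace \<Rightarrow> ('x \<Rightarrow> 'x \<Rightarrow> complex) \<Rightarrow> bool" where
  "reproducing_kernel X M K \<longleftrightarrow>
     (\<forall>w\<in>X. restrict0 X (\<lambda>z. K z w) \<in> hcarrier M \<and>
        (\<forall>h\<in>hcarrier M. h w = hinner M h (restrict0 X (\<lambda>z. K z w))))"

definition matrix_rkhs ::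
  "'x set \<Rightarrow> ('x \<Rightarrow> complex ^ 'r::finite) hspace \<Rightarrow> ('x \<Rightarrow> 'x \<Rightarrow> complex ^ 'r ^ 'r) \<Rightarrow> bool" where
  "matrix_rkhs X N KK \<longleftrightarrow>
     hilbert_space N \<and>
     (\<forall>F\<in>hcarrier N. \<forall>z. z \<notin> X \<longrightarrow> F z = 0) \<and>
     (\<forall>w\<in>X. \<forall>x. restrict0 X (\<lambda>z. KK z w *v x) \<in> hcarrier N \<and>
        (\<forall>F\<in>hcarrier N.
           hinner N F (restrict0 X (\<lambda>z. KK z w *v x)) = (\<Sum>l\<in>UNIV. F w $ l * cnj (x $ l))))"

definition isomorphic_modules ::
  "'f set \<Rightarrow> 'h::complex_vector hspace \<Rightarrow> ('f \<Rightarrow> 'h \<Rightarrow> 'h) \<Rightarrow>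
   'k::complex_vector hspace \<Rightarrow> ('f \<Rightarrow> 'k \<Rightarrow> 'k) \<Rightarrow> bool" where
  "isomorphic_modules A H a K b \<longleftrightarrow>
     (\<exists>T. unitary_map H K T \<and> (\<forall>f\<in>A. \<forall>h\<in>hcarrier H. T (a f h) = b f (T h)))"

definition conj_set :: "(complex ^ 'm::finite) set \<Rightarrow> (complex ^ 'm) set" where
  "conj_set X = {w. (\<chi> i. cnj (w $ i)) \<in> X}"

definition D_op ::
  "'m set \<Rightarrow> 'h::complex_vector hspace \<Rightarrow> ('m \<Rightarrow> 'h \<Rightarrow> 'h) \<Rightarrow> complex ^ 'm::finite \<Rightarrow> 'h \<Rightarrow> 'm \<Rightarrow> 'h" where
  "D_op I H T w h = (\<lambda>i. if i \<in> I then hadjoint H (T i) h - (w $ i) *\<^sub>C h else 0)"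

definition ker_D ::
  "'m set \<Rightarrow> 'h::complex_vector hspace \<Rightarrow> ('m \<Rightarrow> 'h \<Rightarrow> 'h) \<Rightarrow> complex ^ 'm::finite \<Rightarrow> 'h set" where
  "ker_D I H T w = {h \<in> hcarrier H. D_op I H T w h = 0}"

text \<open>\<open>T\<close> is the tuple, indexed by \<open>I\<close>, of multiplications by the coordinates, and \<open>X\<close> is the
  underlying domain in these coordinates. (\<open>dim\<close> is \<open>0\<close> for infinite-dimensional spaces,
  so for \<open>n > 0\<close> the last clause implies that the kernels are finite-dimensional.)\<close>

definition class_B ::
  "nat \<Rightarrow> 'm set \<Rightarrow> (complex ^ 'm::finite) set \<Rightarrow> 'h::complex_vector hspace \<Rightarrow> ('m \<Rightarrow> 'h \<Rightarrow> 'h) \<Rightarrow> bool" where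
  "class_B n I X H T \<longleftrightarrow>
     (\<forall>i\<in>I. bounded_op H (T i)) \<and>
     (\<forall>w\<in>conj_set X. hclosed (hsum I H) (D_op I H T w ` hcarrier H)) \<and>
     hdense H (complex_vector.span (\<Union>w\<in>conj_set X. ker_D I H T w)) \<and>
     (\<forall>w\<in>conj_set X. complex_vector.dim (ker_D I H T w) = n)"

definition submodule0 ::
  "(complex ^ 'm::finite) set \<Rightarrow> (complex ^ 'm) set \<Rightarrow> (complex ^ 'm \<Rightarrow> complex ^ 'm) \<Rightarrow> 'm \<Rightarrow>
   (complex ^ 'm \<Rightarrow> complex) hspace \<Rightarrow> (complex ^ 'm \<Rightarrow> complex) set" where
  "submodule0 Z U \<zeta> \<nu> M = {f \<in> hcarrier M. \<forall>z\<in>U \<inter> Z. f z = 0 \<and> dz U \<zeta> \<nu> f z = 0}"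

definition quotient_space ::
  "(complex ^ 'm::finite) set \<Rightarrow> (complex ^ 'm) set \<Rightarrow> (complex ^ 'm \<Rightarrow> complex ^ 'm) \<Rightarrow> 'm \<Rightarrow>
   (complex ^ 'm \<Rightarrow> complex) hspace \<Rightarrow> (complex ^ 'm \<Rightarrow> complex) hspace" where
  "quotient_space Z U \<zeta> \<nu> M =
     \<lparr>hcarrier = horth M (submodule0 Z U \<zeta> \<nu> M), hinner = hinner M\<rparr>"

definition quotient_action ::
  "(complex ^ 'm::finite) set \<Rightarrow> (complex ^ 'm) set \<Rightarrow> (complex ^ 'm \<Rightarrow> complex ^ 'm) \<Rightarrow> 'm \<Rightarrow>
   (complex ^ 'm \<Rightarrow> complex) hspace \<Rightarrow> (complex ^ 'm \<Rightarrow> complex) \<Rightarrow>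
   (complex ^ 'm \<Rightarrow> complex) \<Rightarrow> complex ^ 'm \<Rightarrow> complex" where
  "quotient_action Z U \<zeta> \<nu> M f h =
     hproj M (hcarrier (quotient_space Z U \<zeta> \<nu> M)) (pointwise_mult f h)"

definition jet ::
  "(complex ^ 'm::finite) set \<Rightarrow> (complex ^ 'm \<Rightarrow> complex ^ 'm) \<Rightarrow> 'm \<Rightarrow>
   (complex ^ 'm \<Rightarrow> complex) \<Rightarrow> complex ^ 'm \<Rightarrow> complex ^ 2" where
  "jet U \<zeta> \<nu> h = restrict0 U (\<lambda>z. vector [h z, dz U \<zeta> \<nu> h z])"

definition jet_space ::
  "(complex ^ 'm::finite) set \<Rightarrow> (complex ^ 'm \<Rightarrow> complex ^ 'm) \<Rightarrow> 'm \<Rightarrow>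
   (complex ^ 'm \<Rightarrow> complex) hspace \<Rightarrow> (complex ^ 'm \<Rightarrow> complex ^ 2) hspace" where
  "jet_space U \<zeta> \<nu> M =
     \<lparr>hcarrier = jet U \<zeta> \<nu> ` hcarrier M,
      hinner = (\<lambda>F G. hinner M (inv_into (hcarrier M) (jet U \<zeta> \<nu>) F)
                               (inv_into (hcarrier M) (jet U \<zeta> \<nu>) G))\<rparr>"

definition jet_kernel ::
  "(complex ^ 'm::finite) set \<Rightarrow> (complex ^ 'm \<Rightarrow> complex ^ 'm) \<Rightarrow> 'm \<Rightarrow>
   (complex ^ 'm \<Rightarrow> complex ^ 'm \<Rightarrow> complex) \<Rightarrow> complex ^ 'm \<Rightarrow> complex ^ 'm \<Rightarrow> complex ^ 2 ^ 2" where
  "jet_kernel U \<zeta> \<nu> K z w =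
     vector [vector [K z w, dzbar U \<zeta> \<nu> (\<lambda>v. K z v) w],
             vector [dz U \<zeta> \<nu> (\<lambda>x. K x w) z, dz U \<zeta> \<nu> (\<lambda>x. dzbar U \<zeta> \<nu> (\<lambda>v. K x v) w) z]]"

definition jet_matrix ::
  "(complex ^ 'm::finite) set \<Rightarrow> (complex ^ 'm \<Rightarrow> complex ^ 'm) \<Rightarrow> 'm \<Rightarrow>
   (complex ^ 'm \<Rightarrow> complex) \<Rightarrow> complex ^ 'm \<Rightarrow> complex ^ 2 ^ 2" where
  "jet_matrix U \<zeta> \<nu> f z = vector [vector [f z, 0], vector [dz U \<zeta> \<nu> f z, f z]]"

definition jet_action ::
  "(complex ^ 'm::finite) set \<Rightarrow> (complex ^ 'm) set \<Rightarrow> (complex ^ 'm \<Rightarrow> complex ^ 'm) \<Rightarrow> 'm \<Rightarrow>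
   (complex ^ 'm \<Rightarrow> complex) \<Rightarrow> (complex ^ 'm \<Rightarrow> complex ^ 2) \<Rightarrow> complex ^ 'm \<Rightarrow> complex ^ 2" where
  "jet_action Z U \<zeta> \<nu> f F = restrict0 (U \<inter> Z) (\<lambda>z. jet_matrix U \<zeta> \<nu> f z *v F z)"

text \<open>The quotient of \<open>M\<close> (with kernel \<open>K\<close>) by the functions vanishing to order two on the
  hypersurface is in the class \<open>B\<^sub>2(\<Omega>, Z)\<close>. The space \<open>N\<close> is the Hilbert space with kernel
  \<open>JK\<close> restricted to \<open>Z\<close>, which is determined uniquely by this kernel. The function \<open>\<phi>\<close> need not extend to
  an element of \<open>fun_algebra \<Omega>\<close>, so its nilpotent action is required separately.\<close>

definition quotient_class_B2 ::
  "(complex ^ 'm::finite) set \<Rightarrow> (complex ^ 'm) set \<Rightarrow> (complex ^ 'm) set \<Rightarrow>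
   (complex ^ 'm \<Rightarrow> complex ^ 'm) \<Rightarrow> 'm \<Rightarrow> (complex ^ 'm \<Rightarrow> complex) \<Rightarrow>
   (complex ^ 'm \<Rightarrow> complex) hspace \<Rightarrow> (complex ^ 'm \<Rightarrow> complex ^ 'm \<Rightarrow> complex) \<Rightarrow> bool" where
  "quotient_class_B2 \<Omega> Z U \<zeta> \<nu> \<phi> M K \<longleftrightarrow>
     holomorphic_hilbert_module \<Omega> M \<and>
     reproducing_kernel \<Omega> M K \<and>
     class_B 1 UNIV \<Omega> M (\<lambda>i. pointwise_mult (\<lambda>z. z $ i)) \<and>
     (\<exists>N. matrix_rkhs (U \<inter> Z) N (jet_kernel U \<zeta> \<nu> K) \<and>
        isomorphic_modules (fun_algebra \<Omega>)
          (quotient_space Z U \<zeta> \<nu> M) (quotient_action Z U \<zeta> \<nu> M)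
          N (jet_action Z U \<zeta> \<nu>) \<and>
        bounded_op N (jet_action Z U \<zeta> \<nu> \<phi>) \<and>
        (\<exists>k. \<forall>F\<in>hcarrier N. (jet_action Z U \<zeta> \<nu> \<phi> ^^ k) F = 0) \<and>
        pointwise_module (restricted_algebra \<Omega> (U \<inter> Z)) (restricted_norm \<Omega> (U \<inter> Z)) N \<and>
        class_B 2 (- {\<nu>}) (\<zeta> ` (U \<inter> Z)) N (\<lambda>i. pointwise_mult (\<lambda>z. \<zeta> z $ i)))"

definition normalised_at ::
  "'x set \<Rightarrow> ('x \<Rightarrow> 'x \<Rightarrow> complex) \<Rightarrow> 'x \<Rightarrow> bool" where
  "normalised_at \<Omega> K w0 \<longleftrightarrow> (\<forall>z\<in>\<Omega>. K z w0 = 1)"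

definition frame ::
  "(complex ^ 'm::finite) set \<Rightarrow> (complex ^ 'm \<Rightarrow> complex ^ 'm) \<Rightarrow> 'm \<Rightarrow>
   (complex ^ 'm \<Rightarrow> complex ^ 'm \<Rightarrow> complex) \<Rightarrow> complex ^ 'm \<Rightarrow> complex ^ 'm \<Rightarrow> complex ^ 2" where
  "frame U \<zeta> \<nu> K w = restrict0 U (\<lambda>z. column 1 (jet_kernel U \<zeta> \<nu> K z w))"

definition dbar_frame ::
  "(complex ^ 'm::finite) set \<Rightarrow> (complex ^ 'm \<Rightarrow> complex ^ 'm) \<Rightarrow> 'm \<Rightarrow>
   (complex ^ 'm \<Rightarrow> complex ^ 'm \<Rightarrow> complex) \<Rightarrow> complex ^ 'm \<Rightarrow> complex ^ 'm \<Rightarrow> complex ^ 2" where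
  "dbar_frame U \<zeta> \<nu> K w = restrict0 U (\<lambda>z. column 2 (jet_kernel U \<zeta> \<nu> K z w))"

text \<open>The two-form \<open>\<Sum>i,j\<in>I. \<partial>\<^sub>i \<partial>bar\<^sub>j log K(w,w) dz\<^sub>i \<and> dzbar\<^sub>j\<close> at \<open>w\<close>, evaluated on the tangent
  vectors with components \<open>u\<close> and \<open>v\<close> in the coordinates \<open>\<zeta>\<close>.\<close>

definition curvature_part ::
  "'m set \<Rightarrow> (complex ^ 'm::finite) set \<Rightarrow> (complex ^ 'm \<Rightarrow> complex ^ 'm) \<Rightarrow>
   (complex ^ 'm \<Rightarrow> complex ^ 'm \<Rightarrow> complex) \<Rightarrow> complex ^ 'm \<Rightarrow> complex ^ 'm \<Rightarrow> complex ^ 'm \<Rightarrow> complex" where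
  "curvature_part I U \<zeta> K w u v =
     (\<Sum>i\<in>I. \<Sum>j\<in>I. dz U \<zeta> i (dzbar U \<zeta> j (\<lambda>x. ln (K x x))) w
        * (u $ i * cnj (v $ j) - v $ i * cnj (u $ j)))"

definition curvature_tan ::
  "(complex ^ 'm::finite) set \<Rightarrow> (complex ^ 'm \<Rightarrow> complex ^ 'm) \<Rightarrow> 'm \<Rightarrow>
   (complex ^ 'm \<Rightarrow> complex ^ 'm \<Rightarrow> complex) \<Rightarrow> complex ^ 'm \<Rightarrow> complex ^ 'm \<Rightarrow> complex ^ 'm \<Rightarrow> complex" where
  "curvature_tan U \<zeta> \<nu> K = curvature_part (- {\<nu>}) U \<zeta> K"

definition curvature_trans ::
  "(complex ^ 'm::finite) set \<Rightarrow> (complex ^ 'm \<Rightarrow> complex ^ 'm) \<Rightarrow> 'm \<Rightarrow>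
   (complex ^ 'm \<Rightarrow> complex ^ 'm \<Rightarrow> complex) \<Rightarrow> complex ^ 'm \<Rightarrow> complex ^ 'm \<Rightarrow> complex ^ 'm \<Rightarrow> complex" where
  "curvature_trans U \<zeta> \<nu> K = curvature_part {\<nu>} U \<zeta> K"

end

theory Submission
  imports Defs "HOL-Complex_Analysis.Conformal_Mappings"
begin

text \<open>
  Why the theorem is true. Each module carries the vectors \<open>K(\<sqdot>,w)\<close> and their normal derivatives
  \<open>\<partial>bar K(\<sqdot>,w)\<close>, for \<open>w \<in> Z\<close> (everything is local, and \<open>Z\<close> stands for \<open>U \<inter> Z\<close>);
  the functions vanishing to order two on \<open>Z\<close> are exactly those
  orthogonal to all of them, so these vectors span a dense subspace of the quotient. Both sides of the
  equivalence turn out to say that the two systems have the same Gram matrix, that is, that the jet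
  kernels \<open>JK\<close> and \<open>JK'\<close> agree on \<open>Z \<times> Z\<close> (\<open>jets_agree\<close> below).

  An isomorphism forces this (\<open>jets_agree_of_isomorphic\<close>). The inverse \<open>S\<close> of a unitary module map
  intertwines the adjoints of the coordinate multiplications. So it maps \<open>K'(\<sqdot>,w)\<close> to a joint
  eigenvector, and by the dimension condition of the class \<open>B\<^sub>1\<close> to a multiple \<open>c(w) K(\<sqdot>,w)\<close>; likewise it maps
  \<open>\<partial>bar K'(\<sqdot>,w)\<close> to \<open>c(w) \<partial>bar K(\<sqdot>,w) + d(w) K(\<sqdot>,w)\<close>. Since \<open>S\<close> is isometric,
  comparison with the vectors at \<open>w\<^sub>0\<close>, where both kernels are normalised, makes \<open>c\<close> a unimodular constant
  and \<open>d\<close> zero. The curvatures and the angle are functions of the jet kernel, so the three conditions follow.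

  Conversely (\<open>jets_agree_of_conditions\<close>), the three conditions are equations on the diagonal of
  \<open>Z \<times> Z\<close> between functions holomorphic in \<open>z\<close> and antiholomorphic in \<open>w\<close>, and such equations propagate to
  \<open>Z \<times> Z\<close> by polarization and the identity theorem (\<open>sesqui_eq_0\<close>). The polarized tangential
  condition says that \<open>\<partial>\<^sub>b \<partial>bar\<^sub>c log K\<close> is the same for both kernels, for tangential \<open>b, c\<close>;
  integrating twice from \<open>w\<^sub>0\<close>, where the normalisation removes the constants of integration, gives
  \<open>K = K'\<close> on \<open>Z \<times> Z\<close> (\<open>kernel_eq_of_curv_eq\<close>). Then the angle gives the mixed entries of the jet kernel, and
  the transversal curvature its last entry. Finally, a Hilbert space of functions is determined by its
  kernel (\<open>matrix_rkhs_unique\<close>), so both quotients are isomorphic to the same module over \<open>Z\<close>.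

  The analysis in several variables is reduced to complex lines. The kernel functions
  form a map into the Hilbert space whose inner products with fixed vectors are antiholomorphic in \<open>w\<close>. By
  Banach-Steinhaus and Cauchy's estimates such a map is differentiable in norm (\<open>antiholo_quad_approx\<close>),
  which makes all mixed derivatives of \<open>K\<close> inner products of derivatives of the map.
\<close>

section \<open>Hilbert spaces given by a carrier and an inner product\<close>

locale hilbert =
  fixes H :: "'h::complex_vector hspace"
  assumes hilbert_space: "hilbert_space H"
begin

abbreviation inner_H :: "'h \<Rightarrow> 'h \<Rightarrow> complex" (\<open>\<langle>_, _\<rangle>\<close>)
  where "\<langle>x, y\<rangle> \<equiv> hinner H x y"

lemma subspace: "complex_vector.subspace (hcarrier H)"
  using hilbert_space by (simp add: hilbert_space_def)

lemma zero_mem [simp]: "0 \<in> hcarrier H"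
  and add_mem [simp]: "x \<in> hcarrier H \<Longrightarrow> y \<in> hcarrier H \<Longrightarrow> x + y \<in> hcarrier H"
  and scale_mem [simp]: "x \<in> hcarrier H \<Longrightarrow> c *\<^sub>C x \<in> hcarrier H"
  and diff_mem [simp]: "x \<in> hcarrier H \<Longrightarrow> y \<in> hcarrier H \<Longrightarrow> x - y \<in> hcarrier H"
  using subspace by (simp_all add: complex_vector.subspace_0 complex_vector.subspace_add
      complex_vector.subspace_scale complex_vector.subspace_diff)

lemmas hilbert_clauses = hilbert_space[unfolded hilbert_space_def]

lemma inner_add_left: "\<lbrakk>x \<in> hcarrier H; y \<in> hcarrier H; z \<in> hcarrier H\<rbrakk> \<Longrightarrow> \<langle>x + y, z\<rangle> = \<langle>x, z\<rangle> + \<langle>y, z\<rangle>"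
  using hilbert_clauses[THEN conjunct2, THEN conjunct1] by blast

lemma inner_scale_left: "\<lbrakk>x \<in> hcarrier H; y \<in> hcarrier H\<rbrakk> \<Longrightarrow> \<langle>c *\<^sub>C x, y\<rangle> = c * \<langle>x, y\<rangle>"
  using hilbert_clauses[THEN conjunct2, THEN conjunct2, THEN conjunct1] by blast

lemma inner_commute: "\<lbrakk>x \<in> hcarrier H; y \<in> hcarrier H\<rbrakk> \<Longrightarrow> \<langle>y, x\<rangle> = cnj \<langle>x, y\<rangle>"
  using hilbert_clauses[THEN conjunct2, THEN conjunct2, THEN conjunct2, THEN conjunct1] by blast

lemma inner_self_Re: "x \<in> hcarrier H \<Longrightarrow> 0 \<le> Re \<langle>x, x\<rangle>"
  using hilbert_clauses[THEN conjunct2, THEN conjunct2, THEN conjunct2, THEN conjunct2, THEN conjunct1]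
  by blast

lemma inner_self_0: "\<lbrakk>x \<in> hcarrier H; \<langle>x, x\<rangle> = 0\<rbrakk> \<Longrightarrow> x = 0"
  using hilbert_clauses[THEN conjunct2, THEN conjunct2, THEN conjunct2, THEN conjunct2, THEN conjunct2,
      THEN conjunct1] by blast

lemma complete:
  assumes "\<And>n. s n \<in> hcarrier H"
    and "\<And>e. e > 0 \<Longrightarrow> \<exists>N. \<forall>i\<ge>N. \<forall>j\<ge>N. hnorm H (s i - s j) < e"
  shows "\<exists>x\<in>hcarrier H. (\<lambda>n. hnorm H (s n - x)) \<longlonglongrightarrow> 0"
  using hilbert_clauses[THEN conjunct2, THEN conjunct2, THEN conjunct2, THEN conjunct2, THEN conjunct2,
      THEN conjunct2, THEN spec, of s] assms by blast

lemma inner_zero_left [simp]: "y \<in> hcarrier H \<Longrightarrow> \<langle>0, y\<rangle> = 0"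
  using inner_scale_left[of 0 y 0] complex_vector.scale_zero_left[of "0::'h"] by simp

lemma inner_add_right: "\<lbrakk>x \<in> hcarrier H; y \<in> hcarrier H; z \<in> hcarrier H\<rbrakk> \<Longrightarrow> \<langle>x, y + z\<rangle> = \<langle>x, y\<rangle> + \<langle>x, z\<rangle>"
  by (metis add_mem complex_cnj_add inner_add_left inner_commute)

lemma inner_scale_right: "\<lbrakk>x \<in> hcarrier H; y \<in> hcarrier H\<rbrakk> \<Longrightarrow> \<langle>x, c *\<^sub>C y\<rangle> = cnj c * \<langle>x, y\<rangle>"
  by (metis scale_mem complex_cnj_mult inner_scale_left inner_commute)

lemma inner_zero_right [simp]: "y \<in> hcarrier H \<Longrightarrow> \<langle>y, 0\<rangle> = 0"
  by (metis complex_cnj_zero inner_commute inner_zero_left zero_mem)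

lemma inner_diff_left: "\<lbrakk>x \<in> hcarrier H; y \<in> hcarrier H; z \<in> hcarrier H\<rbrakk> \<Longrightarrow> \<langle>x - y, z\<rangle> = \<langle>x, z\<rangle> - \<langle>y, z\<rangle>"
  by (metis add_diff_cancel_right' diff_add_cancel diff_mem inner_add_left)

lemma inner_diff_right: "\<lbrakk>x \<in> hcarrier H; y \<in> hcarrier H; z \<in> hcarrier H\<rbrakk> \<Longrightarrow> \<langle>x, y - z\<rangle> = \<langle>x, y\<rangle> - \<langle>x, z\<rangle>"
  by (metis add_diff_cancel_right' diff_add_cancel diff_mem inner_add_right)

lemmas inner_simps = inner_add_left inner_add_right inner_scale_left inner_scale_right
  inner_diff_left inner_diff_right

lemma hnorm_ge_0: "x \<in> hcarrier H \<Longrightarrow> 0 \<le> hnorm H x"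
  using inner_self_Re by (simp add: hnorm_def)

lemma inner_self: "x \<in> hcarrier H \<Longrightarrow> \<langle>x, x\<rangle> = of_real ((hnorm H x)\<^sup>2)"
  using inner_self_Re[of x] inner_commute[of x x]
  by (auto simp: hnorm_def complex_eq_iff)

lemma hnorm_sq: "x \<in> hcarrier H \<Longrightarrow> (hnorm H x)\<^sup>2 = Re \<langle>x, x\<rangle>"
  using inner_self[of x] by simp

lemma hnorm_eq_0: "x \<in> hcarrier H \<Longrightarrow> hnorm H x = 0 \<longleftrightarrow> x = 0"
  using inner_self[of x] inner_self_0[of x] by (auto simp: hnorm_def)

lemma hnorm_scale: "x \<in> hcarrier H \<Longrightarrow> hnorm H (c *\<^sub>C x) = cmod c * hnorm H x"
proof -
  assume x: "x \<in> hcarrier H"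
  have "\<langle>c *\<^sub>C x, c *\<^sub>C x\<rangle> = of_real ((cmod c)\<^sup>2) * \<langle>x, x\<rangle>"
    using x complex_norm_square[of c] by (simp add: inner_simps)
  then have "Re \<langle>c *\<^sub>C x, c *\<^sub>C x\<rangle> = (cmod c)\<^sup>2 * Re \<langle>x, x\<rangle>"
    by simp
  then show ?thesis by (simp add: hnorm_def real_sqrt_mult)
qed

lemma hnorm_diff_commute:
  assumes "x \<in> hcarrier H" "y \<in> hcarrier H" shows "hnorm H (x - y) = hnorm H (y - x)"
proof -
  have "\<langle>x - y, x - y\<rangle> = \<langle>y - x, y - x\<rangle>"
    using assms by (simp add: inner_simps)
  then show ?thesis by (simp add: hnorm_def)
qed

lemma inner_self_diff_scale:
  assumes "x \<in> hcarrier H" "y \<in> hcarrier H"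
  shows "(hnorm H (x - c *\<^sub>C y))\<^sup>2 = (hnorm H x)\<^sup>2 - 2 * Re (cnj c * \<langle>x, y\<rangle>) + (cmod c)\<^sup>2 * (hnorm H y)\<^sup>2"
proof -
  have "\<langle>x - c *\<^sub>C y, x - c *\<^sub>C y\<rangle> =
      \<langle>x, x\<rangle> - (cnj c * \<langle>x, y\<rangle> + cnj (cnj c * \<langle>x, y\<rangle>)) + of_real ((cmod c)\<^sup>2) * \<langle>y, y\<rangle>"
    using assms inner_commute[of x y] complex_norm_square[of c]
    by (simp add: inner_simps algebra_simps)
  then show ?thesis
    using assms by (simp add: hnorm_sq complex_add_cnj del: complex_cnj_mult)
qed

lemma minus_projection:
  assumes x: "x \<in> hcarrier H" and y: "y \<in> hcarrier H" "y \<noteq> 0"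
  obtains c where "(hnorm H (x - c *\<^sub>C y))\<^sup>2 = (hnorm H x)\<^sup>2 - (cmod \<langle>x, y\<rangle>)\<^sup>2 / (hnorm H y)\<^sup>2"
proof -
  have pos: "hnorm H y > 0" using y hnorm_eq_0 hnorm_ge_0 by (metis less_eq_real_def)
  define c where "c = \<langle>x, y\<rangle> / of_real ((hnorm H y)\<^sup>2)"
  have "cnj c * \<langle>x, y\<rangle> = of_real ((cmod \<langle>x, y\<rangle>)\<^sup>2 / (hnorm H y)\<^sup>2)"
    using complex_norm_square[of "\<langle>x, y\<rangle>"] by (simp add: c_def mult_ac)
  moreover have "(cmod c)\<^sup>2 * (hnorm H y)\<^sup>2 = (cmod \<langle>x, y\<rangle>)\<^sup>2 / (hnorm H y)\<^sup>2"
    using pos by (simp add: c_def norm_divide norm_power power_divide eval_nat_numeral norm_mult)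
  ultimately show ?thesis
    using that[of c] inner_self_diff_scale[OF x y(1), of c] by simp
qed

lemma Cauchy_Schwarz:
  assumes x: "x \<in> hcarrier H" and y: "y \<in> hcarrier H"
  shows "cmod \<langle>x, y\<rangle> \<le> hnorm H x * hnorm H y"
proof (cases "y = 0")
  case True
  then show ?thesis using x hnorm_eq_0[of 0] by simp
next
  case False
  then have pos: "hnorm H y > 0" using y hnorm_eq_0 hnorm_ge_0 by (metis less_eq_real_def)
  have "0 \<le> (hnorm H x)\<^sup>2 - (cmod \<langle>x, y\<rangle>)\<^sup>2 / (hnorm H y)\<^sup>2"
    using minus_projection[OF x y False] by (metis zero_le_power2)
  then have "(cmod \<langle>x, y\<rangle>)\<^sup>2 \<le> (hnorm H x * hnorm H y)\<^sup>2"
    using pos by (simp add: field_simps)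
  then show ?thesis
    using x y hnorm_ge_0 by (meson mult_nonneg_nonneg power2_le_imp_le)
qed

lemma hnorm_triangle:
  assumes x: "x \<in> hcarrier H" and y: "y \<in> hcarrier H"
  shows "hnorm H (x + y) \<le> hnorm H x + hnorm H y"
proof -
  have "(hnorm H (x + y))\<^sup>2 = (hnorm H x)\<^sup>2 + 2 * Re \<langle>x, y\<rangle> + (hnorm H y)\<^sup>2"
    using x y inner_commute[of x y] by (simp add: hnorm_sq inner_simps)
  also have "\<dots> \<le> (hnorm H x)\<^sup>2 + 2 * (hnorm H x * hnorm H y) + (hnorm H y)\<^sup>2"
    using Cauchy_Schwarz[OF x y] complex_Re_le_cmod[of "\<langle>x, y\<rangle>"] by simp
  also have "\<dots> = (hnorm H x + hnorm H y)\<^sup>2" by (simp add: power2_eq_square algebra_simps)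
  finally show ?thesis
    using x y hnorm_ge_0 by (meson add_nonneg_nonneg power2_le_imp_le)
qed

lemma hnorm_triangle3:
  assumes "x \<in> hcarrier H" "y \<in> hcarrier H" "z \<in> hcarrier H"
  shows "hnorm H (x - z) \<le> hnorm H (x - y) + hnorm H (y - z)"
  using hnorm_triangle[of "x - y" "y - z"] assms by simp

lemma parallelogram:
  assumes "x \<in> hcarrier H" "y \<in> hcarrier H"
  shows "(hnorm H (x + y))\<^sup>2 + (hnorm H (x - y))\<^sup>2 = 2 * (hnorm H x)\<^sup>2 + 2 * (hnorm H y)\<^sup>2"
  using assms by (simp add: hnorm_sq inner_simps)

lemma hnorm_le_of_functional:
  assumes g: "g \<in> hcarrier H" and C: "C \<ge> 0" and b: "\<And>h. h \<in> hcarrier H \<Longrightarrow> cmod \<langle>h, g\<rangle> \<le> C * hnorm H h"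
  shows "hnorm H g \<le> C"
proof -
  have "(hnorm H g)\<^sup>2 \<le> C * hnorm H g"
    using b[OF g] inner_self[OF g] by (simp add: norm_power)
  then show ?thesis
    using hnorm_ge_0[OF g] C by (cases "hnorm H g = 0") (auto simp: power2_eq_square)
qed

lemma eq_of_inner_eq:
  assumes "g \<in> hcarrier H" "k \<in> hcarrier H" "\<And>h. h \<in> hcarrier H \<Longrightarrow> \<langle>h, g\<rangle> = \<langle>h, k\<rangle>"
  shows "g = k"
proof -
  have "\<langle>g - k, g - k\<rangle> = 0"
    using assms(3)[of "g - k"] assms(1,2) by (simp add: inner_diff_right)
  then show ?thesis using inner_self_0[of "g - k"] assms(1,2) by simp
qed

lemma inner_tendsto:
  assumes "\<And>n. s n \<in> hcarrier H" "\<And>n. t n \<in> hcarrier H" and x: "x \<in> hcarrier H" and y: "y \<in> hcarrier H"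
    and s: "((\<lambda>n. hnorm H (s n - x)) \<longlongrightarrow> 0) F" and t: "((\<lambda>n. hnorm H (t n - y)) \<longlongrightarrow> 0) F"
  shows "((\<lambda>n. \<langle>s n, t n\<rangle>) \<longlongrightarrow> \<langle>x, y\<rangle>) F"
proof -
  have est: "norm (\<langle>s n, t n\<rangle> - \<langle>x, y\<rangle>) \<le>
      hnorm H (s n - x) * hnorm H (t n - y) + hnorm H (s n - x) * hnorm H y + hnorm H x * hnorm H (t n - y)" for n
  proof -
    have "\<langle>s n, t n\<rangle> - \<langle>x, y\<rangle> = \<langle>s n - x, t n - y\<rangle> + \<langle>s n - x, y\<rangle> + \<langle>x, t n - y\<rangle>"
      using assms by (simp add: inner_simps)
    also have "norm \<dots> \<le> norm \<langle>s n - x, t n - y\<rangle> + norm \<langle>s n - x, y\<rangle> + norm \<langle>x, t n - y\<rangle>"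
      by (meson add_mono norm_triangle_le order_refl)
    also have "\<dots> \<le> hnorm H (s n - x) * hnorm H (t n - y) + hnorm H (s n - x) * hnorm H y + hnorm H x * hnorm H (t n - y)"
      using assms by (intro add_mono Cauchy_Schwarz) auto
    finally show ?thesis .
  qed
  have "((\<lambda>n. hnorm H (s n - x) * hnorm H (t n - y) + hnorm H (s n - x) * hnorm H y + hnorm H x * hnorm H (t n - y))
      \<longlongrightarrow> 0 * 0 + 0 * hnorm H y + hnorm H x * 0) F"
    by (intro tendsto_intros s t)
  then have "((\<lambda>n. \<langle>s n, t n\<rangle> - \<langle>x, y\<rangle>) \<longlongrightarrow> 0) F"
    by (intro Lim_null_comparison[OF always_eventually[OF allI[OF est]]]) simp
  then show ?thesis by (simp add: LIM_zero_iff)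
qed

text \<open>The subspace is not assumed closed, so the nearest point \<open>p\<close> exists only as a limit of a minimizing sequence.
  This form serves both as the projection onto closed subspaces and as a density criterion.\<close>

lemma projection_limit:
  assumes W: "complex_vector.subspace W" "W \<subseteq> hcarrier H" and x: "x \<in> hcarrier H"
  obtains p s where "p \<in> hcarrier H" "\<And>n::nat. s n \<in> W" "(\<lambda>n. hnorm H (s n - p)) \<longlonglongrightarrow> 0"
    "\<And>w. w \<in> W \<Longrightarrow> \<langle>x - p, w\<rangle> = 0"
proof -
  define d where "d = (INF w\<in>W. (hnorm H (x - w))\<^sup>2)"
  have W0: "0 \<in> W" using W(1) by (rule complex_vector.subspace_0)
  have bdd: "bdd_below ((\<lambda>w. (hnorm H (x - w))\<^sup>2) ` W)" by (intro bdd_belowI[of _ 0]) auto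
  have lower: "d \<le> (hnorm H (x - w))\<^sup>2" if "w \<in> W" for w
    unfolding d_def using bdd that by (rule cINF_lower)
  have "\<exists>w\<in>W. (hnorm H (x - w))\<^sup>2 < d + 1 / Suc n" for n
  proof -
    have "d < d + 1 / Suc n" by simp
    then show ?thesis
      unfolding d_def using cINF_less_iff[OF _ bdd] W0 by blast
  qed
  then obtain s where s: "\<And>n. s n \<in> W" "\<And>n. (hnorm H (x - s n))\<^sup>2 < d + 1 / Suc n" by metis
  have sH: "s n \<in> hcarrier H" for n using s(1) W(2) by blast
  have close: "(hnorm H (s i - s j))\<^sup>2 \<le> 2 / Suc i + 2 / Suc j" for i j
  proof -
    \<comment> \<open>the midpoint is no nearer than the infimum, so the parallelogram law bounds the distance\<close>
    define m where "m = (1/2) *\<^sub>C (s i + s j)"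
    have m: "m \<in> W" unfolding m_def using W(1) s(1)
      by (simp add: complex_vector.subspace_scale complex_vector.subspace_add)
    then have mH: "m \<in> hcarrier H" using W(2) by blast
    have two: "2 *\<^sub>C y = y + y" for y :: 'h
      using scaleC_add_left[of 1 1 y] by (simp add: scaleC_one)
    have "2 *\<^sub>C m = s i + s j" by (simp add: m_def scaleC_scaleC scaleC_one)
    then have "(x - s i) + (x - s j) = 2 *\<^sub>C (x - m)"
      by (simp add: two algebra_simps)
    then have "hnorm H ((x - s i) + (x - s j)) = 2 * hnorm H (x - m)"
      using x mH by (simp add: hnorm_scale)
    then have a: "(hnorm H ((x - s i) + (x - s j)))\<^sup>2 \<ge> 4 * d"
      using lower[OF m] by (simp add: power_mult_distrib)
    have "(x - s i) - (x - s j) = s j - s i" by simp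
    then have "(hnorm H ((x - s i) - (x - s j)))\<^sup>2 = (hnorm H (s i - s j))\<^sup>2"
      using hnorm_diff_commute[OF sH sH] by simp
    then show ?thesis
      using parallelogram[of "x - s i" "x - s j"] a s(2)[of i] s(2)[of j] x sH by simp
  qed
  have "\<exists>N. \<forall>i\<ge>N. \<forall>j\<ge>N. hnorm H (s i - s j) < e" if "e > 0" for e
  proof -
    obtain N :: nat where N: "4 / e\<^sup>2 < N" using reals_Archimedean2 by blast
    have Npos: "real N > 0" using N that by (smt (verit) divide_pos_pos zero_less_power)
    have "hnorm H (s i - s j) < e" if "i \<ge> N" "j \<ge> N" for i j
    proof -
      have i: "2 / real (Suc i) < 2 / N" and j: "2 / real (Suc j) < 2 / N"
        using that Npos by (auto intro!: divide_strict_left_mono)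
      have "(hnorm H (s i - s j))\<^sup>2 < 4 / N" using close[of i j] i j by simp
      also have "4 / N < e\<^sup>2" using N Npos \<open>e > 0\<close> by (simp add: field_simps)
      finally show ?thesis using \<open>e > 0\<close> by (simp add: power_less_imp_less_base)
    qed
    then show ?thesis by blast
  qed
  then obtain p where p: "p \<in> hcarrier H" "(\<lambda>n. hnorm H (s n - p)) \<longlonglongrightarrow> 0"
    using complete[of s] sH by blast
  have "\<langle>x - p, w\<rangle> = 0" if w: "w \<in> W" for w
  proof (rule ccontr)
    assume ne: "\<langle>x - p, w\<rangle> \<noteq> 0"
    have wH: "w \<in> hcarrier H" using w W(2) by blast
    have "w \<noteq> 0" using ne x p by auto
    then obtain c where c: "(hnorm H ((x - p) - c *\<^sub>C w))\<^sup>2 = (hnorm H (x - p))\<^sup>2 - (cmod \<langle>x - p, w\<rangle>)\<^sup>2 / (hnorm H w)\<^sup>2"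
      using minus_projection[of "x - p" w] x p wH by auto
    have lim: "(\<lambda>n. (hnorm H ((x - s n) - c *\<^sub>C w))\<^sup>2) \<longlonglongrightarrow> (hnorm H ((x - p) - c *\<^sub>C w))\<^sup>2"
      and lim2: "(\<lambda>n. (hnorm H (x - s n))\<^sup>2) \<longlonglongrightarrow> (hnorm H (x - p))\<^sup>2"
    proof -
      have "hnorm H ((y - s n) - (y - p)) = hnorm H (s n - p)" if "y \<in> hcarrier H" for y n
        using hnorm_diff_commute[OF sH p(1)] by simp
      then have *: "(\<lambda>n. (hnorm H (y - s n))\<^sup>2) \<longlonglongrightarrow> (hnorm H (y - p))\<^sup>2" if "y \<in> hcarrier H" for y
        using that inner_tendsto[of "\<lambda>n. y - s n" "\<lambda>n. y - s n" "y - p" "y - p"] sH p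
        by (auto simp: hnorm_sq intro!: tendsto_Re)
      show "(\<lambda>n. (hnorm H (x - s n))\<^sup>2) \<longlonglongrightarrow> (hnorm H (x - p))\<^sup>2" by (rule *[OF x])
      have "x - a - c *\<^sub>C w = (x - c *\<^sub>C w) - a" for a by (simp add: algebra_simps)
      then show "(\<lambda>n. (hnorm H ((x - s n) - c *\<^sub>C w))\<^sup>2) \<longlonglongrightarrow> (hnorm H ((x - p) - c *\<^sub>C w))\<^sup>2"
        using *[of "x - c *\<^sub>C w"] x wH by (simp only: diff_mem scale_mem simp_thms)
    qed
    have "x - s n - c *\<^sub>C w = x - (s n + c *\<^sub>C w)" for n by (simp add: algebra_simps)
    moreover have "s n + c *\<^sub>C w \<in> W" for n
      using W(1) s(1) w by (simp add: complex_vector.subspace_scale complex_vector.subspace_add)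
    ultimately have "d \<le> (hnorm H ((x - s n) - c *\<^sub>C w))\<^sup>2" for n using lower by metis
    then have "d \<le> (hnorm H ((x - p) - c *\<^sub>C w))\<^sup>2" using lim by (meson LIMSEQ_le_const)
    moreover have "(hnorm H (x - p))\<^sup>2 \<le> d"
    proof (rule LIMSEQ_le[OF lim2])
      show "(\<lambda>n. d + 1 / Suc n) \<longlonglongrightarrow> d"
        using tendsto_add[OF tendsto_const[of d] LIMSEQ_inverse_real_of_nat] by (simp add: inverse_eq_divide)
      show "\<exists>N. \<forall>n\<ge>N. (hnorm H (x - s n))\<^sup>2 \<le> d + 1 / Suc n" using s(2) less_imp_le by blast
    qed
    moreover have "(cmod \<langle>x - p, w\<rangle>)\<^sup>2 / (hnorm H w)\<^sup>2 > 0"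
      using ne \<open>w \<noteq> 0\<close> wH hnorm_eq_0 by simp
    ultimately show False using c by simp
  qed
  then show ?thesis using that p s(1) by blast
qed

lemma orthogonal_decomposition:
  assumes W: "complex_vector.subspace W" "hclosed H W" and x: "x \<in> hcarrier H"
  obtains p where "p \<in> W" "\<And>w. w \<in> W \<Longrightarrow> \<langle>x - p, w\<rangle> = 0"
proof -
  have WH: "W \<subseteq> hcarrier H" using W(2) by (simp add: hclosed_def)
  obtain p s where "p \<in> hcarrier H" "\<And>n::nat. s n \<in> W" "(\<lambda>n. hnorm H (s n - p)) \<longlonglongrightarrow> 0"
    "\<And>w. w \<in> W \<Longrightarrow> \<langle>x - p, w\<rangle> = 0"
    using projection_limit[OF W(1) WH x] by blast
  then show ?thesis using that W(2) unfolding hclosed_def by blast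
qed

lemma subspace_annihilator:
  assumes G: "G \<subseteq> hcarrier H"
  shows "complex_vector.subspace {x \<in> hcarrier H. \<forall>g\<in>G. \<langle>x, g\<rangle> = 0}"
    and "hclosed H {x \<in> hcarrier H. \<forall>g\<in>G. \<langle>x, g\<rangle> = 0}"
proof -
  show "complex_vector.subspace {x \<in> hcarrier H. \<forall>g\<in>G. \<langle>x, g\<rangle> = 0}"
    using G by (auto intro!: complex_vector.subspaceI simp: inner_simps subset_iff)
  have "\<langle>x, g\<rangle> = 0" if x: "x \<in> hcarrier H" and g: "g \<in> G" and s: "\<And>n::nat. s n \<in> hcarrier H" "\<And>n. \<langle>s n, g\<rangle> = 0"
    and lim: "(\<lambda>n. hnorm H (s n - x)) \<longlonglongrightarrow> 0" for x g s
  proof -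
    have gH: "g \<in> hcarrier H" using g G by blast
    then have "(\<lambda>n. \<langle>s n, g\<rangle>) \<longlonglongrightarrow> \<langle>x, g\<rangle>"
      using inner_tendsto[of s "\<lambda>_. g" x g sequentially] s x lim hnorm_eq_0[of 0] by simp
    then show ?thesis using s(2) by (simp add: LIMSEQ_const_iff)
  qed
  then show "hclosed H {x \<in> hcarrier H. \<forall>g\<in>G. \<langle>x, g\<rangle> = 0}"
    unfolding hclosed_def by blast
qed

text \<open>The representing vector is a multiple of the component of any vector outside the kernel that is orthogonal to
  the kernel.\<close>

lemma Riesz:
  assumes add: "\<And>x y. x \<in> hcarrier H \<Longrightarrow> y \<in> hcarrier H \<Longrightarrow> f (x + y) = f x + f y"
    and scale: "\<And>c x. x \<in> hcarrier H \<Longrightarrow> f (c *\<^sub>C x) = c * f x"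
    and bound: "\<And>x. x \<in> hcarrier H \<Longrightarrow> cmod (f x) \<le> C * hnorm H x"
  obtains k where "k \<in> hcarrier H" "\<And>x. x \<in> hcarrier H \<Longrightarrow> f x = \<langle>x, k\<rangle>"
proof (cases "\<forall>x\<in>hcarrier H. f x = 0")
  case True
  then show ?thesis using that[of 0] by simp
next
  case False
  then obtain x where x: "x \<in> hcarrier H" "f x \<noteq> 0" by blast
  define W where "W = {y \<in> hcarrier H. f y = 0}"
  have f0: "f 0 = 0" using scale[of 0 0] complex_vector.scale_zero_left[of "0::'h"] by simp
  have fdiff: "f (y - z) = f y - f z" if "y \<in> hcarrier H" "z \<in> hcarrier H" for y z
    using add[of "y - z" z] that by simp
  have sub: "complex_vector.subspace W"
    by (auto intro!: complex_vector.subspaceI simp: W_def add scale f0)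
  have "hclosed H W" unfolding hclosed_def
  proof (intro conjI allI impI, goal_cases)
    case 1 then show ?case by (auto simp: W_def)
  next
    case (2 s y)
    then have y: "y \<in> hcarrier H" and s: "\<And>n. s n \<in> hcarrier H" "\<And>n. f (s n) = 0" by (auto simp: W_def)
    have "cmod (f y) \<le> C * hnorm H (s n - y)" for n
      using bound[of "s n - y"] s y by (simp add: fdiff)
    moreover have "(\<lambda>n. C * hnorm H (s n - y)) \<longlonglongrightarrow> C * 0" using 2 by (intro tendsto_intros) auto
    ultimately have "cmod (f y) \<le> C * 0" by (meson LIMSEQ_le_const)
    then show ?case using y by (simp add: W_def)
  qed
  then obtain p where p: "p \<in> W" "\<And>w. w \<in> W \<Longrightarrow> \<langle>x - p, w\<rangle> = 0"
    using orthogonal_decomposition[OF sub _ x(1)] by blast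
  define q where "q = x - p"
  have q: "q \<in> hcarrier H" "f q \<noteq> 0" using p x by (auto simp: q_def W_def fdiff)
  have qn: "\<langle>q, q\<rangle> \<noteq> 0" using q inner_self_0 f0 by blast
  show ?thesis
  proof (rule that[of "cnj (f q / \<langle>q, q\<rangle>) *\<^sub>C q"])
    fix y assume y: "y \<in> hcarrier H"
    define c where "c = f y / f q"
    have "y - c *\<^sub>C q \<in> W" using y q by (simp add: W_def fdiff scale c_def)
    then have "\<langle>q, y - c *\<^sub>C q\<rangle> = 0" using p(2) by (simp add: q_def)
    then have "\<langle>y - c *\<^sub>C q, q\<rangle> = 0" using inner_commute[of q "y - c *\<^sub>C q"] y q by simp
    then have "\<langle>y, q\<rangle> = c * \<langle>q, q\<rangle>" using y q by (simp add: inner_simps)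
    then show "f y = \<langle>y, cnj (f q / \<langle>q, q\<rangle>) *\<^sub>C q\<rangle>"
      using y q qn by (simp add: inner_simps c_def)
  qed (use q in simp)
qed

text \<open>Banach--Steinhaus for functionals given by vectors, by the gliding hump: the \<open>n\<close>-th step has length
  \<open>3^-n\<close> and makes the \<open>n\<close>-th functional, of norm above \<open>(n + 1) 3^n\<close>, large; the sign is chosen so that
  the step does not cancel what was already there, and the later steps, of total length at most \<open>3^-n / 2\<close>,
  undo at most half of the gain.\<close>

lemma uniform_boundedness:
  assumes S: "S \<subseteq> hcarrier H" and b: "\<And>h. h \<in> hcarrier H \<Longrightarrow> \<exists>C. \<forall>k\<in>S. cmod \<langle>h, k\<rangle> \<le> C"
  obtains B where "B \<ge> 0" "\<And>k. k \<in> S \<Longrightarrow> hnorm H k \<le> B"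
proof -
  have "\<exists>B. \<forall>k\<in>S. hnorm H k \<le> B"
  proof (rule ccontr)
    assume "\<nexists>B. \<forall>k\<in>S. hnorm H k \<le> B"
    then have "\<forall>n::nat. \<exists>k\<in>S. hnorm H k > (real n + 1) * 3 ^ n" by (metis not_le)
    then obtain k where k: "\<And>n. k n \<in> S" "\<And>n. hnorm H (k n) > (real n + 1) * 3 ^ n" by metis
    have kH: "k n \<in> hcarrier H" for n using k(1) S by blast
    have kpos: "hnorm H (k n) > 0" for n
      using k(2)[of n] by (smt (verit) mult_pos_pos of_nat_0_le_iff zero_less_power)
    define u where "u n = (of_real (1 / (3 ^ n * hnorm H (k n)))) *\<^sub>C k n" for n
    have uH: "u n \<in> hcarrier H" for n by (simp add: u_def kH)
    have un: "hnorm H (u n) = 1 / 3 ^ n" for n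
      using kpos[of n] by (simp add: u_def hnorm_scale kH norm_divide norm_mult norm_power)
    define step where "step n x = (if cmod \<langle>x + u n, k n\<rangle> \<ge> cmod \<langle>x - u n, k n\<rangle> then x + u n else x - u n)" for n x
    define x where "x = rec_nat 0 step"
    have x0: "x 0 = 0" and xS: "x (Suc n) = step n (x n)" for n by (simp_all add: x_def)
    have xH: "x n \<in> hcarrier H" for n by (induction n) (simp_all add: x0 xS step_def uH)
    have big: "cmod \<langle>x (Suc n), k n\<rangle> \<ge> hnorm H (k n) / 3 ^ n" for n
    proof -
      have "\<langle>u n, k n\<rangle> = of_real (hnorm H (k n) / 3 ^ n)"
        using kpos[of n] by (simp add: u_def inner_simps kH inner_self power2_eq_square)
      then have a: "cmod \<langle>u n, k n\<rangle> = hnorm H (k n) / 3 ^ n" using kpos[of n]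
        by (simp add: norm_divide norm_power)
      have "2 * \<langle>u n, k n\<rangle> = \<langle>x n + u n, k n\<rangle> - \<langle>x n - u n, k n\<rangle>"
        by (simp add: inner_simps xH uH kH)
      then have "2 * cmod \<langle>u n, k n\<rangle> \<le> cmod \<langle>x n + u n, k n\<rangle> + cmod \<langle>x n - u n, k n\<rangle>"
        by (metis norm_mult norm_numeral norm_triangle_ineq4)
      then show ?thesis unfolding xS step_def a[symmetric] by auto
    qed
    have inc: "hnorm H (x (Suc n) - x n) \<le> 1 / 3 ^ n" for n
    proof -
      have "x (Suc n) - x n = u n \<or> x (Suc n) - x n = 0 - u n" by (auto simp: xS step_def)
      then show ?thesis using un[of n] hnorm_diff_commute[of 0 "u n"] uH[of n] by auto
    qed
    have tail: "hnorm H (x (n + m) - x n) \<le> (3 / 2) * (1 / 3 ^ n - 1 / 3 ^ (n + m))" for n m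
    proof (induction m)
      case 0 then show ?case using hnorm_eq_0[of 0] by simp
    next
      case (Suc m)
      have "hnorm H (x (n + Suc m) - x n) \<le> hnorm H (x (Suc (n + m)) - x (n + m)) + hnorm H (x (n + m) - x n)"
        using hnorm_triangle3[OF xH xH xH] by simp
      also have "\<dots> \<le> 1 / 3 ^ (n + m) + (3 / 2) * (1 / 3 ^ n - 1 / 3 ^ (n + m))"
        using inc[of "n + m"] Suc by linarith
      also have "\<dots> = (3 / 2) * (1 / 3 ^ n - 1 / 3 ^ (n + Suc m))" by (simp add: field_simps)
      finally show ?case .
    qed
    have tail': "hnorm H (x j - x i) \<le> (3 / 2) * (1 / 3 ^ i)" if "i \<le> j" for i j
    proof -
      have "(3 / 2) * (1 / 3 ^ i - 1 / 3 ^ (i + (j - i))) \<le> (3 / 2) * (1 / 3 ^ i :: real)" by simp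
      then show ?thesis using tail[of i "j - i"] that by (simp only: le_add_diff_inverse)
    qed
    have geo: "(\<lambda>n. 3 / 2 * (1 / 3 ^ n) :: real) \<longlonglongrightarrow> 0"
      using LIMSEQ_power_zero[of "1/3 :: real"] by (intro tendsto_mult_right_zero) (simp add: power_one_over)
    have "\<exists>N. \<forall>i\<ge>N. \<forall>j\<ge>N. hnorm H (x i - x j) < e" if "e > 0" for e
    proof -
      obtain N where N: "3 / 2 * (1 / 3 ^ N) < e / 2"
        using geo \<open>e > 0\<close> by (metis (no_types, lifting) half_gt_zero_iff order_tendstoD(2) eventually_sequentially order_refl)
      have "hnorm H (x i - x j) < e" if "i \<ge> N" "j \<ge> N" for i j
        using hnorm_triangle3[OF xH[of i] xH[of N] xH[of j]] tail'[OF that(1)] tail'[OF that(2)]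
          hnorm_diff_commute[OF xH[of N] xH[of j]] N by linarith
      then show ?thesis by blast
    qed
    then obtain y where y: "y \<in> hcarrier H" "(\<lambda>n. hnorm H (x n - y)) \<longlonglongrightarrow> 0"
      using complete[of x] xH by blast
    have far: "hnorm H (y - x (Suc n)) \<le> (1 / 2) * (1 / 3 ^ n)" for n
    proof -
      have "(\<lambda>m. hnorm H (x m - y) + (3 / 2) * (1 / 3 ^ Suc n)) \<longlonglongrightarrow> 0 + (3 / 2) * (1 / 3 ^ Suc n)"
        by (intro tendsto_intros y)
      moreover have "hnorm H (y - x (Suc n)) \<le> hnorm H (x m - y) + (3 / 2) * (1 / 3 ^ Suc n)" if "m \<ge> Suc n" for m
        using hnorm_triangle3[OF y(1) xH[of m] xH[of "Suc n"]] tail'[OF that] hnorm_diff_commute[OF y(1) xH[of m]]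
        by linarith
      ultimately have "hnorm H (y - x (Suc n)) \<le> 0 + (3 / 2) * (1 / 3 ^ Suc n)"
        by (meson LIMSEQ_le_const)
      then show ?thesis by simp
    qed
    have "cmod \<langle>y, k n\<rangle> \<ge> (real n + 1) / 2" for n
    proof -
      have "cmod \<langle>y - x (Suc n), k n\<rangle> \<le> (1 / 2) * (1 / 3 ^ n) * hnorm H (k n)"
        using Cauchy_Schwarz[of "y - x (Suc n)" "k n"] far[of n] y(1) xH kH kpos[of n]
        by (meson diff_mem dual_order.trans less_imp_le mult_right_mono)
      moreover have "\<langle>x (Suc n), k n\<rangle> = \<langle>y, k n\<rangle> - \<langle>y - x (Suc n), k n\<rangle>" using y(1) xH kH by (simp add: inner_simps)
      then have "cmod \<langle>x (Suc n), k n\<rangle> \<le> cmod \<langle>y, k n\<rangle> + cmod \<langle>y - x (Suc n), k n\<rangle>" by (metis norm_triangle_ineq4)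
      ultimately have "cmod \<langle>y, k n\<rangle> \<ge> hnorm H (k n) / 3 ^ n / 2" using big[of n] by simp
      moreover have "hnorm H (k n) / 3 ^ n \<ge> real n + 1" using k(2)[of n] by (simp add: field_simps)
      ultimately show ?thesis by simp
    qed
    moreover obtain C where "\<forall>k\<in>S. cmod \<langle>y, k\<rangle> \<le> C" using b y(1) by blast
    then have "cmod \<langle>y, k n\<rangle> \<le> C" for n using k(1) by blast
    moreover obtain n :: nat where "C * 2 < n" using reals_Archimedean2 by blast
    ultimately have "(real n + 1) / 2 \<le> C" "C < (real n + 1) / 2"
      using order_trans[of "(real n + 1) / 2" "cmod \<langle>y, k n\<rangle>" C] by simp_all
    then show False by simp
  qed
  then obtain B where "\<And>k. k \<in> S \<Longrightarrow> hnorm H k \<le> B" by blast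
  then show ?thesis using that[of "max B 0"] by (meson max.cobounded2 max.coboundedI1)
qed

end

section \<open>Holomorphy along complex lines\<close>

text \<open>Holomorphy in several variables is used in the form of continuity and differentiability along complex
  lines, because this form visibly passes to directional derivatives and reduces statements to one variable.\<close>

definition line_holo :: "(complex ^ 'm::finite \<Rightarrow> complex) \<Rightarrow> (complex ^ 'm) set \<Rightarrow> bool" where
  "line_holo f V \<longleftrightarrow> continuous_on V f \<and>
     (\<forall>v\<in>V. \<forall>b. (\<lambda>\<tau>. f (v + \<tau> *s b)) field_differentiable (at 0))"

definition ddir :: "complex ^ 'm::finite \<Rightarrow> (complex ^ 'm \<Rightarrow> complex) \<Rightarrow> complex ^ 'm \<Rightarrow> complex" where
  "ddir b f v = deriv (\<lambda>\<tau>. f (v + \<tau> *s b)) 0"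

lemma bounded_linear_smult_vec: "bounded_linear (\<lambda>\<tau>. \<tau> *s (b :: complex ^ 'm::finite))"
proof -
  have "linear (\<lambda>\<tau>. \<tau> *s b)"
    by (rule linearI) (auto simp: vec_eq_iff algebra_simps)
  then show ?thesis by (rule linear_conv_bounded_linear[THEN iffD1])
qed

lemma norm_smult_vec: "norm (\<tau> *s (b :: complex ^ 'm::finite)) = cmod \<tau> * norm b"
  by (simp add: norm_vec_def norm_mult L2_set_right_distrib)

lemma continuous_smult_vec [continuous_intros]:
  "continuous F g \<Longrightarrow> continuous F (\<lambda>x. g x *s (b :: complex ^ 'm::finite))"
  "continuous_on S g \<Longrightarrow> continuous_on S (\<lambda>x. g x *s (b :: complex ^ 'm::finite))"
  by (auto intro: bounded_linear.continuous[OF bounded_linear_smult_vec]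
      bounded_linear.continuous_on[OF bounded_linear_smult_vec])

lemma open_line: "open V \<Longrightarrow> open {\<tau>. v + \<tau> *s (b :: complex ^ 'm::finite) \<in> V}"
proof -
  assume "open V"
  moreover have "continuous_on UNIV (\<lambda>\<tau>. v + \<tau> *s b)"
    by (intro continuous_on_add continuous_on_const continuous_smult_vec continuous_on_id)
  ultimately show ?thesis using open_vimage[of V "\<lambda>\<tau>. v + \<tau> *s b"] by (simp add: vimage_def)
qed

lemma convex_line:
  assumes "convex C" shows "convex {\<tau>. v + \<tau> *s (b :: complex ^ 'm::finite) \<in> C}"
proof -
  have "{\<tau>. v + \<tau> *s b \<in> C} = (\<lambda>\<tau>. \<tau> *s b) -` ((\<lambda>u. - v + u) ` C)"
    by (auto simp: image_iff algebra_simps)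
  then show ?thesis
    by (simp only: convex_linear_vimage[OF bounded_linear.linear[OF bounded_linear_smult_vec] convex_translation[OF assms]])
qed

lemma shift_line: "(p :: complex ^ 'm::finite) + \<tau>0 *s b + \<tau> *s b = p + (\<tau>0 + \<tau>) *s b"
  by (simp add: algebra_simps)

lemma field_differentiable_shift:
  assumes "(\<lambda>\<tau>. f (\<tau>0 + \<tau>)) field_differentiable (at 0)"
  shows "f field_differentiable (at \<tau>0)"
  using assms DERIV_at_within_shift[of f _ \<tau>0 0 UNIV] unfolding field_differentiable_def by auto

lemma line_holo_field_differentiable:
  assumes "line_holo f V" "v + \<tau>0 *s b \<in> V"
  shows "(\<lambda>\<tau>. f (v + \<tau> *s b)) field_differentiable (at \<tau>0)"
proof (rule field_differentiable_shift)
  have "(\<lambda>\<tau>. f ((v + \<tau>0 *s b) + \<tau> *s b)) field_differentiable (at 0)"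
    using assms by (simp add: line_holo_def)
  then show "(\<lambda>\<tau>. f (v + (\<tau>0 + \<tau>) *s b)) field_differentiable (at 0)"
    by (simp only: shift_line)
qed

lemma line_holo_holomorphic:
  "line_holo f V \<Longrightarrow> open V \<Longrightarrow> (\<And>\<tau>. \<tau> \<in> S \<Longrightarrow> v + \<tau> *s b \<in> V) \<Longrightarrow>
    (\<lambda>\<tau>. f (v + \<tau> *s b)) holomorphic_on S"
  unfolding holomorphic_on_def
  by (intro ballI field_differentiable_at_within[OF line_holo_field_differentiable])

lemma ddir_DERIV:
  assumes "line_holo f V" "v \<in> V"
  shows "((\<lambda>\<tau>. f (v + \<tau> *s b)) has_field_derivative ddir b f v) (at 0)"
  using assms unfolding ddir_def line_holo_def by (auto intro: field_differentiable_derivI)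

lemma holo_on_line_DERIV:
  assumes "holo_on f V" "v \<in> V"
  obtains D where "linear D" "\<And>c u. D (c *s u) = c * D u"
    "\<And>b. ((\<lambda>\<tau>. f (v + \<tau> *s b)) has_field_derivative D b) (at 0)"
proof -
  obtain D where D: "(f has_derivative D) (at v)" "\<And>c u. D (c *s u) = c * D u"
    using assms by (auto simp: holo_on_def)
  have "((\<lambda>\<tau>. f (v + \<tau> *s b)) has_field_derivative D b) (at 0)" for b
  proof -
    have "((\<lambda>\<tau>. v + \<tau> *s b) has_derivative (\<lambda>\<tau>. \<tau> *s b)) (at 0)"
      by (auto intro!: derivative_eq_intros bounded_linear_imp_has_derivative bounded_linear_smult_vec)
    then have "((\<lambda>\<tau>. f (v + \<tau> *s b)) has_derivative (\<lambda>\<tau>. D (\<tau> *s b))) (at 0)"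
      using D(1) by (intro has_derivative_compose[of _ _ 0 UNIV f D]) (auto simp: has_derivative_at_withinI)
    then show ?thesis
      by (simp add: D(2) has_field_derivative_def mult.commute[of _ "D b"])
  qed
  then show ?thesis using that has_derivative_linear[OF D(1)] D(2) by blast
qed

lemma holo_on_line_holo:
  assumes "holo_on f V" shows "line_holo f V"
  unfolding line_holo_def
proof (intro conjI ballI allI)
  show "continuous_on V f"
    using assms unfolding holo_on_def
    by (metis continuous_at_imp_continuous_on has_derivative_continuous)
  show "(\<lambda>\<tau>. f (v + \<tau> *s b)) field_differentiable at 0" if "v \<in> V" for v b
    using holo_on_line_DERIV[OF assms that] unfolding field_differentiable_def by metis
qed

lemma ddir_linear:
  assumes "holo_on f V" "v \<in> V"
  shows "ddir b f v = (\<Sum>i\<in>UNIV. b $ i * ddir (axis i 1) f v)"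
proof -
  obtain D where D: "linear D" "\<And>c u. D (c *s u) = c * D u"
    "\<And>b. ((\<lambda>\<tau>. f (v + \<tau> *s b)) has_field_derivative D b) (at 0)"
    using holo_on_line_DERIV[OF assms] by blast
  have dd: "ddir b f v = D b" for b
    unfolding ddir_def by (rule DERIV_imp_deriv[OF D(3)])
  have "D b = D (\<Sum>i\<in>UNIV. (b $ i) *s axis i 1)" by (simp only: basis_expansion)
  also have "\<dots> = (\<Sum>i\<in>UNIV. b $ i * D (axis i 1))"
    by (simp only: linear_sum[OF D(1)] D(2))
  finally show ?thesis by (simp add: dd)
qed

text \<open>The constants come from Cauchy's inequality on discs of radius \<open>r / 2\<close> with centres in the disc of radius
  \<open>r / 2\<close>, inserted into Taylor's formula.\<close>

lemma cauchy_estimates: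
  assumes holf: "f holomorphic_on S" and S: "open S" "cball 0 r \<subseteq> S" and r: "r > 0"
    and B: "\<And>\<tau>. cmod \<tau> \<le> r \<Longrightarrow> cmod (f \<tau>) \<le> B"
  shows "cmod (deriv f 0) \<le> B / r"
    and "cmod \<tau> \<le> r / 2 \<Longrightarrow> cmod (f \<tau> - f 0) \<le> 2 * B / r * cmod \<tau>"
    and "cmod \<tau> \<le> r / 2 \<Longrightarrow> cmod (f \<tau> - f 0 - \<tau> * deriv f 0) \<le> 8 * B / r\<^sup>2 * (cmod \<tau>)\<^sup>2"
proof -
  have ineq: "norm ((deriv ^^ n) f \<xi>) \<le> fact n * B / (s ^ n)"
    if "cball \<xi> s \<subseteq> cball 0 r" "s > 0" for n \<xi> s
  proof (rule Cauchy_inequality)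
    show "f holomorphic_on ball \<xi> s"
      using holf by (rule holomorphic_on_subset) (use that S in \<open>auto simp: subset_iff\<close>)
    show "continuous_on (cball \<xi> s) f"
      by (rule holomorphic_on_imp_continuous_on, rule holomorphic_on_subset[OF holf]) (use that S in blast)
    show "norm (f x) \<le> B" if "norm (\<xi> - x) = s" for x
      using that \<open>cball \<xi> s \<subseteq> cball 0 r\<close> by (intro B) (auto simp: subset_iff dist_norm)
  qed (use that in auto)
  show "cmod (deriv f 0) \<le> B / r" using ineq[of 0 r 1] r by simp
  have half: "cball \<xi> (r / 2) \<subseteq> cball 0 r" if "cmod \<xi> \<le> r / 2" for \<xi>
  proof
    fix y assume "y \<in> cball \<xi> (r / 2)"
    then show "y \<in> cball 0 r" using that dist_triangle[of 0 y \<xi>] by (simp add: dist_norm)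
  qed
  have d: "((deriv ^^ i) f has_field_derivative (deriv ^^ Suc i) f x) (at x within cball 0 (r / 2))"
    if "x \<in> cball 0 (r / 2)" for i x
  proof -
    have "(deriv ^^ i) f holomorphic_on S" by (intro holomorphic_higher_deriv holf S)
    moreover have "x \<in> S" using that S(2) r by (auto simp: subset_iff)
    ultimately show ?thesis
      using S(1) holomorphic_derivI[of "(deriv ^^ i) f" S x] by (auto intro: has_field_derivative_at_within)
  qed
  have T: "cmod (f \<tau> - (\<Sum>i\<le>n. (deriv ^^ i) f 0 * (\<tau> - 0) ^ i / fact i)) \<le> (fact (Suc n) * B / (r / 2) ^ Suc n) * cmod (\<tau> - 0) ^ Suc n / fact n"
    if "cmod \<tau> \<le> r / 2" for n
  proof -
    have "cmod ((deriv ^^ 0) f \<tau> - (\<Sum>i\<le>n. (deriv ^^ i) f 0 * (\<tau> - 0) ^ i / fact i)) \<le> (fact (Suc n) * B / (r / 2) ^ Suc n) * cmod (\<tau> - 0) ^ Suc n / fact n"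
    proof (rule complex_Taylor[where f = "\<lambda>i. (deriv ^^ i) f" and S = "cball 0 (r / 2)"])
      show "cmod ((deriv ^^ Suc n) f x) \<le> fact (Suc n) * B / (r / 2) ^ Suc n" if "x \<in> cball 0 (r / 2)" for x
        by (rule ineq[OF half]) (use that r in auto)
    qed (use d that r in auto)
    then show ?thesis by simp
  qed
  show "cmod (f \<tau> - f 0) \<le> 2 * B / r * cmod \<tau>" if "cmod \<tau> \<le> r / 2"
    using T[OF that, of 0] by (simp add: mult.commute)
  show "cmod (f \<tau> - f 0 - \<tau> * deriv f 0) \<le> 8 * B / r\<^sup>2 * (cmod \<tau>)\<^sup>2" if "cmod \<tau> \<le> r / 2"
    using T[OF that, of 1] by (simp add: power2_eq_square algebra_simps)
qed

lemma segment_room: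
  fixes v b :: "complex ^ 'm::finite"
  assumes "open V" "v \<in> V"
  obtains \<rho> \<delta> where "\<rho> > 0" "\<delta> > 0" "cball v (2 * \<rho>) \<subseteq> V"
    "\<And>u \<tau>. u \<in> cball v \<rho> \<Longrightarrow> cmod \<tau> \<le> \<delta> \<Longrightarrow> u + \<tau> *s b \<in> cball v (2 * \<rho>)"
proof -
  obtain e where e: "e > 0" "cball v e \<subseteq> V" using assms open_contains_cball by blast
  define \<rho> where "\<rho> = e / 2"
  define \<delta> where "\<delta> = \<rho> / (norm b + 1)"
  have nb: "norm b + 1 > 0" by (smt (verit) norm_ge_zero)
  show ?thesis
  proof (rule that[of \<rho> \<delta>])
    show "\<rho> > 0" "\<delta> > 0" "cball v (2 * \<rho>) \<subseteq> V" using e nb by (auto simp: \<rho>_def \<delta>_def)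
    fix u \<tau> assume u: "u \<in> cball v \<rho>" and t: "cmod \<tau> \<le> \<delta>"
    have "cmod \<tau> * norm b \<le> \<delta> * (norm b + 1)" using t order_trans[OF norm_ge_zero t] by (intro mult_mono) auto
    also have "\<dots> = \<rho>" using nb by (simp add: \<delta>_def)
    finally have "norm (\<tau> *s b) \<le> \<rho>" by (simp add: norm_smult_vec)
    moreover have "norm (v - u - \<tau> *s b) \<le> norm (v - u) + norm (\<tau> *s b)" by (rule norm_triangle_ineq4)
    ultimately show "u + \<tau> *s b \<in> cball v (2 * \<rho>)"
      using u by (simp add: dist_norm diff_diff_eq)
  qed
qed

text \<open>By Cauchy's estimates the difference quotients converge locally uniformly, and locally uniform limits of
  holomorphic functions are holomorphic.\<close>

lemma line_holo_ddir:
  assumes f: "line_holo f V" and V: "open V"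
  shows "line_holo (ddir b f) V"
proof -
  have main: "continuous (at v) (ddir b f) \<and>
      (\<forall>c. (\<lambda>\<tau>. ddir b f (v + \<tau> *s c)) field_differentiable (at 0))" if v: "v \<in> V" for v
  proof -
    obtain \<rho> \<delta> where \<rho>: "\<rho> > 0" "\<delta> > 0" "cball v (2 * \<rho>) \<subseteq> V"
      "\<And>u \<tau>. u \<in> cball v \<rho> \<Longrightarrow> cmod \<tau> \<le> \<delta> \<Longrightarrow> u + \<tau> *s b \<in> cball v (2 * \<rho>)"
      using segment_room[OF V v] by blast
    have sub: "cball v \<rho> \<subseteq> V" using \<rho> by (auto simp: subset_iff)
    have "continuous_on (cball v (2 * \<rho>)) f"
      using f \<rho>(3) continuous_on_subset by (auto simp: line_holo_def)
    then have "bounded (f ` cball v (2 * \<rho>))"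
      using compact_continuous_image compact_cball compact_imp_bounded by blast
    then obtain B where B: "\<And>u. u \<in> cball v (2 * \<rho>) \<Longrightarrow> cmod (f u) \<le> B"
      unfolding bounded_iff by blast
    define \<epsilon> :: "nat \<Rightarrow> real" where "\<epsilon> n = \<delta> / 2 * inverse (real (Suc n))" for n
    have \<epsilon>: "\<epsilon> n > 0" "\<epsilon> n \<le> \<delta> / 2" for n
      using \<rho>(2) by (auto simp: \<epsilon>_def field_simps)
    have \<epsilon>0: "\<epsilon> \<longlonglongrightarrow> 0"
      unfolding \<epsilon>_def using LIMSEQ_inverse_real_of_nat by (intro tendsto_mult_right_zero)
    define q where "q n u = (f (u + of_real (\<epsilon> n) *s b) - f u) / of_real (\<epsilon> n)" for n u
    have est: "cmod (q n u - ddir b f u) \<le> 8 * B / \<delta>\<^sup>2 * \<epsilon> n" if u: "u \<in> cball v \<rho>" for n u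
    proof -
      have "cmod (f (u + of_real (\<epsilon> n) *s b) - f (u + 0 *s b) - of_real (\<epsilon> n) * deriv (\<lambda>\<tau>. f (u + \<tau> *s b)) 0)
          \<le> 8 * B / \<delta>\<^sup>2 * (cmod (of_real (\<epsilon> n)))\<^sup>2"
      proof (rule cauchy_estimates(3)[of "\<lambda>\<tau>. f (u + \<tau> *s b)" "{\<tau>. u + \<tau> *s b \<in> V}"])
        show "(\<lambda>\<tau>. f (u + \<tau> *s b)) holomorphic_on {\<tau>. u + \<tau> *s b \<in> V}"
          by (rule line_holo_holomorphic[OF f V]) simp
        show "open {\<tau>. u + \<tau> *s b \<in> V}" by (rule open_line[OF V])
        show "cball 0 \<delta> \<subseteq> {\<tau>. u + \<tau> *s b \<in> V}" using \<rho>(3,4) u by auto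
        show "cmod (f (u + \<tau> *s b)) \<le> B" if "cmod \<tau> \<le> \<delta>" for \<tau> using B \<rho>(4) u that by blast
      qed (use \<rho> \<epsilon>[of n] in auto)
      then have e1: "cmod (f (u + of_real (\<epsilon> n) *s b) - f u - of_real (\<epsilon> n) * ddir b f u) \<le> 8 * B / \<delta>\<^sup>2 * (\<epsilon> n)\<^sup>2"
        by (simp add: ddir_def)
      have "q n u - ddir b f u = (f (u + of_real (\<epsilon> n) *s b) - f u - of_real (\<epsilon> n) * ddir b f u) / of_real (\<epsilon> n)"
        using \<epsilon>(1)[of n] by (simp add: q_def field_simps)
      then have "cmod (q n u - ddir b f u) = cmod (f (u + of_real (\<epsilon> n) *s b) - f u - of_real (\<epsilon> n) * ddir b f u) / \<epsilon> n"
        using \<epsilon>(1)[of n] by (simp add: norm_divide)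
      also have "\<dots> \<le> 8 * B / \<delta>\<^sup>2 * (\<epsilon> n)\<^sup>2 / \<epsilon> n"
        using e1 \<epsilon>(1)[of n] by (intro divide_right_mono) auto
      finally show ?thesis using \<epsilon>(1)[of n] by (simp add: power2_eq_square)
    qed
    have unif: "uniform_limit (cball v \<rho>) q (ddir b f) sequentially"
    proof (rule uniform_limitI)
      fix e :: real assume "e > 0"
      have "(\<lambda>n. 8 * B / \<delta>\<^sup>2 * \<epsilon> n) \<longlonglongrightarrow> 8 * B / \<delta>\<^sup>2 * 0" by (intro tendsto_intros \<epsilon>0)
      then have "eventually (\<lambda>n. 8 * B / \<delta>\<^sup>2 * \<epsilon> n < e) sequentially"
        using \<open>e > 0\<close> by (auto dest: order_tendstoD(2))
      then show "\<forall>\<^sub>F n in sequentially. \<forall>x\<in>cball v \<rho>. dist (q n x) (ddir b f x) < e"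
        by eventually_elim (use est in \<open>fastforce simp: dist_norm intro: le_less_trans\<close>)
    qed
    have shift: "u + of_real (\<epsilon> n) *s b \<in> V" if "u \<in> cball v \<rho>" for u n
      using \<rho>(3) \<rho>(4)[OF that, of "of_real (\<epsilon> n)"] \<epsilon>[of n] \<rho>(2) by (auto simp: subset_iff)
    have contq: "continuous_on (cball v \<rho>) (q n)" for n
    proof -
      have cf: "continuous_on V f" using f by (simp add: line_holo_def)
      have "continuous_on (cball v \<rho>) (\<lambda>u. f (u + of_real (\<epsilon> n) *s b))"
        by (rule continuous_on_compose2[OF cf]) (use shift in \<open>auto intro: continuous_on_add continuous_on_id continuous_on_const\<close>)
      moreover have "continuous_on (cball v \<rho>) f" using cf sub by (rule continuous_on_subset)
      ultimately show ?thesis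
        unfolding q_def using \<epsilon>(1)[of n] by (intro continuous_on_divide continuous_on_diff continuous_on_const) auto
    qed
    have "continuous_on (cball v \<rho>) (ddir b f)"
      by (rule uniform_limit_theorem[OF always_eventually unif]) (use contq in auto)
    then have "continuous (at v) (ddir b f)"
      using \<rho>(1) by (intro continuous_on_interior) auto
    moreover have "(\<lambda>\<tau>. ddir b f (v + \<tau> *s c)) field_differentiable (at 0)" for c
    proof -
      define A where "A = {\<tau>. v + \<tau> *s c \<in> ball v \<rho>}"
      have A: "open A" "0 \<in> A" unfolding A_def using \<rho>(1) open_line[OF open_ball] by simp_all
      have "(\<lambda>\<tau>. ddir b f (v + \<tau> *s c)) holomorphic_on A"
      proof (rule holomorphic_uniform_sequence[OF A(1), of "\<lambda>n \<tau>. q n (v + \<tau> *s c)"])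
        fix n
        have eq: "(v + \<tau> *s c) + of_real (\<epsilon> n) *s b = (v + of_real (\<epsilon> n) *s b) + \<tau> *s c" for \<tau>
          by (simp add: algebra_simps)
        have "(v + of_real (\<epsilon> n) *s b) + \<tau> *s c \<in> V" if "\<tau> \<in> A" for \<tau>
          unfolding eq[symmetric] by (rule shift) (use that in \<open>simp add: A_def\<close>)
        then have "(\<lambda>\<tau>. f ((v + of_real (\<epsilon> n) *s b) + \<tau> *s c)) holomorphic_on A"
          by (intro line_holo_holomorphic[OF f V])
        moreover have "(\<lambda>\<tau>. f (v + \<tau> *s c)) holomorphic_on A"
          using sub by (intro line_holo_holomorphic[OF f V]) (auto simp: A_def subset_iff)
        ultimately show "(\<lambda>\<tau>. q n (v + \<tau> *s c)) holomorphic_on A"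
          unfolding q_def eq using \<epsilon>(1)[of n] by (intro holomorphic_intros) auto
      next
        fix x assume "x \<in> A"
        then obtain d where d: "d > 0" "cball x d \<subseteq> A" using A(1) open_contains_cball by blast
        have "uniform_limit (cball x d) (\<lambda>n \<tau>. q n (v + \<tau> *s c)) (\<lambda>\<tau>. ddir b f (v + \<tau> *s c)) sequentially"
        proof (rule uniform_limit_compose'[OF unif])
          show "(\<lambda>\<tau>. v + \<tau> *s c) \<in> cball x d \<rightarrow> cball v \<rho>" using d(2) by (auto simp: A_def subset_iff less_imp_le)
        qed
        then show "\<exists>d. 0 < d \<and> cball x d \<subseteq> A \<and>
            uniform_limit (cball x d) (\<lambda>n \<tau>. q n (v + \<tau> *s c)) (\<lambda>\<tau>. ddir b f (v + \<tau> *s c)) sequentially"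
          using d by blast
      qed
      then show ?thesis using A by (auto simp: holomorphic_on_open field_differentiable_def)
    qed
    ultimately show ?thesis by blast
  qed
  then show ?thesis
    unfolding line_holo_def by (auto intro: continuous_at_imp_continuous_on)
qed

lemma line_holo_cong:
  assumes "open V" "\<And>v. v \<in> V \<Longrightarrow> f v = g v" "line_holo f V"
  shows "line_holo g V"
  unfolding line_holo_def
proof (intro conjI ballI allI)
  show "continuous_on V g"
    using assms continuous_on_cong[of V V f g] by (simp add: line_holo_def)
  fix v b assume v: "v \<in> V"
  have "((\<lambda>\<tau>. f (v + \<tau> *s b)) has_field_derivative ddir b f v) (at 0)"
    using ddir_DERIV[OF assms(3) v] .
  then have "((\<lambda>\<tau>. g (v + \<tau> *s b)) has_field_derivative ddir b f v) (at 0)"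
    by (rule has_field_derivative_transform_within_open[OF _ open_line[OF assms(1), of v b]])
      (use assms(2) v in auto)
  then show "(\<lambda>\<tau>. g (v + \<tau> *s b)) field_differentiable at 0"
    by (auto simp: field_differentiable_def)
qed

section \<open>Weakly antiholomorphic maps into a Hilbert space\<close>

context hilbert
begin

definition antiholo :: "(complex ^ 'm::finite \<Rightarrow> 'h) \<Rightarrow> (complex ^ 'm) set \<Rightarrow> bool" where
  "antiholo \<kappa> V \<longleftrightarrow> open V \<and> (\<forall>v\<in>V. \<kappa> v \<in> hcarrier H) \<and>
     (\<forall>h\<in>hcarrier H. line_holo (\<lambda>v. \<langle>h, \<kappa> v\<rangle>) V)"

text \<open>The weak derivative of \<open>\<kappa>\<close> in the direction \<open>b\<close>; by \<open>antiholo_quad_approx\<close> below it is the derivative in norm.\<close>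

definition dd :: "(complex ^ 'm::finite \<Rightarrow> 'h) \<Rightarrow> complex ^ 'm \<Rightarrow> complex ^ 'm \<Rightarrow> 'h" where
  "dd \<kappa> b v = (SOME k. k \<in> hcarrier H \<and> (\<forall>h\<in>hcarrier H. \<langle>h, k\<rangle> = ddir b (\<lambda>u. \<langle>h, \<kappa> u\<rangle>) v))"

text \<open>Strong differentiability at \<open>0\<close> with a quadratic remainder. The function \<open>\<sigma>\<close> is \<open>cnj\<close> or the identity:
  an antiholomorphic map has the former, but becomes holomorphic when its parameter is conjugated.\<close>

definition quad_approx :: "(complex \<Rightarrow> 'h) \<Rightarrow> (complex \<Rightarrow> complex) \<Rightarrow> 'h \<Rightarrow> bool" where
  "quad_approx a \<sigma> u \<longleftrightarrow> u \<in> hcarrier H \<and>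
     (\<exists>\<delta>>0. \<exists>C\<ge>0. \<forall>\<tau>. cmod \<tau> \<le> \<delta> \<longrightarrow> a \<tau> \<in> hcarrier H \<and>
        hnorm H (a \<tau> - a 0 - \<sigma> \<tau> *\<^sub>C u) \<le> C * (cmod \<tau>)\<^sup>2)"

lemma quad_approxI:
  assumes "u \<in> hcarrier H" "\<delta> > 0" "C \<ge> 0" "\<And>\<tau>. cmod \<tau> \<le> \<delta> \<Longrightarrow> a \<tau> \<in> hcarrier H"
    "\<And>\<tau>. cmod \<tau> \<le> \<delta> \<Longrightarrow> hnorm H (a \<tau> - a 0 - \<sigma> \<tau> *\<^sub>C u) \<le> C * (cmod \<tau>)\<^sup>2"
  shows "quad_approx a \<sigma> u"
  using assms unfolding quad_approx_def by blast

lemma antiholo_mem: "antiholo \<kappa> V \<Longrightarrow> v \<in> V \<Longrightarrow> \<kappa> v \<in> hcarrier H"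
  and antiholo_line: "antiholo \<kappa> V \<Longrightarrow> h \<in> hcarrier H \<Longrightarrow> line_holo (\<lambda>v. \<langle>h, \<kappa> v\<rangle>) V"
  and antiholo_open: "antiholo \<kappa> V \<Longrightarrow> open V"
  by (auto simp: antiholo_def)

text \<open>On a compact set every \<open>\<langle>h, \<kappa> u\<rangle>\<close> is bounded by continuity; uniform boundedness does the rest.\<close>

lemma antiholo_bounded:
  assumes \<kappa>: "antiholo \<kappa> V" and C: "compact C" "C \<subseteq> V"
  obtains B where "B \<ge> 0" "\<And>u. u \<in> C \<Longrightarrow> hnorm H (\<kappa> u) \<le> B"
proof -
  have "\<kappa> ` C \<subseteq> hcarrier H" using \<kappa> C by (auto simp: antiholo_def)
  moreover have "\<exists>B. \<forall>k\<in>\<kappa> ` C. cmod \<langle>h, k\<rangle> \<le> B" if "h \<in> hcarrier H" for h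
  proof -
    have "continuous_on C (\<lambda>v. \<langle>h, \<kappa> v\<rangle>)"
      using antiholo_line[OF \<kappa> that] C(2) continuous_on_subset unfolding line_holo_def by blast
    then have "bounded ((\<lambda>v. \<langle>h, \<kappa> v\<rangle>) ` C)"
      using C(1) compact_continuous_image compact_imp_bounded by blast
    then show ?thesis by (auto simp: bounded_iff)
  qed
  ultimately obtain B where "B \<ge> 0" "\<And>k. k \<in> \<kappa> ` C \<Longrightarrow> hnorm H k \<le> B"
    using uniform_boundedness by blast
  then show ?thesis using that by blast
qed

text \<open>Cauchy's estimates for \<open>\<langle>h, \<kappa>\<rangle>\<close> have constants proportional to the norm of \<open>h\<close>, because \<open>\<kappa>\<close> is locally
  bounded in norm. Uniformity in \<open>h\<close> is what turns weak statements into strong ones.\<close>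

lemma antiholo_estimates:
  fixes v b :: "complex ^ 'm::finite"
  assumes \<kappa>: "antiholo \<kappa> V" and v: "v \<in> V"
  obtains \<delta> C where "\<delta> > 0" "C \<ge> 0" "\<And>\<tau>. cmod \<tau> \<le> \<delta> \<Longrightarrow> v + \<tau> *s b \<in> V"
    "\<And>h. h \<in> hcarrier H \<Longrightarrow> cmod (ddir b (\<lambda>u. \<langle>h, \<kappa> u\<rangle>) v) \<le> C * hnorm H h"
    "\<And>h \<tau>. h \<in> hcarrier H \<Longrightarrow> cmod \<tau> \<le> \<delta> \<Longrightarrow>
       cmod (\<langle>h, \<kappa> (v + \<tau> *s b)\<rangle> - \<langle>h, \<kappa> v\<rangle> - \<tau> * ddir b (\<lambda>u. \<langle>h, \<kappa> u\<rangle>) v) \<le> C * (cmod \<tau>)\<^sup>2 * hnorm H h"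
proof -
  have V: "open V" using \<kappa> by (rule antiholo_open)
  obtain \<rho> \<delta> where \<rho>: "\<rho> > 0" "\<delta> > 0" "cball v (2 * \<rho>) \<subseteq> V"
    "\<And>u \<tau>. u \<in> cball v \<rho> \<Longrightarrow> cmod \<tau> \<le> \<delta> \<Longrightarrow> u + \<tau> *s b \<in> cball v (2 * \<rho>)"
    using segment_room[OF V v] by blast
  obtain B where B: "B \<ge> 0" "\<And>u. u \<in> cball v (2 * \<rho>) \<Longrightarrow> hnorm H (\<kappa> u) \<le> B"
    using antiholo_bounded[OF \<kappa> compact_cball \<rho>(3)] by blast
  have room: "v + \<tau> *s b \<in> cball v (2 * \<rho>)" if "cmod \<tau> \<le> \<delta>" for \<tau>
    using \<rho>(1) \<rho>(4)[OF _ that, of v] by simp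
  define C where "C = max (B / \<delta>) (8 * B / \<delta>\<^sup>2)"
  have C: "C \<ge> B / \<delta>" "C \<ge> 8 * B / \<delta>\<^sup>2" by (auto simp: C_def)
  have est: "cmod (deriv (\<lambda>\<tau>. \<langle>h, \<kappa> (v + \<tau> *s b)\<rangle>) 0) \<le> B * hnorm H h / \<delta>"
    "cmod \<tau> \<le> \<delta> / 2 \<Longrightarrow> cmod (\<langle>h, \<kappa> (v + \<tau> *s b)\<rangle> - \<langle>h, \<kappa> (v + 0 *s b)\<rangle> - \<tau> * deriv (\<lambda>\<tau>. \<langle>h, \<kappa> (v + \<tau> *s b)\<rangle>) 0)
      \<le> 8 * (B * hnorm H h) / \<delta>\<^sup>2 * (cmod \<tau>)\<^sup>2"
    if h: "h \<in> hcarrier H" for h \<tau>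
  proof -
    have 1: "(\<lambda>\<tau>. \<langle>h, \<kappa> (v + \<tau> *s b)\<rangle>) holomorphic_on {\<tau>. v + \<tau> *s b \<in> V}"
      by (rule line_holo_holomorphic[OF antiholo_line[OF \<kappa> h] V]) simp
    have 2: "cball 0 \<delta> \<subseteq> {\<tau>. v + \<tau> *s b \<in> V}" using room \<rho>(3) by auto
    have 3: "cmod \<langle>h, \<kappa> (v + \<tau> *s b)\<rangle> \<le> B * hnorm H h" if "cmod \<tau> \<le> \<delta>" for \<tau>
    proof -
      have "cmod \<langle>h, \<kappa> (v + \<tau> *s b)\<rangle> \<le> hnorm H h * hnorm H (\<kappa> (v + \<tau> *s b))"
        using room[OF that] \<rho>(3) \<kappa> by (intro Cauchy_Schwarz h) (auto simp: antiholo_def)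
      also have "\<dots> \<le> hnorm H h * B"
        using B(2)[OF room[OF that]] hnorm_ge_0[OF h] by (intro mult_left_mono)
      finally show ?thesis by (simp add: mult.commute)
    qed
    show "cmod (deriv (\<lambda>\<tau>. \<langle>h, \<kappa> (v + \<tau> *s b)\<rangle>) 0) \<le> B * hnorm H h / \<delta>"
      by (rule cauchy_estimates(1)[OF 1 open_line[OF V] 2 \<rho>(2) 3])
    show "cmod (\<langle>h, \<kappa> (v + \<tau> *s b)\<rangle> - \<langle>h, \<kappa> (v + 0 *s b)\<rangle> - \<tau> * deriv (\<lambda>\<tau>. \<langle>h, \<kappa> (v + \<tau> *s b)\<rangle>) 0)
      \<le> 8 * (B * hnorm H h) / \<delta>\<^sup>2 * (cmod \<tau>)\<^sup>2" if "cmod \<tau> \<le> \<delta> / 2"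
      by (rule cauchy_estimates(3)[OF 1 open_line[OF V] 2 \<rho>(2) 3 that])
  qed
  show ?thesis
  proof (rule that[of "\<delta> / 2" C])
    show "\<delta> / 2 > 0" using \<rho> by simp
    show "C \<ge> 0" using C(1) B(1) \<rho>(2) by (meson divide_nonneg_pos order_trans)
    show "v + \<tau> *s b \<in> V" if "cmod \<tau> \<le> \<delta> / 2" for \<tau> using room[of \<tau>] that \<rho> by auto
  next
    fix h assume h: "h \<in> hcarrier H"
    have "B * hnorm H h / \<delta> \<le> C * hnorm H h"
      using mult_right_mono[OF C(1) hnorm_ge_0[OF h]] by simp
    then show "cmod (ddir b (\<lambda>u. \<langle>h, \<kappa> u\<rangle>) v) \<le> C * hnorm H h"
      using est(1)[OF h] by (simp add: ddir_def)
    fix \<tau> assume t: "cmod \<tau> \<le> \<delta> / 2"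
    have "8 * (B * hnorm H h) / \<delta>\<^sup>2 * (cmod \<tau>)\<^sup>2 = (8 * B / \<delta>\<^sup>2) * ((cmod \<tau>)\<^sup>2 * hnorm H h)" by simp
    also have "\<dots> \<le> C * ((cmod \<tau>)\<^sup>2 * hnorm H h)"
      using C(2) hnorm_ge_0[OF h] by (intro mult_right_mono) auto
    finally show "cmod (\<langle>h, \<kappa> (v + \<tau> *s b)\<rangle> - \<langle>h, \<kappa> v\<rangle> - \<tau> * ddir b (\<lambda>u. \<langle>h, \<kappa> u\<rangle>) v) \<le> C * (cmod \<tau>)\<^sup>2 * hnorm H h"
      using est(2)[OF h t] by (simp add: ddir_def mult.assoc)
  qed
qed

lemma dd:
  assumes \<kappa>: "antiholo \<kappa> V" and v: "v \<in> V"
  shows dd_mem: "dd \<kappa> b v \<in> hcarrier H"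
    and inner_dd: "h \<in> hcarrier H \<Longrightarrow> \<langle>h, dd \<kappa> b v\<rangle> = ddir b (\<lambda>u. \<langle>h, \<kappa> u\<rangle>) v"
proof -
  obtain C where C: "\<And>h. h \<in> hcarrier H \<Longrightarrow> cmod (ddir b (\<lambda>u. \<langle>h, \<kappa> u\<rangle>) v) \<le> C * hnorm H h"
    using antiholo_estimates[OF \<kappa> v] by metis
  have D: "((\<lambda>\<tau>. \<langle>h, \<kappa> (v + \<tau> *s b)\<rangle>) has_field_derivative ddir b (\<lambda>u. \<langle>h, \<kappa> u\<rangle>) v) (at 0)"
    if "h \<in> hcarrier H" for h
    using ddir_DERIV[OF antiholo_line[OF \<kappa> that] v] .
  have tr: "ddir b (\<lambda>u. \<langle>h, \<kappa> u\<rangle>) v = d"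
    if "\<And>u. u \<in> V \<Longrightarrow> \<langle>h, \<kappa> u\<rangle> = g u" "((\<lambda>\<tau>. g (v + \<tau> *s b)) has_field_derivative d) (at 0)" for h g d
  proof -
    have "((\<lambda>\<tau>. \<langle>h, \<kappa> (v + \<tau> *s b)\<rangle>) has_field_derivative d) (at 0)"
      by (rule has_field_derivative_transform_within_open[OF that(2) open_line[OF antiholo_open[OF \<kappa>], of v b]])
        (use v that(1) in auto)
    then show ?thesis unfolding ddir_def by (rule DERIV_imp_deriv)
  qed
  obtain k where "k \<in> hcarrier H" "\<And>h. h \<in> hcarrier H \<Longrightarrow> ddir b (\<lambda>u. \<langle>h, \<kappa> u\<rangle>) v = \<langle>h, k\<rangle>"
  proof (rule Riesz[of "\<lambda>h. ddir b (\<lambda>u. \<langle>h, \<kappa> u\<rangle>) v" C])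
    fix x y assume "x \<in> hcarrier H" "y \<in> hcarrier H"
    then show "ddir b (\<lambda>u. \<langle>x + y, \<kappa> u\<rangle>) v = ddir b (\<lambda>u. \<langle>x, \<kappa> u\<rangle>) v + ddir b (\<lambda>u. \<langle>y, \<kappa> u\<rangle>) v"
      by (intro tr[of _ "\<lambda>u. \<langle>x, \<kappa> u\<rangle> + \<langle>y, \<kappa> u\<rangle>"] DERIV_add D) (simp add: inner_add_left antiholo_mem[OF \<kappa>])
  next
    fix c x assume "x \<in> hcarrier H"
    then show "ddir b (\<lambda>u. \<langle>c *\<^sub>C x, \<kappa> u\<rangle>) v = c * ddir b (\<lambda>u. \<langle>x, \<kappa> u\<rangle>) v"
      by (intro tr[of _ "\<lambda>u. c * \<langle>x, \<kappa> u\<rangle>"] DERIV_cmult D) (simp add: inner_scale_left antiholo_mem[OF \<kappa>])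
  qed (use C in auto)
  then have "\<exists>k. k \<in> hcarrier H \<and> (\<forall>h\<in>hcarrier H. \<langle>h, k\<rangle> = ddir b (\<lambda>u. \<langle>h, \<kappa> u\<rangle>) v)" by auto
  from someI_ex[OF this] show "dd \<kappa> b v \<in> hcarrier H"
    "h \<in> hcarrier H \<Longrightarrow> \<langle>h, dd \<kappa> b v\<rangle> = ddir b (\<lambda>u. \<langle>h, \<kappa> u\<rangle>) v"
    by (auto simp: dd_def)
qed

lemma antiholo_dd:
  assumes \<kappa>: "antiholo \<kappa> V" shows "antiholo (dd \<kappa> b) V"
  unfolding antiholo_def
proof (intro conjI ballI)
  show "open V" using \<kappa> by (rule antiholo_open)
  show "dd \<kappa> b v \<in> hcarrier H" if "v \<in> V" for v using dd_mem[OF \<kappa> that] .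
  fix h assume h: "h \<in> hcarrier H"
  show "line_holo (\<lambda>v. \<langle>h, dd \<kappa> b v\<rangle>) V"
    by (rule line_holo_cong[OF antiholo_open[OF \<kappa>] _ line_holo_ddir[OF antiholo_line[OF \<kappa> h] antiholo_open[OF \<kappa>]]])
      (simp add: inner_dd[OF \<kappa> _ h])
qed

text \<open>Weakly antiholomorphic maps are strongly differentiable: the bound on the remainder of \<open>\<langle>h, \<kappa>\<rangle>\<close> is uniform on
  the unit ball, hence bounds the norm of the remainder.\<close>

lemma antiholo_quad_approx:
  assumes \<kappa>: "antiholo \<kappa> V" and v: "v \<in> V"
  shows "quad_approx (\<lambda>\<tau>. \<kappa> (v + \<tau> *s b)) cnj (dd \<kappa> b v)"
    and "quad_approx (\<lambda>\<tau>. \<kappa> (v + cnj \<tau> *s b)) (\<lambda>\<tau>. \<tau>) (dd \<kappa> b v)"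
proof -
  obtain \<delta> C where *: "\<delta> > 0" "C \<ge> 0" "\<And>\<tau>. cmod \<tau> \<le> \<delta> \<Longrightarrow> v + \<tau> *s b \<in> V"
    "\<And>h \<tau>. h \<in> hcarrier H \<Longrightarrow> cmod \<tau> \<le> \<delta> \<Longrightarrow>
       cmod (\<langle>h, \<kappa> (v + \<tau> *s b)\<rangle> - \<langle>h, \<kappa> v\<rangle> - \<tau> * ddir b (\<lambda>u. \<langle>h, \<kappa> u\<rangle>) v) \<le> C * (cmod \<tau>)\<^sup>2 * hnorm H h"
    using antiholo_estimates[OF \<kappa> v] by metis
  have mem: "\<kappa> (v + \<tau> *s b) \<in> hcarrier H" if "cmod \<tau> \<le> \<delta>" for \<tau> using *(3)[OF that] by (rule antiholo_mem[OF \<kappa>])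
  have est: "hnorm H (\<kappa> (v + \<tau> *s b) - \<kappa> v - cnj \<tau> *\<^sub>C dd \<kappa> b v) \<le> C * (cmod \<tau>)\<^sup>2" if "cmod \<tau> \<le> \<delta>" for \<tau>
  proof (rule hnorm_le_of_functional)
    show "\<kappa> (v + \<tau> *s b) - \<kappa> v - cnj \<tau> *\<^sub>C dd \<kappa> b v \<in> hcarrier H"
      using mem[OF that] antiholo_mem[OF \<kappa> v] dd_mem[OF \<kappa> v] by simp
    fix h assume h: "h \<in> hcarrier H"
    show "cmod \<langle>h, \<kappa> (v + \<tau> *s b) - \<kappa> v - cnj \<tau> *\<^sub>C dd \<kappa> b v\<rangle> \<le> C * (cmod \<tau>)\<^sup>2 * hnorm H h"
      using *(4)[OF h that] mem[OF that] antiholo_mem[OF \<kappa> v] dd_mem[OF \<kappa> v] h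
      by (simp add: inner_simps inner_dd[OF \<kappa> v])
  qed (use * in simp)
  show "quad_approx (\<lambda>\<tau>. \<kappa> (v + \<tau> *s b)) cnj (dd \<kappa> b v)"
    by (rule quad_approxI[OF dd_mem[OF \<kappa> v] *(1,2) mem]) (use est in simp_all)
  show "quad_approx (\<lambda>\<tau>. \<kappa> (v + cnj \<tau> *s b)) (\<lambda>\<tau>. \<tau>) (dd \<kappa> b v)"
    by (rule quad_approxI[OF dd_mem[OF \<kappa> v] *(1,2) mem])
      (use est[of "cnj _"] in simp_all)
qed

text \<open>The product rule. The two parameters \<open>\<sigma>\<close> and \<open>\<rho>\<close> cover both the real-differentiable restriction of a kernel
  to its diagonal and its polarized, holomorphic version.\<close>

lemma inner_has_derivative:
  assumes a: "quad_approx a \<sigma> u" and b: "quad_approx b \<rho> v"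
    and \<sigma>: "bounded_linear \<sigma>" "\<And>\<tau>. cmod (\<sigma> \<tau>) = cmod \<tau>"
    and \<rho>: "bounded_linear \<rho>" "\<And>\<tau>. cmod (\<rho> \<tau>) = cmod \<tau>"
  shows "((\<lambda>\<tau>. \<langle>a \<tau>, b \<tau>\<rangle>) has_derivative (\<lambda>\<tau>. \<sigma> \<tau> * \<langle>u, b 0\<rangle> + cnj (\<rho> \<tau>) * \<langle>a 0, v\<rangle>)) (at 0)"
proof -
  define D where "D \<tau> = \<sigma> \<tau> * \<langle>u, b 0\<rangle> + cnj (\<rho> \<tau>) * \<langle>a 0, v\<rangle>" for \<tau>
  obtain \<delta>1 C1 where 1: "u \<in> hcarrier H" "\<delta>1 > 0" "C1 \<ge> 0" "\<And>\<tau>. cmod \<tau> \<le> \<delta>1 \<Longrightarrow> a \<tau> \<in> hcarrier H"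
      "\<And>\<tau>. cmod \<tau> \<le> \<delta>1 \<Longrightarrow> hnorm H (a \<tau> - a 0 - \<sigma> \<tau> *\<^sub>C u) \<le> C1 * (cmod \<tau>)\<^sup>2"
    using a unfolding quad_approx_def by blast
  obtain \<delta>2 C2 where 2: "v \<in> hcarrier H" "\<delta>2 > 0" "C2 \<ge> 0" "\<And>\<tau>. cmod \<tau> \<le> \<delta>2 \<Longrightarrow> b \<tau> \<in> hcarrier H"
      "\<And>\<tau>. cmod \<tau> \<le> \<delta>2 \<Longrightarrow> hnorm H (b \<tau> - b 0 - \<rho> \<tau> *\<^sub>C v) \<le> C2 * (cmod \<tau>)\<^sup>2"
    using b unfolding quad_approx_def by blast
  define \<delta> where "\<delta> = min 1 (min \<delta>1 \<delta>2)"
  have \<delta>: "\<delta> > 0" "\<delta> \<le> \<delta>1" "\<delta> \<le> \<delta>2" "\<delta> \<le> 1" using 1(2) 2(2) by (auto simp: \<delta>_def)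
  have 0: "a 0 \<in> hcarrier H" "b 0 \<in> hcarrier H" using 1(2,4) 2(2,4) by auto
  define E where "E = C1 * (hnorm H (b 0) + hnorm H v + C2) + (hnorm H (a 0) + hnorm H u) * C2 + cmod \<langle>u, v\<rangle>"
  have est: "norm (\<langle>a \<tau>, b \<tau>\<rangle> - \<langle>a 0, b 0\<rangle> - D \<tau>) \<le> E * (cmod \<tau>)\<^sup>2"
    if t: "cmod \<tau> \<le> \<delta>" for \<tau>
  proof -
    define ra where "ra = a \<tau> - a 0 - \<sigma> \<tau> *\<^sub>C u"
    define rb where "rb = b \<tau> - b 0 - \<rho> \<tau> *\<^sub>C v"
    have m: "a \<tau> \<in> hcarrier H" "b \<tau> \<in> hcarrier H" using 1 2 \<delta> t by auto
    have r: "ra \<in> hcarrier H" "rb \<in> hcarrier H" using m 0 1 2 by (auto simp: ra_def rb_def)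
    have t1: "cmod \<tau> \<le> 1" "(cmod \<tau>)\<^sup>2 \<le> 1" using t \<delta>(4) by (auto simp: power_le_one_iff)
    have ra: "hnorm H ra \<le> C1 * (cmod \<tau>)\<^sup>2" and rb: "hnorm H rb \<le> C2 * (cmod \<tau>)\<^sup>2"
      using 1(5) 2(5) t \<delta> by (auto simp: ra_def rb_def)
    have eqb: "b \<tau> = b 0 + \<rho> \<tau> *\<^sub>C v + rb" by (simp add: rb_def)
    have "hnorm H (b \<tau>) \<le> hnorm H (b 0) + cmod \<tau> * hnorm H v + C2 * (cmod \<tau>)\<^sup>2"
      unfolding eqb using hnorm_triangle[of "b 0 + \<rho> \<tau> *\<^sub>C v" rb] hnorm_triangle[of "b 0" "\<rho> \<tau> *\<^sub>C v"] 0 2(1) r rb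
      by (simp add: hnorm_scale \<rho>)
    also have "\<dots> \<le> hnorm H (b 0) + 1 * hnorm H v + C2 * 1"
      using t1 2(1,3) hnorm_ge_0 by (intro add_mono mult_mono) auto
    finally have nb: "hnorm H (b \<tau>) \<le> hnorm H (b 0) + hnorm H v + C2" by simp
    have "hnorm H (a 0 + \<sigma> \<tau> *\<^sub>C u) \<le> hnorm H (a 0) + cmod \<tau> * hnorm H u"
      using hnorm_triangle[of "a 0" "\<sigma> \<tau> *\<^sub>C u"] 0 1 by (simp add: hnorm_scale \<sigma>)
    also have "\<dots> \<le> hnorm H (a 0) + 1 * hnorm H u"
      using t1 1(1) hnorm_ge_0 by (intro add_mono mult_mono) auto
    finally have na: "hnorm H (a 0 + \<sigma> \<tau> *\<^sub>C u) \<le> hnorm H (a 0) + hnorm H u" by simp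
    have "\<langle>a \<tau>, b \<tau>\<rangle> = \<langle>ra, b \<tau>\<rangle> + \<langle>a 0 + \<sigma> \<tau> *\<^sub>C u, b \<tau>\<rangle>"
      using m 0 1 by (simp add: ra_def inner_simps)
    also have "\<langle>a 0 + \<sigma> \<tau> *\<^sub>C u, b \<tau>\<rangle> = \<langle>a 0 + \<sigma> \<tau> *\<^sub>C u, rb\<rangle> + \<langle>a 0 + \<sigma> \<tau> *\<^sub>C u, b 0 + \<rho> \<tau> *\<^sub>C v\<rangle>"
      using m 0 1 2 by (simp add: rb_def inner_simps)
    also have "\<langle>a 0 + \<sigma> \<tau> *\<^sub>C u, b 0 + \<rho> \<tau> *\<^sub>C v\<rangle> = \<langle>a 0, b 0\<rangle> + D \<tau> + \<sigma> \<tau> * cnj (\<rho> \<tau>) * \<langle>u, v\<rangle>"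
      using 0 1 2 by (simp add: D_def inner_simps algebra_simps)
    finally have "\<langle>a \<tau>, b \<tau>\<rangle> - \<langle>a 0, b 0\<rangle> - D \<tau> =
        \<langle>ra, b \<tau>\<rangle> + \<langle>a 0 + \<sigma> \<tau> *\<^sub>C u, rb\<rangle> + \<sigma> \<tau> * cnj (\<rho> \<tau>) * \<langle>u, v\<rangle>" by simp
    also have "norm \<dots> \<le> norm \<langle>ra, b \<tau>\<rangle> + norm \<langle>a 0 + \<sigma> \<tau> *\<^sub>C u, rb\<rangle> + norm (\<sigma> \<tau> * cnj (\<rho> \<tau>) * \<langle>u, v\<rangle>)"
      by (meson add_mono norm_triangle_le order_refl)
    also have "\<dots> \<le> hnorm H ra * hnorm H (b \<tau>) + hnorm H (a 0 + \<sigma> \<tau> *\<^sub>C u) * hnorm H rb + (cmod \<tau>)\<^sup>2 * cmod \<langle>u, v\<rangle>"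
      using m r 0 1 by (intro add_mono Cauchy_Schwarz) (auto simp: norm_mult \<sigma> \<rho> power2_eq_square)
    also have "\<dots> \<le> (C1 * (cmod \<tau>)\<^sup>2) * (hnorm H (b 0) + hnorm H v + C2) + (hnorm H (a 0) + hnorm H u) * (C2 * (cmod \<tau>)\<^sup>2) + (cmod \<tau>)\<^sup>2 * cmod \<langle>u, v\<rangle>"
      using ra rb na nb m r 0 1(1,3) 2(1,3) hnorm_ge_0 by (intro add_mono mult_mono) auto
    also have "\<dots> = E * (cmod \<tau>)\<^sup>2" by (simp add: E_def algebra_simps)
    finally show ?thesis .
  qed
  have bl: "bounded_linear D"
    unfolding D_def
    by (intro bounded_linear_add bounded_linear_mult_const \<sigma>(1) bounded_linear_compose[OF bounded_linear_cnj \<rho>(1)])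
  show ?thesis
    unfolding has_derivative_at D_def[symmetric]
  proof (intro conjI bl)
    have "((\<lambda>\<tau>. E * cmod \<tau>) \<longlongrightarrow> E * cmod 0) (at 0)" by (intro tendsto_intros)
    then have lim: "((\<lambda>\<tau>. E * cmod \<tau>) \<longlongrightarrow> 0) (at 0)" by simp
    show "((\<lambda>h. norm (\<langle>a (0 + h), b (0 + h)\<rangle> - \<langle>a 0, b 0\<rangle> - D h) / norm h) \<longlongrightarrow> 0) (at 0)"
    proof (rule Lim_null_comparison[OF _ lim])
      have "eventually (\<lambda>\<tau>. \<tau> \<in> cball 0 \<delta>) (at (0::complex))"
        using \<delta>(1) eventually_at_le[of "\<lambda>\<tau>. \<tau> \<in> cball 0 \<delta>" 0 UNIV] by (auto simp: dist_norm)
      then show "\<forall>\<^sub>F \<tau> in at 0. norm (norm (\<langle>a (0 + \<tau>), b (0 + \<tau>)\<rangle> - \<langle>a 0, b 0\<rangle> - D \<tau>) / norm \<tau>) \<le> E * cmod \<tau>"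
      proof eventually_elim
        case (elim \<tau>)
        show ?case
        proof (cases "\<tau> = 0")
          case False
          then show ?thesis using est[of \<tau>] elim by (simp add: divide_le_eq power2_eq_square mult.assoc)
        qed simp
      qed
    qed
  qed
qed

lemma inner_antiholo_diagonal:
  assumes "antiholo \<kappa> V" "antiholo \<mu> V" "v \<in> V"
  shows "((\<lambda>\<tau>. \<langle>\<kappa> (v + \<tau> *s b), \<mu> (v + \<tau> *s b)\<rangle>) has_derivative
    (\<lambda>\<tau>. \<tau> * \<langle>\<kappa> v, dd \<mu> b v\<rangle> + cnj \<tau> * \<langle>dd \<kappa> b v, \<mu> v\<rangle>)) (at 0)"
  using inner_has_derivative[OF antiholo_quad_approx(1)[OF assms(1,3)] antiholo_quad_approx(1)[OF assms(2,3)]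
      bounded_linear_cnj _ bounded_linear_cnj, of b b]
  by (simp add: add.commute)

lemma inner_antiholo_sesqui:
  assumes "antiholo \<kappa> V" "antiholo \<mu> V" "z \<in> V" "w \<in> V"
  shows "((\<lambda>\<tau>. \<langle>\<kappa> (w + cnj \<tau> *s c), \<mu> (z + \<tau> *s b)\<rangle>) has_field_derivative
    (\<langle>dd \<kappa> c w, \<mu> z\<rangle> + \<langle>\<kappa> w, dd \<mu> b z\<rangle>)) (at 0)"
proof -
  have "(\<lambda>\<tau>. \<tau> * \<langle>dd \<kappa> c w, \<mu> z\<rangle> + cnj (cnj \<tau>) * \<langle>\<kappa> w, dd \<mu> b z\<rangle>) =
      (*) (\<langle>dd \<kappa> c w, \<mu> z\<rangle> + \<langle>\<kappa> w, dd \<mu> b z\<rangle>)"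
    by (simp add: fun_eq_iff algebra_simps)
  then show ?thesis
    using inner_has_derivative[OF antiholo_quad_approx(2)[OF assms(1,4)] antiholo_quad_approx(1)[OF assms(2,3)]
        bounded_linear_ident _ bounded_linear_cnj, of c b]
    by (simp add: has_field_derivative_def)
qed

end

section \<open>Sesquiholomorphic functions: polarization and identity theorem\<close>

text \<open>Functions holomorphic in \<open>z\<close> and antiholomorphic in \<open>w\<close>, required jointly: conjugating the parameter in the
  second argument makes the restriction to every pair of complex lines holomorphic.\<close>

definition sesqui :: "(complex ^ 'm::finite \<Rightarrow> complex ^ 'm \<Rightarrow> complex) \<Rightarrow> (complex ^ 'm) set \<Rightarrow> bool" where
  "sesqui F V \<longleftrightarrow> (\<forall>z\<in>V. \<forall>w\<in>V. \<forall>b c. (\<lambda>\<tau>. F (z + \<tau> *s b) (w + cnj \<tau> *s c)) field_differentiable (at 0))"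

lemma sesqui_diff: "sesqui F V \<Longrightarrow> sesqui G V \<Longrightarrow> sesqui (\<lambda>z w. F z w - G z w) V"
  and sesqui_mult: "sesqui F V \<Longrightarrow> sesqui G V \<Longrightarrow> sesqui (\<lambda>z w. F z w * G z w) V"
  by (auto simp: sesqui_def intro!: field_differentiable_diff field_differentiable_mult)

lemma (in hilbert) sesqui_inner:
  assumes "antiholo \<kappa> V" "antiholo \<mu> V"
  shows "sesqui (\<lambda>z w. \<langle>\<kappa> w, \<mu> z\<rangle>) V"
  unfolding sesqui_def field_differentiable_def using inner_antiholo_sesqui[OF assms] by blast

lemma sesqui_field_differentiable:
  assumes "sesqui F V" "z + \<tau>0 *s b \<in> V" "w + cnj \<tau>0 *s c \<in> V"
  shows "(\<lambda>\<tau>. F (z + \<tau> *s b) (w + cnj \<tau> *s c)) field_differentiable (at \<tau>0)"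
proof (rule field_differentiable_shift)
  have "(\<lambda>\<tau>. F ((z + \<tau>0 *s b) + \<tau> *s b) ((w + cnj \<tau>0 *s c) + cnj \<tau> *s c)) field_differentiable (at 0)"
    using assms unfolding sesqui_def by blast
  then show "(\<lambda>\<tau>. F (z + (\<tau>0 + \<tau>) *s b) (w + cnj (\<tau>0 + \<tau>) *s c)) field_differentiable (at 0)"
    by (simp only: shift_line complex_cnj_add)
qed

text \<open>With \<open>a = (z + w) / 2\<close> and \<open>b = (z - w) / 2i\<close>, the function \<open>F (a + \<tau> b) (a + cnj \<tau> b)\<close> of one
  variable is holomorphic, vanishes at real \<open>\<tau>\<close>, and is \<open>F z w\<close> at \<open>\<tau> = \<i>\<close>.\<close>

lemma polarization:
  fixes v0 :: "complex ^ 'm::finite"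
  assumes F: "sesqui F V" and L: "vec.subspace L" and v0: "v0 \<in> L" and r: "ball v0 (3 * r) \<subseteq> V"
    and diag: "\<And>z. z \<in> ball v0 (3 * r) \<inter> L \<Longrightarrow> F z z = 0"
    and z: "z \<in> ball v0 r \<inter> L" and w: "w \<in> ball v0 r \<inter> L"
  shows "F z w = 0"
proof -
  define a where "a = (1/2) *s (z + w)"
  define b where "b = (1 / (2 * \<i>)) *s (z - w)"
  have aL: "a \<in> L" and bL: "b \<in> L"
    using L z w by (auto simp: a_def b_def vec.subspace_scale vec.subspace_add vec.subspace_diff)
  have na: "norm (a - v0) < r"
  proof -
    have "v0 = (1/2) *s (v0 + v0)" by (simp add: vec_eq_iff)
    then have "a - v0 = (1/2) *s ((z - v0) + (w - v0))"
      unfolding a_def by (simp add: vec_eq_iff field_simps)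
    then have "norm (a - v0) = norm ((z - v0) + (w - v0)) / 2" by (simp only: norm_smult_vec) simp
    also have "\<dots> \<le> (norm (z - v0) + norm (w - v0)) / 2" by (intro divide_right_mono norm_triangle_ineq) simp
    finally show ?thesis using z w by (auto simp: dist_norm norm_minus_commute)
  qed
  have nb: "norm b < r"
  proof -
    have "norm b = norm ((z - v0) - (w - v0)) / 2" by (simp only: b_def norm_smult_vec) (simp add: norm_divide norm_mult)
    also have "\<dots> \<le> (norm (z - v0) + norm (w - v0)) / 2" by (intro divide_right_mono norm_triangle_ineq4) simp
    finally show ?thesis using z w by (auto simp: dist_norm norm_minus_commute)
  qed
  have room: "a + \<tau> *s b \<in> ball v0 (3 * r)" if "cmod \<tau> < 2" for \<tau>
  proof -
    have "norm (a + \<tau> *s b - v0) \<le> norm (a - v0) + norm (\<tau> *s b)"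
      using norm_triangle_ineq[of "a - v0" "\<tau> *s b"] by (simp add: algebra_simps)
    also have "\<dots> \<le> norm (a - v0) + 2 * norm b"
      using that by (simp add: norm_smult_vec mult_right_mono)
    finally show ?thesis using na nb by (simp add: dist_norm norm_minus_commute)
  qed
  define Q where "Q \<tau> = F (a + \<tau> *s b) (a + cnj \<tau> *s b)" for \<tau>
  have holQ: "Q holomorphic_on ball 0 2"
    unfolding holomorphic_on_def Q_def
  proof
    fix \<tau> :: complex assume "\<tau> \<in> ball 0 2"
    then have "a + \<tau> *s b \<in> V" "a + cnj \<tau> *s b \<in> V"
      using room[of \<tau>] room[of "cnj \<tau>"] r by auto
    then show "(\<lambda>\<tau>. F (a + \<tau> *s b) (a + cnj \<tau> *s b)) field_differentiable at \<tau> within ball 0 2"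
      by (rule field_differentiable_at_within[OF sesqui_field_differentiable[OF F]])
  qed
  have lim: "0 islimpt (of_real ` {-1<..<1::real} :: complex set)"
    unfolding islimpt_approachable
  proof (intro allI impI)
    fix e :: real assume "e > 0"
    define x :: real where "x = min e 1 / 2"
    have "x \<in> {-1<..<1}" "complex_of_real x \<noteq> 0" "dist (complex_of_real x) 0 < e"
      using \<open>e > 0\<close> by (auto simp: x_def dist_norm)
    then show "\<exists>x'\<in>of_real ` {-1<..<1}. x' \<noteq> (0::complex) \<and> dist x' 0 < e" by blast
  qed
  have zero: "Q \<tau> = 0" if \<tau>: "\<tau> \<in> of_real ` {-1<..<1::real}" for \<tau>
  proof -
    obtain t :: real where t: "\<tau> = of_real t" "t \<in> {-1<..<1}" using \<tau> by blast
    then have "cmod \<tau> < 2" by auto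
    then have "a + \<tau> *s b \<in> ball v0 (3 * r) \<inter> L"
      using room[of \<tau>] L aL bL by (simp add: vec.subspace_add vec.subspace_scale)
    then show ?thesis using diag t by (simp add: Q_def)
  qed
  have "Q \<i> = 0"
    by (rule analytic_continuation[OF holQ open_ball connected_ball _ _ lim zero]) auto
  moreover have "a + \<i> *s b = z" "a + cnj \<i> *s b = w"
    by (auto simp: a_def b_def vec_eq_iff field_simps)
  ultimately show ?thesis by (simp add: Q_def)
qed

text \<open>The points of \<open>V \<inter> L\<close> near which \<open>f\<close> vanishes form an open set. It is also closed: in a ball that contains
  one such point \<open>q\<close>, every other point is joined to \<open>q\<close> by a complex line, on which \<open>f\<close> is a holomorphic function
  of one variable vanishing near \<open>q\<close>. The subspace \<open>L\<close> makes the lemma applicable to the hypersurface as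
  well as to a domain.\<close>

lemma identity_theorem:
  fixes f :: "complex ^ 'm::finite \<Rightarrow> complex"
  assumes f: "\<And>v b. v \<in> V \<Longrightarrow> (\<lambda>\<tau>. f (v + \<tau> *s b)) field_differentiable (at 0)"
    and V: "open V" and L: "vec.subspace L" and conn: "connected (V \<inter> L)"
    and v0: "v0 \<in> V \<inter> L" "r > 0" "\<And>v. v \<in> ball v0 r \<inter> V \<inter> L \<Longrightarrow> f v = 0"
    and v: "v \<in> V \<inter> L"
  shows "f v = 0"
proof -
  define E where "E = {p \<in> V \<inter> L. \<exists>e>0. \<forall>v\<in>ball p e \<inter> V \<inter> L. f v = 0}"
  have "openin (top_of_set (V \<inter> L)) E"
    unfolding openin_contains_ball
  proof (intro conjI ballI)
    fix p assume "p \<in> E"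
    then obtain e where e: "e > 0" "\<forall>v\<in>ball p e \<inter> V \<inter> L. f v = 0" by (auto simp: E_def)
    have "ball p e \<inter> (V \<inter> L) \<subseteq> E"
    proof
      fix q assume q: "q \<in> ball p e \<inter> (V \<inter> L)"
      then obtain e' where "e' > 0" "ball q e' \<subseteq> ball p e"
        using open_contains_ball[of "ball p e"] open_ball by blast
      then show "q \<in> E" using q e(2) by (auto simp: E_def subset_iff intro!: exI[of _ e'])
    qed
    then show "\<exists>e>0. ball p e \<inter> (V \<inter> L) \<subseteq> E" using e(1) by blast
  qed (auto simp: E_def)
  moreover have "openin (top_of_set (V \<inter> L)) (V \<inter> L - E)"
    unfolding openin_contains_ball
  proof (intro conjI ballI)
    fix p assume p: "p \<in> V \<inter> L - E"
    obtain e where e: "e > 0" "ball p e \<subseteq> V" using V p open_contains_ball by blast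
    have "q \<notin> E" if q: "q \<in> ball p e" for q
    proof
      assume "q \<in> E"
      then obtain d where qL: "q \<in> L" and d: "d > 0" "\<forall>v\<in>ball q d \<inter> V \<inter> L. f v = 0" by (auto simp: E_def)
      have "f v = 0" if v: "v \<in> ball p e \<inter> L" for v
      proof -
        define S where "S = {\<tau>. q + \<tau> *s (v - q) \<in> ball p e}"
        have S: "open S" unfolding S_def by (rule open_line[OF open_ball])
        have "convex S" unfolding S_def by (rule convex_line[OF convex_ball])
        have hol: "(\<lambda>\<tau>. f (q + \<tau> *s (v - q))) holomorphic_on S"
          unfolding holomorphic_on_def
        proof (rule ballI, rule field_differentiable_at_within)
          fix \<tau>0 assume "\<tau>0 \<in> S"
          then have "(\<lambda>\<tau>. f ((q + \<tau>0 *s (v - q)) + \<tau> *s (v - q))) field_differentiable (at 0)"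
            using e(2) by (intro f) (auto simp: S_def)
          then show "(\<lambda>\<tau>. f (q + \<tau> *s (v - q))) field_differentiable (at \<tau>0)"
            by (simp only: shift_line) (rule field_differentiable_shift)
        qed
        have lim: "0 islimpt ({\<tau>. q + \<tau> *s (v - q) \<in> ball q d} \<inter> S)"
        proof (rule interior_limit_point)
          have "open ({\<tau>. q + \<tau> *s (v - q) \<in> ball q d} \<inter> S)"
            using S open_line[OF open_ball] by (intro open_Int)
          moreover have "0 \<in> {\<tau>. q + \<tau> *s (v - q) \<in> ball q d} \<inter> S"
            using d(1) q by (simp add: S_def)
          ultimately show "0 \<in> interior ({\<tau>. q + \<tau> *s (v - q) \<in> ball q d} \<inter> S)"
            by (simp only: interior_open)
        qed
        have zero: "f (q + \<tau> *s (v - q)) = 0" if "\<tau> \<in> {\<tau>. q + \<tau> *s (v - q) \<in> ball q d} \<inter> S" for \<tau>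
          using that d(2) e(2) L qL v by (auto simp: S_def vec.subspace_add vec.subspace_scale vec.subspace_diff)
        have "f (q + 1 *s (v - q)) = 0"
          by (rule analytic_continuation[OF hol S convex_connected[OF \<open>convex S\<close>] _ _ lim zero])
            (use q v in \<open>auto simp: S_def\<close>)
        then show ?thesis by simp
      qed
      then have "p \<in> E" using p e(1) by (auto simp: E_def)
      then show False using p by blast
    qed
    then show "\<exists>e>0. ball p e \<inter> (V \<inter> L) \<subseteq> V \<inter> L - E" using e(1) by blast
  qed auto
  moreover have "E \<subseteq> V \<inter> L" by (auto simp: E_def)
  ultimately have "openin (top_of_set (V \<inter> L)) E \<and> closedin (top_of_set (V \<inter> L)) E"
    by (simp add: closedin_def)
  then have "E = {} \<or> E = V \<inter> L" using conn connected_clopen by blast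
  moreover have "v0 \<in> E" using v0 by (auto simp: E_def)
  ultimately have "v \<in> E" using v by blast
  then show ?thesis by (auto simp: E_def)
qed

text \<open>Polarization gives a neighbourhood of \<open>(v0, v0)\<close>; the identity theorem extends this first in \<open>z\<close>, with \<open>w\<close> near
  \<open>v0\<close>, and then in \<open>w\<close>.\<close>

lemma sesqui_eq_0:
  assumes F: "sesqui F V" and V: "open V" and L: "vec.subspace L" and conn: "connected (V \<inter> L)"
    and v0: "v0 \<in> V \<inter> L" "r > 0" "\<And>z. z \<in> ball v0 r \<inter> V \<inter> L \<Longrightarrow> F z z = 0"
    and z: "z \<in> V \<inter> L" and w: "w \<in> V \<inter> L"
  shows "F z w = 0"
proof -
  obtain e where e: "e > 0" "ball v0 e \<subseteq> V" using V v0(1) open_contains_ball by blast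
  define s where "s = min e r / 3"
  have s: "s > 0" "3 * s \<le> e" "3 * s \<le> r" using e v0 by (auto simp: s_def)
  have local: "F z w = 0" if "z \<in> ball v0 s \<inter> L" "w \<in> ball v0 s \<inter> L" for z w
  proof (rule polarization[OF F L _ _ _ that])
    show "v0 \<in> L" using v0 by simp
    show *: "ball v0 (3 * s) \<subseteq> V" using e(2) s(2) by (meson order_trans subset_ball)
    show "F z z = 0" if "z \<in> ball v0 (3 * s) \<inter> L" for z
      using that * s(3) by (intro v0(3)) auto
  qed
  have 1: "F z w = 0" if w: "w \<in> ball v0 s \<inter> V \<inter> L" for w
  proof (rule identity_theorem[of V "\<lambda>z. F z w", OF _ V L conn v0(1) s(1) _ z])
    fix v b assume "v \<in> V"
    then have "(\<lambda>\<tau>. F (v + \<tau> *s b) (w + cnj \<tau> *s 0)) field_differentiable at 0"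
      using F w unfolding sesqui_def by blast
    then show "(\<lambda>\<tau>. F (v + \<tau> *s b) w) field_differentiable at 0" by simp
  qed (use local w in auto)
  have "cnj (F z w) = 0"
  proof (rule identity_theorem[of V "\<lambda>w. cnj (F z w)", OF _ V L conn v0(1) s(1) _ w])
    fix v b assume "v \<in> V"
    then have "(\<lambda>\<tau>. F (z + \<tau> *s 0) (v + cnj \<tau> *s b)) field_differentiable at 0"
      using F z unfolding sesqui_def by blast
    then obtain D where "((\<lambda>\<tau>. F z (v + cnj \<tau> *s b)) has_field_derivative D) (at (cnj 0))"
      by (auto simp: field_differentiable_def)
    from has_field_derivative_cnj_cnj[OF this]
    show "(\<lambda>\<tau>. cnj (F z (v + \<tau> *s b))) field_differentiable at 0"
      by (auto simp: field_differentiable_def o_def)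
  qed (use 1 in auto)
  then show ?thesis by simp
qed

context hilbert
begin

lemma antiholo_line_DERIV:
  assumes \<kappa>: "antiholo \<kappa> V" and h: "h \<in> hcarrier H" and p: "p + \<tau>0 *s b \<in> V"
  shows "((\<lambda>\<tau>. \<langle>h, \<kappa> (p + \<tau> *s b)\<rangle>) has_field_derivative \<langle>h, dd \<kappa> b (p + \<tau>0 *s b)\<rangle>) (at \<tau>0)"
proof -
  have "((\<lambda>\<tau>. \<langle>h, \<kappa> ((p + \<tau>0 *s b) + \<tau> *s b)\<rangle>) has_field_derivative \<langle>h, dd \<kappa> b (p + \<tau>0 *s b)\<rangle>) (at 0)"
    using ddir_DERIV[OF antiholo_line[OF \<kappa> h] p, of b] inner_dd[OF \<kappa> p h] by simp
  then show ?thesis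
    using DERIV_at_within_shift[of "\<lambda>\<tau>. \<langle>h, \<kappa> (p + \<tau> *s b)\<rangle>" _ \<tau>0 0 UNIV] by (simp add: shift_line)
qed

text \<open>A kernel normalised at \<open>v0\<close> is constant in the other variable there.\<close>

lemma dd_normalised:
  assumes \<kappa>: "antiholo \<kappa> V" and v0: "v0 \<in> V" and norm: "\<And>z. z \<in> V \<Longrightarrow> \<langle>\<kappa> v0, \<kappa> z\<rangle> = 1" and w: "w \<in> V"
  shows "\<langle>dd \<kappa> c w, \<kappa> v0\<rangle> = 0"
proof -
  have "((\<lambda>\<tau>. 1) has_field_derivative \<langle>\<kappa> v0, dd \<kappa> c (w + 0 *s c)\<rangle>) (at (0::complex))"
    by (rule has_field_derivative_transform_within_open[OF antiholo_line_DERIV[OF \<kappa> antiholo_mem[OF \<kappa> v0]]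
          open_line[OF antiholo_open[OF \<kappa>], of w c]]) (use w norm in auto)
  then have "\<langle>\<kappa> v0, dd \<kappa> c w\<rangle> = 0" using DERIV_unique[OF _ DERIV_const] by simp
  then show ?thesis using inner_commute[OF antiholo_mem[OF \<kappa> v0] dd_mem[OF \<kappa> w]] by simp
qed

text \<open>The polarized curvature: \<open>\<partial>\<^sub>b \<partial>bar\<^sub>c log \<langle>\<kappa> w, \<kappa> z\<rangle>\<close>, with \<open>\<partial>\<^sub>b\<close> acting in \<open>z\<close> and \<open>\<partial>bar\<^sub>c\<close> in \<open>w\<close>.\<close>

definition curv :: "(complex ^ 'm::finite \<Rightarrow> 'h) \<Rightarrow> complex ^ 'm \<Rightarrow> complex ^ 'm \<Rightarrow> complex ^ 'm \<Rightarrow> complex ^ 'm \<Rightarrow> complex" where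
  "curv \<kappa> b c z w = (\<langle>dd \<kappa> c w, dd \<kappa> b z\<rangle> * \<langle>\<kappa> w, \<kappa> z\<rangle> - \<langle>dd \<kappa> c w, \<kappa> z\<rangle> * \<langle>\<kappa> w, dd \<kappa> b z\<rangle>) / \<langle>\<kappa> w, \<kappa> z\<rangle>\<^sup>2"

lemma curv_DERIV:
  assumes \<kappa>: "antiholo \<kappa> V" and w: "w \<in> V" and z: "p + \<tau> *s b \<in> V"
    and nz: "\<langle>\<kappa> w, \<kappa> (p + \<tau> *s b)\<rangle> \<noteq> 0"
  shows "((\<lambda>\<tau>. \<langle>dd \<kappa> c w, \<kappa> (p + \<tau> *s b)\<rangle> / \<langle>\<kappa> w, \<kappa> (p + \<tau> *s b)\<rangle>)
    has_field_derivative curv \<kappa> b c (p + \<tau> *s b) w) (at \<tau>)"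
  using DERIV_divide[OF antiholo_line_DERIV[OF \<kappa> dd_mem[OF \<kappa> w] z] antiholo_line_DERIV[OF \<kappa> antiholo_mem[OF \<kappa> w] z] nz]
  by (simp add: curv_def power2_eq_square)

text \<open>Cauchy's estimate on the complex line through \<open>v0\<close> and \<open>w\<close>: as \<open>w\<close> approaches \<open>v0\<close>, ever larger
  discs of this line fit into a given ball, on which \<open>\<kappa>\<close> is bounded in norm, so \<open>\<langle>\<kappa> z, \<kappa> w\<rangle>\<close> is close to
  \<open>\<langle>\<kappa> z, \<kappa> v0\<rangle> = 1\<close>, uniformly in \<open>z\<close>.\<close>

lemma normalised_nonzero_near:
  fixes v0 :: "complex ^ 'm::finite"
  assumes \<kappa>: "antiholo \<kappa> V" and v0: "v0 \<in> V" and norm: "\<And>z. z \<in> V \<Longrightarrow> \<langle>\<kappa> v0, \<kappa> z\<rangle> = 1"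
  obtains r where "r > 0" "ball v0 r \<subseteq> V" "\<And>z w. z \<in> ball v0 r \<Longrightarrow> w \<in> ball v0 r \<Longrightarrow> \<langle>\<kappa> w, \<kappa> z\<rangle> \<noteq> 0"
proof -
  have V: "open V" using \<kappa> by (rule antiholo_open)
  obtain e where e: "e > 0" "cball v0 e \<subseteq> V" using V v0 open_contains_cball by blast
  obtain B where B: "B \<ge> 0" "\<And>u. u \<in> cball v0 e \<Longrightarrow> hnorm H (\<kappa> u) \<le> B"
    using antiholo_bounded[OF \<kappa> compact_cball e(2)] by blast
  have mem: "\<kappa> u \<in> hcarrier H" if "u \<in> cball v0 e" for u using that e(2) antiholo_mem[OF \<kappa>] by blast
  define C where "C = B * B + 1"
  have C: "C \<ge> 1" using B(1) by (simp add: C_def)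
  define r where "r = e / (2 * C)"
  have r: "r > 0" "r \<le> e / 2" using e(1) C by (auto simp: r_def field_simps)
  have "\<langle>\<kappa> w, \<kappa> z\<rangle> \<noteq> 0" if z: "z \<in> ball v0 r" and w: "w \<in> ball v0 r" for z w
  proof
    assume 0: "\<langle>\<kappa> w, \<kappa> z\<rangle> = 0"
    define b where "b = w - v0"
    have ze: "z \<in> cball v0 e" and we: "w \<in> cball v0 e" using z w r e(1) by auto
    have "w \<noteq> v0" using 0 norm[of z] ze e(2) by auto
    then have b: "norm b > 0" "norm b < r" using w by (auto simp: b_def dist_norm norm_minus_commute)
    have room: "v0 + \<tau> *s b \<in> cball v0 e" if "cmod \<tau> \<le> e / norm b" for \<tau>
      using that b(1) by (simp add: dist_norm norm_smult_vec le_divide_eq)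
    have "cmod (\<langle>\<kappa> z, \<kappa> (v0 + 1 *s b)\<rangle> - \<langle>\<kappa> z, \<kappa> (v0 + 0 *s b)\<rangle>) \<le> 2 * (B * B) / (e / norm b) * cmod 1"
    proof (rule cauchy_estimates(2)[of "\<lambda>\<tau>. \<langle>\<kappa> z, \<kappa> (v0 + \<tau> *s b)\<rangle>" "{\<tau>. v0 + \<tau> *s b \<in> V}"])
      show "(\<lambda>\<tau>. \<langle>\<kappa> z, \<kappa> (v0 + \<tau> *s b)\<rangle>) holomorphic_on {\<tau>. v0 + \<tau> *s b \<in> V}"
        by (rule line_holo_holomorphic[OF antiholo_line[OF \<kappa> mem[OF ze]] V]) simp
      show "open {\<tau>. v0 + \<tau> *s b \<in> V}" by (rule open_line[OF V])
      show "cball 0 (e / norm b) \<subseteq> {\<tau>. v0 + \<tau> *s b \<in> V}"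
        using room e(2) unfolding subset_iff by simp
      show "cmod \<langle>\<kappa> z, \<kappa> (v0 + \<tau> *s b)\<rangle> \<le> B * B" if \<tau>: "cmod \<tau> \<le> e / norm b" for \<tau>
      proof -
        have "cmod \<langle>\<kappa> z, \<kappa> (v0 + \<tau> *s b)\<rangle> \<le> hnorm H (\<kappa> z) * hnorm H (\<kappa> (v0 + \<tau> *s b))"
          by (rule Cauchy_Schwarz[OF mem[OF ze] mem[OF room[OF \<tau>]]])
        also have "\<dots> \<le> B * B"
          by (rule mult_mono[OF B(2)[OF ze] B(2)[OF room[OF \<tau>]] B(1) hnorm_ge_0[OF mem[OF room[OF \<tau>]]]])
        finally show ?thesis .
      qed
      show "e / norm b > 0" "cmod 1 \<le> e / norm b / 2" using b r e(1) by (auto simp: field_simps)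
    qed
    moreover have "\<langle>\<kappa> z, \<kappa> w\<rangle> = 0" "\<langle>\<kappa> z, \<kappa> v0\<rangle> = 1"
      using inner_commute[OF mem[OF we] mem[OF ze]] inner_commute[OF mem[of v0] mem[OF ze]] 0 norm[of z] ze e by auto
    ultimately have "1 \<le> 2 * (B * B) * norm b / e" by (simp add: b_def)
    also have "\<dots> \<le> 2 * (B * B) * r / e"
      using b e(1) B(1) by (intro divide_right_mono mult_left_mono) auto
    also have "\<dots> = B * B / C" using e(1) C by (simp add: r_def field_simps)
    also have "\<dots> < 1" using C by (simp add: divide_less_eq) (simp add: C_def)
    finally show False by simp
  qed
  moreover have "ball v0 r \<subseteq> V" using r e by (auto simp: subset_iff)
  ultimately show ?thesis using that r(1) by blast
qed

end

section \<open>Two normalised kernels\<close>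

locale two_frames = M: hilbert M + M': hilbert M'
  for M :: "'h::complex_vector hspace" and M' :: "'k::complex_vector hspace" +
  fixes \<kappa> :: "complex ^ 'm::finite \<Rightarrow> 'h" and \<kappa>' :: "complex ^ 'm \<Rightarrow> 'k"
    and V L :: "(complex ^ 'm) set" and v0 :: "complex ^ 'm"
  assumes \<kappa>: "M.antiholo \<kappa> V" and \<kappa>': "M'.antiholo \<kappa>' V"
    and L: "vec.subspace L" and connected: "connected (V \<inter> L)" and v0: "v0 \<in> V" "v0 \<in> L"
    and normalised: "\<And>z. z \<in> V \<Longrightarrow> hinner M (\<kappa> v0) (\<kappa> z) = 1"
    and normalised': "\<And>z. z \<in> V \<Longrightarrow> hinner M' (\<kappa>' v0) (\<kappa>' z) = 1"
begin

lemma V: "open V" using M.antiholo_open[OF \<kappa>] .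

lemma polarized_eq:
  assumes "M.antiholo \<alpha> V" "M.antiholo \<beta> V" "M'.antiholo \<alpha>' V" "M'.antiholo \<beta>' V"
    and "r > 0" "\<And>v. v \<in> ball v0 r \<inter> V \<inter> L \<Longrightarrow> hinner M (\<alpha> v) (\<beta> v) = hinner M' (\<alpha>' v) (\<beta>' v)"
    and "z \<in> V \<inter> L" "w \<in> V \<inter> L"
  shows "hinner M (\<alpha> w) (\<beta> z) = hinner M' (\<alpha>' w) (\<beta>' z)"
proof -
  have "sesqui (\<lambda>z w. hinner M (\<alpha> w) (\<beta> z) - hinner M' (\<alpha>' w) (\<beta>' z)) V"
    using assms by (intro sesqui_diff M.sesqui_inner M'.sesqui_inner)
  then have "hinner M (\<alpha> w) (\<beta> z) - hinner M' (\<alpha>' w) (\<beta>' z) = 0"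
    by (rule sesqui_eq_0[OF _ V L connected, of _ v0 r]) (use assms v0 in auto)
  then show ?thesis by simp
qed

text \<open>Two kernels normalised at the same point are determined by their curvature along \<open>L\<close>. Polarized, the hypothesis
  says that \<open>\<partial>\<^sub>b (\<partial>bar\<^sub>c K / K)\<close> agrees for both. At \<open>z = v0\<close> the quotient \<open>\<partial>bar\<^sub>c K / K\<close> vanishes, so it agrees for
  all \<open>z\<close> near \<open>v0\<close>; hence the quotient \<open>K / K'\<close> is constant in \<open>w\<close>, and it is \<open>1\<close> at \<open>w = v0\<close>. The argument needs
  kernels without zeros and therefore stays near \<open>v0\<close>; the identity theorem takes over from there.\<close>

lemma kernel_eq_of_curv_eq:
  assumes pos: "\<And>v. v \<in> V \<Longrightarrow> hinner M (\<kappa> v) (\<kappa> v) \<noteq> 0" "\<And>v. v \<in> V \<Longrightarrow> hinner M' (\<kappa>' v) (\<kappa>' v) \<noteq> 0"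
    and curv: "\<And>b c v. b \<in> L \<Longrightarrow> c \<in> L \<Longrightarrow> v \<in> V \<inter> L \<Longrightarrow> M.curv \<kappa> b c v v = M'.curv \<kappa>' b c v v"
    and z: "z \<in> V \<inter> L" and w: "w \<in> V \<inter> L"
  shows "hinner M (\<kappa> w) (\<kappa> z) = hinner M' (\<kappa>' w) (\<kappa>' z)"
proof -
  define D where "D z w = hinner M (\<kappa> w) (\<kappa> z)" for z w
  define D' where "D' z w = hinner M' (\<kappa>' w) (\<kappa>' z)" for z w
  define N where "N b c z w = hinner M (M.dd \<kappa> c w) (M.dd \<kappa> b z) * D z w - hinner M (M.dd \<kappa> c w) (\<kappa> z) * hinner M (\<kappa> w) (M.dd \<kappa> b z)" for b c z w
  define N' where "N' b c z w = hinner M' (M'.dd \<kappa>' c w) (M'.dd \<kappa>' b z) * D' z w - hinner M' (M'.dd \<kappa>' c w) (\<kappa>' z) * hinner M' (\<kappa>' w) (M'.dd \<kappa>' b z)" for b c z w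
  have cN: "M.curv \<kappa> b c z w = N b c z w / (D z w)\<^sup>2" for b c z w by (simp add: M.curv_def N_def D_def)
  have cN': "M'.curv \<kappa>' b c z w = N' b c z w / (D' z w)\<^sup>2" for b c z w by (simp add: M'.curv_def N'_def D'_def)
  \<comment> \<open>without denominators the condition can be polarized on all of \<open>V \<inter> L\<close>\<close>
  have cross: "N b c z w * (D' z w * D' z w) - N' b c z w * (D z w * D z w) = 0"
    if b: "b \<in> L" and c: "c \<in> L" and "z \<in> V \<inter> L" "w \<in> V \<inter> L" for b c z w
  proof (rule sesqui_eq_0[OF _ V L connected, of _ v0 1])
    show "sesqui (\<lambda>z w. N b c z w * (D' z w * D' z w) - N' b c z w * (D z w * D z w)) V"
      unfolding N_def N'_def D_def D'_def
      by (intro sesqui_diff sesqui_mult M.sesqui_inner M'.sesqui_inner M.antiholo_dd M'.antiholo_dd \<kappa> \<kappa>')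
    fix v assume v: "v \<in> ball v0 1 \<inter> V \<inter> L"
    then have "N b c v v / (D v v)\<^sup>2 = N' b c v v / (D' v v)\<^sup>2"
      using curv[OF b c, of v] by (simp add: cN cN')
    then show "N b c v v * (D' v v * D' v v) - N' b c v v * (D v v * D v v) = 0"
      using pos v by (simp add: D_def D'_def frac_eq_eq power2_eq_square)
  qed (use that v0 in auto)
  obtain r1 where r1: "r1 > 0" "ball v0 r1 \<subseteq> V" "\<And>z w. z \<in> ball v0 r1 \<Longrightarrow> w \<in> ball v0 r1 \<Longrightarrow> D z w \<noteq> 0"
    unfolding D_def using M.normalised_nonzero_near[OF \<kappa> v0(1) normalised] by blast
  obtain r2 where r2: "r2 > 0" "ball v0 r2 \<subseteq> V" "\<And>z w. z \<in> ball v0 r2 \<Longrightarrow> w \<in> ball v0 r2 \<Longrightarrow> D' z w \<noteq> 0"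
    unfolding D'_def using M'.normalised_nonzero_near[OF \<kappa>' v0(1) normalised'] by blast
  define r where "r = min r1 r2"
  have r: "r > 0" "ball v0 r \<subseteq> V" using r1 r2 by (auto simp: r_def)
  have nz: "D z w \<noteq> 0" "D' z w \<noteq> 0" if "z \<in> ball v0 r" "w \<in> ball v0 r" for z w
    using r1(3) r2(3) that by (auto simp: r_def)
  have memb: "\<kappa> v \<in> hcarrier M" "M.dd \<kappa> c v \<in> hcarrier M" "\<kappa>' v \<in> hcarrier M'" "M'.dd \<kappa>' c v \<in> hcarrier M'"
    if "v \<in> V" for c v
    using that M.antiholo_mem[OF \<kappa>] M'.antiholo_mem[OF \<kappa>'] M.dd_mem[OF \<kappa>] M'.dd_mem[OF \<kappa>'] by auto
  have dd0: "hinner M (M.dd \<kappa> c w) (\<kappa> v0) = 0" "hinner M' (M'.dd \<kappa>' c w) (\<kappa>' v0) = 0" if "w \<in> V" for c w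
    using M.dd_normalised[OF \<kappa> v0(1) normalised that] M'.dd_normalised[OF \<kappa>' v0(1) normalised' that] by simp_all
  \<comment> \<open>first integration, along the line from \<open>v0\<close> to \<open>z\<close>\<close>
  have logd: "hinner M (M.dd \<kappa> c w) (\<kappa> z) / D z w = hinner M' (M'.dd \<kappa>' c w) (\<kappa>' z) / D' z w"
    if c: "c \<in> L" and z: "z \<in> ball v0 r \<inter> L" and w: "w \<in> ball v0 r \<inter> L" for c z w
  proof -
    define b where "b = z - v0"
    have b: "b \<in> L" using z L v0 by (simp add: b_def vec.subspace_diff)
    define S where "S = {\<tau>. v0 + \<tau> *s b \<in> ball v0 r}"
    define R where "R \<tau> = hinner M (M.dd \<kappa> c w) (\<kappa> (v0 + \<tau> *s b)) / hinner M (\<kappa> w) (\<kappa> (v0 + \<tau> *s b)) -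
      hinner M' (M'.dd \<kappa>' c w) (\<kappa>' (v0 + \<tau> *s b)) / hinner M' (\<kappa>' w) (\<kappa>' (v0 + \<tau> *s b))" for \<tau>
    have wV: "w \<in> V" using w r by blast
    have "(R has_field_derivative 0) (at \<tau> within S)" if \<tau>: "\<tau> \<in> S" for \<tau>
    proof -
      define p where "p = v0 + \<tau> *s b"
      have p: "p \<in> ball v0 r" "p \<in> V" "p \<in> L"
        using \<tau> r(2) b L v0(2) by (auto simp: S_def p_def vec.subspace_add vec.subspace_scale)
      have pV: "v0 + \<tau> *s b \<in> V" using p(2) by (simp add: p_def)
      have nzp: "D p w \<noteq> 0" "D' p w \<noteq> 0" using nz p w by auto
      have "(R has_field_derivative (M.curv \<kappa> b c p w - M'.curv \<kappa>' b c p w)) (at \<tau>)"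
        unfolding R_def p_def
        by (rule DERIV_diff[OF M.curv_DERIV[OF \<kappa> wV pV] M'.curv_DERIV[OF \<kappa>' wV pV]])
          (use nzp in \<open>simp_all add: D_def D'_def p_def\<close>)
      moreover have "M.curv \<kappa> b c p w = M'.curv \<kappa>' b c p w"
        using cross[OF b c, of p w] p w wV nzp by (simp add: cN cN' frac_eq_eq power2_eq_square)
      ultimately show ?thesis by (auto intro: has_field_derivative_at_within)
    qed
    then obtain k where k: "\<And>\<tau>. \<tau> \<in> S \<Longrightarrow> R \<tau> = k"
      using has_field_derivative_zero_constant[of S R] convex_line[OF convex_ball] unfolding S_def by blast
    have "0 \<in> S" "1 \<in> S" using r z by (auto simp: S_def b_def)
    then have "R 1 = R 0" using k by simp
    also have "R 0 = 0" using dd0[OF wV] by (simp add: R_def)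
    finally show ?thesis by (simp add: R_def b_def D_def D'_def)
  qed
  \<comment> \<open>second integration, along the line from \<open>v0\<close> to \<open>w\<close>; the order of the arguments makes the quotient holomorphic\<close>
  have local: "D z w = D' z w" if z: "z \<in> ball v0 r \<inter> L" and w: "w \<in> ball v0 r \<inter> L" for z w
  proof -
    define c where "c = w - v0"
    have c: "c \<in> L" using w L v0 by (simp add: c_def vec.subspace_diff)
    define S where "S = {\<tau>. v0 + \<tau> *s c \<in> ball v0 r}"
    define R where "R \<tau> = hinner M (\<kappa> z) (\<kappa> (v0 + \<tau> *s c)) / hinner M' (\<kappa>' z) (\<kappa>' (v0 + \<tau> *s c))" for \<tau>
    have zV: "z \<in> V" using z r by blast
    have "(R has_field_derivative 0) (at \<tau> within S)" if \<tau>: "\<tau> \<in> S" for \<tau>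
    proof -
      define p where "p = v0 + \<tau> *s c"
      have p: "p \<in> ball v0 r \<inter> L" "p \<in> V"
        using \<tau> r(2) c L v0(2) by (auto simp: S_def p_def vec.subspace_add vec.subspace_scale)
      have pV: "v0 + \<tau> *s c \<in> V" using p(2) by (simp add: p_def)
      have nzp: "hinner M' (\<kappa>' z) (\<kappa>' p) \<noteq> 0" using nz[of p z] p z by (simp add: D'_def)
      have "(R has_field_derivative (hinner M (\<kappa> z) (M.dd \<kappa> c p) * hinner M' (\<kappa>' z) (\<kappa>' p) -
          hinner M (\<kappa> z) (\<kappa> p) * hinner M' (\<kappa>' z) (M'.dd \<kappa>' c p)) / (hinner M' (\<kappa>' z) (\<kappa>' p) * hinner M' (\<kappa>' z) (\<kappa>' p))) (at \<tau>)"
        unfolding R_def p_def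
        by (rule DERIV_divide[OF M.antiholo_line_DERIV[OF \<kappa> memb(1)[OF zV] pV] M'.antiholo_line_DERIV[OF \<kappa>' memb(3)[OF zV] pV]])
          (use nzp in \<open>simp add: p_def\<close>)
      moreover have "hinner M (\<kappa> z) (M.dd \<kappa> c p) * hinner M' (\<kappa>' z) (\<kappa>' p) -
          hinner M (\<kappa> z) (\<kappa> p) * hinner M' (\<kappa>' z) (M'.dd \<kappa>' c p) = 0"
      proof -
        have "hinner M (M.dd \<kappa> c p) (\<kappa> z) * D' z p = hinner M' (M'.dd \<kappa>' c p) (\<kappa>' z) * D z p"
          using logd[OF c z p(1)] nz[of z p] z p by (simp add: frac_eq_eq)
        from arg_cong[OF this, of cnj]
        have "cnj (hinner M (M.dd \<kappa> c p) (\<kappa> z)) * cnj (D' z p) = cnj (hinner M' (M'.dd \<kappa>' c p) (\<kappa>' z)) * cnj (D z p)"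
          by simp
        then show ?thesis
          unfolding D_def D'_def M.inner_commute[OF memb(2)[OF p(2)] memb(1)[OF zV], symmetric]
            M.inner_commute[OF memb(1)[OF p(2)] memb(1)[OF zV], symmetric]
            M'.inner_commute[OF memb(4)[OF p(2)] memb(3)[OF zV], symmetric]
            M'.inner_commute[OF memb(3)[OF p(2)] memb(3)[OF zV], symmetric]
          by (simp add: mult.commute)
      qed
      ultimately show ?thesis by (auto intro: has_field_derivative_at_within)
    qed
    then obtain k where k: "\<And>\<tau>. \<tau> \<in> S \<Longrightarrow> R \<tau> = k"
      using has_field_derivative_zero_constant[of S R] convex_line[OF convex_ball] unfolding S_def by blast
    have "0 \<in> S" "1 \<in> S" using r w by (auto simp: S_def c_def)
    then have "R 1 = R 0" using k by simp
    also have "R 0 = 1"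
      using normalised[OF zV] normalised'[OF zV] M.inner_commute[OF memb(1)[OF v0(1)] memb(1)[OF zV]]
        M'.inner_commute[OF memb(3)[OF v0(1)] memb(3)[OF zV]] by (simp add: R_def)
    finally have "hinner M (\<kappa> z) (\<kappa> w) = hinner M' (\<kappa>' z) (\<kappa>' w)"
      by (simp add: R_def c_def split: if_splits)
    then show ?thesis
      unfolding D_def D'_def using w r(2) memb zV M.inner_commute[of "\<kappa> z" "\<kappa> w"] M'.inner_commute[of "\<kappa>' z" "\<kappa>' w"]
      by (auto simp: subset_iff)
  qed
  show ?thesis
    by (rule polarized_eq[OF \<kappa> \<kappa> \<kappa>' \<kappa>' r(1) _ z w]) (use local in \<open>auto simp: D_def D'_def\<close>)
qed

end

section \<open>Wirtinger derivatives in adapted coordinates\<close>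

lemma has_derivative_vec_componentwise:
  fixes g :: "'a::real_normed_vector \<Rightarrow> complex ^ 'm::finite"
  assumes "\<And>i. ((\<lambda>u. g u $ i) has_derivative (\<lambda>h. G h $ i)) (at v)"
  shows "(g has_derivative G) (at v)"
proof -
  have "((\<lambda>u. \<Sum>i\<in>UNIV. (g u $ i) *s axis i 1) has_derivative (\<lambda>h. \<Sum>i\<in>UNIV. (G h $ i) *s axis i 1)) (at v)"
    by (intro has_derivative_sum bounded_linear.has_derivative[OF bounded_linear_smult_vec] assms)
  then show ?thesis by (simp only: basis_expansion)
qed

text \<open>In the coordinates \<open>\<zeta>\<close> the hypersurface is \<open>V \<inter> L\<close>, an open connected piece of a hyperplane.\<close>

locale chart =
  fixes \<Omega> Z U :: "(complex ^ 'm::finite) set"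
    and \<zeta> :: "complex ^ 'm \<Rightarrow> complex ^ 'm" and \<nu> :: 'm and w0 :: "complex ^ 'm"
  assumes domain: "bounded_domain \<Omega>"
    and coordinates: "adapted_coordinates \<Omega> Z U \<zeta> \<nu> w0"
begin

abbreviation \<psi> :: "complex ^ 'm \<Rightarrow> complex ^ 'm" where "\<psi> \<equiv> inv_into U \<zeta>"
abbreviation V :: "(complex ^ 'm) set" where "V \<equiv> \<zeta> ` U"
abbreviation L :: "(complex ^ 'm) set" where "L \<equiv> {v. v $ \<nu> = 0}"
abbreviation e :: "'m \<Rightarrow> complex ^ 'm" where "e i \<equiv> axis i 1"

lemma open_V: "open V" and inj: "inj_on \<zeta> U" and U_sub: "U \<subseteq> \<Omega>" and w0: "w0 \<in> U" "w0 \<in> Z"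
  and U_Z: "U \<inter> Z = {z \<in> U. \<zeta> z $ \<nu> = 0}" and open_U: "open U"
  using coordinates by (auto simp: adapted_coordinates_def)

lemma \<psi>_mem: "v \<in> V \<Longrightarrow> \<psi> v \<in> U" and \<zeta>_\<psi>: "v \<in> V \<Longrightarrow> \<zeta> (\<psi> v) = v"
  by (auto intro: inv_into_into f_inv_into_f)

lemma \<psi>_\<zeta>: "z \<in> U \<Longrightarrow> \<psi> (\<zeta> z) = z"
  using inj by simp

lemma V_L: "V \<inter> L = \<zeta> ` (U \<inter> Z)"
  unfolding U_Z by auto

lemma subspace_L: "vec.subspace L"
  by (auto intro!: vec.subspaceI)

lemma connected_V_L: "connected (V \<inter> L)"
proof -
  have "continuous_on U (\<lambda>z. \<zeta> z $ i)" for i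
    using coordinates holo_on_line_holo by (auto simp: adapted_coordinates_def line_holo_def)
  then have "continuous_on U \<zeta>"
    using continuous_on_vec_lambda[of U "\<lambda>i z. \<zeta> z $ i"] by simp
  then show ?thesis
    unfolding V_L using coordinates
    by (intro connected_continuous_image) (auto simp: adapted_coordinates_def intro: continuous_on_subset)
qed

lemma holo_on_\<psi>:
  assumes f: "holo_on f \<Omega>" shows "holo_on (\<lambda>v. f (\<psi> v)) V"
  unfolding holo_on_def
proof
  fix v assume v: "v \<in> V"
  have "holo_on (\<lambda>v. \<psi> v $ i) V" for i
    using coordinates by (simp add: adapted_coordinates_def)
  then have "\<exists>D. ((\<lambda>v. \<psi> v $ i) has_derivative D) (at v) \<and> (\<forall>c u. D (c *s u) = c * D u)" for i
    using v unfolding holo_on_def by blast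
  then obtain D where D: "\<And>i. ((\<lambda>v. \<psi> v $ i) has_derivative D i) (at v)" "\<And>i c u. D i (c *s u) = c * D i u"
    by metis
  define G where "G u = (\<chi> i. D i u)" for u
  have G: "(\<psi> has_derivative G) (at v)"
    by (rule has_derivative_vec_componentwise) (simp add: G_def D(1))
  have Gs: "G (c *s u) = c *s G u" for c u by (simp add: G_def D(2) vec_eq_iff)
  have "\<psi> v \<in> \<Omega>" using \<psi>_mem[OF v] U_sub by blast
  then obtain E where E: "(f has_derivative E) (at (\<psi> v))" "\<And>c u. E (c *s u) = c * E u"
    using f by (auto simp: holo_on_def)
  have "((\<lambda>v. f (\<psi> v)) has_derivative (\<lambda>u. E (G u))) (at v)"
    by (rule has_derivative_compose[OF G E(1)])
  then show "\<exists>D. ((\<lambda>v. f (\<psi> v)) has_derivative D) (at v) \<and> (\<forall>c u. D (c *s u) = c * D u)"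
    using E(2) Gs by auto
qed

lemma wirtinger:
  assumes d: "((\<lambda>\<tau>. f (\<psi> (\<zeta> z + \<tau> *s e i))) has_derivative (\<lambda>\<tau>. \<tau> * p + cnj \<tau> * q)) (at 0)"
  shows "dz U \<zeta> i f z = p" "dzbar U \<zeta> i f z = q"
proof -
  have vd: "vector_derivative (\<lambda>t. f (shift_coord U \<zeta> i z (c * of_real t))) (at 0) = c * p + cnj c * q" for c
  proof -
    have "((\<lambda>t. c * of_real t) has_derivative (\<lambda>t. c * of_real t)) (at (0::real))"
      by (auto intro!: derivative_eq_intros)
    then have "((\<lambda>t. f (\<psi> (\<zeta> z + (c * of_real t) *s e i))) has_derivative (\<lambda>t. (c * of_real t) * p + cnj (c * of_real t) * q)) (at (0::real))"
      using has_derivative_compose[of "\<lambda>t. c * of_real t" "\<lambda>t. c * of_real t" 0 UNIV _ _] d by fastforce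
    moreover have "(\<lambda>t. (c * of_real t) * p + cnj (c * of_real t) * q) = (\<lambda>t. t *\<^sub>R (c * p + cnj c * q))"
      by (simp add: fun_eq_iff scaleR_conv_of_real algebra_simps)
    moreover have ax: "axis i (c * of_real t) = (c * of_real t) *s e i" for t
      by (simp add: vec_eq_iff axis_def)
    ultimately show ?thesis
      unfolding shift_coord_def ax by (intro vector_derivative_at) (simp add: has_vector_derivative_def)
  qed
  have "vector_derivative (\<lambda>t. f (shift_coord U \<zeta> i z (of_real t))) (at 0) = p + q"
    using vd[of 1] by simp
  moreover have "vector_derivative (\<lambda>t. f (shift_coord U \<zeta> i z (\<i> * of_real t))) (at 0) = \<i> * p - \<i> * q"
    using vd[of \<i>] by simp
  ultimately show "dz U \<zeta> i f z = p" "dzbar U \<zeta> i f z = q"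
    unfolding dz_def dzbar_def by (simp_all only:) (simp_all add: algebra_simps)
qed

text \<open>On a coordinate line the values matter only near \<open>\<tau> = 0\<close>, and there the line stays in \<open>U\<close>.\<close>

lemma wirtinger_local:
  assumes z: "z \<in> U" and eq: "\<And>x. x \<in> U \<Longrightarrow> f x = g (\<zeta> x)"
    and d: "((\<lambda>\<tau>. g (\<zeta> z + \<tau> *s e i)) has_derivative (\<lambda>\<tau>. \<tau> * p + cnj \<tau> * q)) (at 0)"
  shows "dz U \<zeta> i f z = p" "dzbar U \<zeta> i f z = q"
proof -
  have "((\<lambda>\<tau>. f (\<psi> (\<zeta> z + \<tau> *s e i))) has_derivative (\<lambda>\<tau>. \<tau> * p + cnj \<tau> * q)) (at 0)"
  proof (rule has_derivative_transform_within_open[OF d open_line[OF open_V, of "\<zeta> z" "e i"]])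
    show "0 \<in> {\<tau>. \<zeta> z + \<tau> *s e i \<in> V}" using z by simp
    show "g (\<zeta> z + \<tau> *s e i) = f (\<psi> (\<zeta> z + \<tau> *s e i))" if "\<tau> \<in> {\<tau>. \<zeta> z + \<tau> *s e i \<in> V}" for \<tau>
    proof -
      have m: "\<zeta> z + \<tau> *s e i \<in> V" using that by blast
      show ?thesis using eq[OF \<psi>_mem[OF m]] by (simp only: \<zeta>_\<psi>[OF m])
    qed
  qed
  then show "dz U \<zeta> i f z = p" "dzbar U \<zeta> i f z = q" by (rule wirtinger)+
qed

lemma wirtinger_holo:
  assumes "z \<in> U" "\<And>x. x \<in> U \<Longrightarrow> f x = g (\<zeta> x)"
    and "((\<lambda>\<tau>. g (\<zeta> z + \<tau> *s e i)) has_field_derivative p) (at 0)"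
  shows "dz U \<zeta> i f z = p"
proof -
  have "((\<lambda>\<tau>. g (\<zeta> z + \<tau> *s e i)) has_derivative (\<lambda>\<tau>. \<tau> * p + cnj \<tau> * 0)) (at 0)"
    using assms(3) by (simp add: has_field_derivative_def mult_commute_abs)
  then show ?thesis using wirtinger_local(1)[where f = f and g = g] assms(1,2) by blast
qed

end

section \<open>Kernel functions, jets and curvature of a module\<close>

locale kernel_module = chart \<Omega> Z U \<zeta> \<nu> w0
  for \<Omega> Z U :: "(complex ^ 'm::finite) set"
    and \<zeta> :: "complex ^ 'm \<Rightarrow> complex ^ 'm" and \<nu> :: 'm and w0 :: "complex ^ 'm" +
  fixes M :: "(complex ^ 'm \<Rightarrow> complex) hspace" and K :: "complex ^ 'm \<Rightarrow> complex ^ 'm \<Rightarrow> complex"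
  assumes module: "holomorphic_hilbert_module \<Omega> M"
    and kernel: "reproducing_kernel \<Omega> M K"
    and normalised_K: "normalised_at \<Omega> K w0"
begin

sublocale hilbert M
  using module by unfold_locales (simp add: holomorphic_hilbert_module_def pointwise_module_def)

abbreviation inner_M :: "(complex ^ 'm \<Rightarrow> complex) \<Rightarrow> (complex ^ 'm \<Rightarrow> complex) \<Rightarrow> complex" (\<open>\<langle>_, _\<rangle>\<close>)
  where "\<langle>g, h\<rangle> \<equiv> hinner M g h"

definition ker :: "complex ^ 'm \<Rightarrow> complex ^ 'm \<Rightarrow> complex" where
  "ker w = restrict0 \<Omega> (\<lambda>z. K z w)"

definition \<kappa> :: "complex ^ 'm \<Rightarrow> complex ^ 'm \<Rightarrow> complex" where
  "\<kappa> v = ker (\<psi> v)"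

abbreviation \<kappa>\<^sub>\<nu> :: "complex ^ 'm \<Rightarrow> complex ^ 'm \<Rightarrow> complex" where
  "\<kappa>\<^sub>\<nu> \<equiv> dd \<kappa> (e \<nu>)"

lemma ker_mem: "w \<in> \<Omega> \<Longrightarrow> ker w \<in> hcarrier M"
  and inner_ker: "w \<in> \<Omega> \<Longrightarrow> h \<in> hcarrier M \<Longrightarrow> \<langle>h, ker w\<rangle> = h w"
  using kernel by (auto simp: reproducing_kernel_def ker_def)

lemma K_inner: "z \<in> \<Omega> \<Longrightarrow> w \<in> \<Omega> \<Longrightarrow> K z w = \<langle>ker w, ker z\<rangle>"
  by (simp add: inner_ker ker_mem) (simp add: ker_def restrict0_def)

lemma holo_mem: "h \<in> hcarrier M \<Longrightarrow> holo_on h \<Omega>" and outside_0: "h \<in> hcarrier M \<Longrightarrow> z \<notin> \<Omega> \<Longrightarrow> h z = 0"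
  using module by (auto simp: holomorphic_hilbert_module_def)

lemma \<kappa>_mem: "v \<in> V \<Longrightarrow> \<kappa> v \<in> hcarrier M"
  and inner_\<kappa>: "v \<in> V \<Longrightarrow> h \<in> hcarrier M \<Longrightarrow> \<langle>h, \<kappa> v\<rangle> = h (\<psi> v)"
proof -
  assume "v \<in> V"
  then have "\<psi> v \<in> \<Omega>" using \<psi>_mem U_sub by blast
  then show "\<kappa> v \<in> hcarrier M" "h \<in> hcarrier M \<Longrightarrow> \<langle>h, \<kappa> v\<rangle> = h (\<psi> v)"
    by (simp_all add: \<kappa>_def ker_mem inner_ker)
qed

lemma holo_inner_\<kappa>:
  assumes "h \<in> hcarrier M" shows "holo_on (\<lambda>v. \<langle>h, \<kappa> v\<rangle>) V"
proof -
  have h: "holo_on (\<lambda>v. h (\<psi> v)) V" by (rule holo_on_\<psi>[OF holo_mem[OF assms]])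
  show ?thesis
    unfolding holo_on_def
  proof
    fix v assume v: "v \<in> V"
    then obtain D where D: "((\<lambda>v. h (\<psi> v)) has_derivative D) (at v)" "\<forall>c u. D (c *s u) = c * D u"
      using h unfolding holo_on_def by blast
    have "((\<lambda>v. \<langle>h, \<kappa> v\<rangle>) has_derivative D) (at v)"
      by (rule has_derivative_transform_within_open[OF D(1) open_V v]) (simp add: inner_\<kappa> assms)
    then show "\<exists>D. ((\<lambda>v. \<langle>h, \<kappa> v\<rangle>) has_derivative D) (at v) \<and> (\<forall>c u. D (c *s u) = c * D u)"
      using D(2) by blast
  qed
qed

lemma antiholo_\<kappa>: "antiholo \<kappa> V"
  unfolding antiholo_def using open_V \<kappa>_mem holo_on_line_holo[OF holo_inner_\<kappa>] by blast

lemma antiholo_\<kappa>\<^sub>\<nu>: "antiholo \<kappa>\<^sub>\<nu> V"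
  by (rule antiholo_dd[OF antiholo_\<kappa>])

lemma \<kappa>\<^sub>\<nu>_mem: "v \<in> V \<Longrightarrow> \<kappa>\<^sub>\<nu> v \<in> hcarrier M"
  by (rule dd_mem[OF antiholo_\<kappa>])

lemma inner_\<kappa>_\<kappa>\<^sub>\<nu>: "z \<in> V \<Longrightarrow> w \<in> V \<Longrightarrow> \<langle>\<kappa> w, \<kappa>\<^sub>\<nu> z\<rangle> = cnj \<langle>\<kappa>\<^sub>\<nu> z, \<kappa> w\<rangle>"
  by (rule inner_commute[OF \<kappa>\<^sub>\<nu>_mem \<kappa>_mem])

lemma \<kappa>_\<zeta>: "z \<in> U \<Longrightarrow> \<kappa> (\<zeta> z) = ker z"
  by (simp add: \<kappa>_def \<psi>_\<zeta>)

lemma dz_mem: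
  assumes "h \<in> hcarrier M" "z \<in> U" "\<And>x. x \<in> U \<Longrightarrow> f x = h x"
  shows "dz U \<zeta> i f z = \<langle>h, dd \<kappa> (e i) (\<zeta> z)\<rangle>"
proof (rule wirtinger_holo[OF assms(2), where g = "\<lambda>v. \<langle>h, \<kappa> v\<rangle>"])
  show "f x = \<langle>h, \<kappa> (\<zeta> x)\<rangle>" if "x \<in> U" for x
    using that assms U_sub by (auto simp: \<kappa>_\<zeta> inner_ker)
  show "((\<lambda>\<tau>. \<langle>h, \<kappa> (\<zeta> z + \<tau> *s e i)\<rangle>) has_field_derivative \<langle>h, dd \<kappa> (e i) (\<zeta> z)\<rangle>) (at 0)"
    using antiholo_line_DERIV[OF antiholo_\<kappa> assms(1), of "\<zeta> z" 0 "e i"] assms(2) by simp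
qed

lemma dzbar_K:
  assumes z: "z \<in> \<Omega>" and w: "w \<in> U"
  shows "dzbar U \<zeta> i (\<lambda>v. K z v) w = \<langle>dd \<kappa> (e i) (\<zeta> w), ker z\<rangle>"
proof (rule wirtinger_local(2)[OF w, where p = 0 and g = "\<lambda>v. cnj \<langle>ker z, \<kappa> v\<rangle>"])
  show "K z x = cnj \<langle>ker z, \<kappa> (\<zeta> x)\<rangle>" if "x \<in> U" for x
    using that z U_sub inner_commute[of "ker z" "ker x"] by (auto simp: \<kappa>_\<zeta> K_inner ker_mem)
  have w': "\<zeta> w \<in> V" using w by blast
  have "((\<lambda>\<tau>. \<langle>ker z, \<kappa> (\<zeta> w + \<tau> *s e i)\<rangle>) has_field_derivative \<langle>ker z, dd \<kappa> (e i) (\<zeta> w)\<rangle>) (at 0)"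
    using antiholo_line_DERIV[OF antiholo_\<kappa> ker_mem[OF z], of "\<zeta> w" 0 "e i"] w' by simp
  then have "((\<lambda>\<tau>. cnj \<langle>ker z, \<kappa> (\<zeta> w + \<tau> *s e i)\<rangle>) has_derivative (\<lambda>\<tau>. cnj (\<langle>ker z, dd \<kappa> (e i) (\<zeta> w)\<rangle> * \<tau>))) (at 0)"
    unfolding has_field_derivative_def by (rule bounded_linear.has_derivative[OF bounded_linear_cnj])
  then show "((\<lambda>\<tau>. cnj \<langle>ker z, \<kappa> (\<zeta> w + \<tau> *s e i)\<rangle>) has_derivative (\<lambda>\<tau>. \<tau> * 0 + cnj \<tau> * \<langle>dd \<kappa> (e i) (\<zeta> w), ker z\<rangle>)) (at 0)"
    using inner_commute[OF ker_mem[OF z] dd_mem[OF antiholo_\<kappa> w']] by (simp add: mult.commute)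
qed

lemma K_eq: "z \<in> U \<Longrightarrow> w \<in> U \<Longrightarrow> K z w = \<langle>\<kappa> (\<zeta> w), \<kappa> (\<zeta> z)\<rangle>"
  using K_inner[of z w] U_sub by (auto simp: \<kappa>_\<zeta>)

text \<open>The jet kernel is the Gram matrix of the vectors \<open>\<kappa>\<close> and \<open>\<kappa>\<^sub>\<nu>\<close>.\<close>

lemma jet_kernel_eq:
  assumes z: "z \<in> U" and w: "w \<in> U"
  shows "jet_kernel U \<zeta> \<nu> K z w =
    vector [vector [\<langle>\<kappa> (\<zeta> w), \<kappa> (\<zeta> z)\<rangle>, \<langle>\<kappa>\<^sub>\<nu> (\<zeta> w), \<kappa> (\<zeta> z)\<rangle>],
            vector [\<langle>\<kappa> (\<zeta> w), \<kappa>\<^sub>\<nu> (\<zeta> z)\<rangle>, \<langle>\<kappa>\<^sub>\<nu> (\<zeta> w), \<kappa>\<^sub>\<nu> (\<zeta> z)\<rangle>]]"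
proof -
  have w': "\<zeta> w \<in> V" using w by blast
  have zO: "z \<in> \<Omega>" using z U_sub by auto
  have 1: "dzbar U \<zeta> \<nu> (\<lambda>v. K x v) w = \<langle>\<kappa>\<^sub>\<nu> (\<zeta> w), ker x\<rangle>" if "x \<in> \<Omega>" for x
    using dzbar_K[OF that w] .
  have 2: "dz U \<zeta> \<nu> (\<lambda>x. K x w) z = \<langle>\<kappa> (\<zeta> w), \<kappa>\<^sub>\<nu> (\<zeta> z)\<rangle>"
    using U_sub by (intro dz_mem[OF \<kappa>_mem[OF w'] z]) (auto simp: \<kappa>_\<zeta>[OF w] ker_def restrict0_def)
  have 3: "dz U \<zeta> \<nu> (\<lambda>x. dzbar U \<zeta> \<nu> (\<lambda>v. K x v) w) z = \<langle>\<kappa>\<^sub>\<nu> (\<zeta> w), \<kappa>\<^sub>\<nu> (\<zeta> z)\<rangle>"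
    using U_sub by (intro dz_mem[OF \<kappa>\<^sub>\<nu>_mem[OF w'] z])
      (auto simp: 1 inner_ker \<kappa>\<^sub>\<nu>_mem[OF w'])
  show ?thesis
    using 1[OF zO] 2 3 K_eq[OF z w] z by (simp add: jet_kernel_def \<kappa>_\<zeta>)
qed

lemma normalised_\<kappa>: "v \<in> V \<Longrightarrow> \<langle>\<kappa> (\<zeta> w0), \<kappa> v\<rangle> = 1"
  using normalised_K U_sub w0 \<psi>_mem[of v] K_eq[of "\<psi> v" w0] \<zeta>_\<psi>[of v] by (auto simp: normalised_at_def)

text \<open>Positivity holds on all of \<open>\<Omega>\<close> because of the normalisation: \<open>\<langle>K(\<sqdot>,w0), K(\<sqdot>,z)\<rangle> = 1\<close>.\<close>

lemma ker_self: "z \<in> \<Omega> \<Longrightarrow> \<langle>ker z, ker z\<rangle> = of_real ((hnorm M (ker z))\<^sup>2) \<and> hnorm M (ker z) > 0"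
proof -
  assume z: "z \<in> \<Omega>"
  have "\<langle>ker w0, ker z\<rangle> = 1"
    using normalised_K U_sub w0 K_inner[OF z, of w0] z by (auto simp: normalised_at_def)
  then have "ker z \<noteq> 0" using ker_mem[of w0] w0 U_sub by auto
  then show ?thesis
    using inner_self[OF ker_mem[OF z]] hnorm_eq_0[OF ker_mem[OF z]] hnorm_ge_0[OF ker_mem[OF z]] by simp
qed

lemma \<kappa>_self_nz: "v \<in> V \<Longrightarrow> \<langle>\<kappa> v, \<kappa> v\<rangle> \<noteq> 0"
proof -
  assume "v \<in> V"
  then have "\<psi> v \<in> \<Omega>" using \<psi>_mem U_sub by blast
  then show ?thesis using ker_self[of "\<psi> v"] by (simp add: \<kappa>_def)
qed

text \<open>On the diagonal the logarithm is taken of a positive number, where it is holomorphic, so the chain rule applies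
  to the derivative of \<open>\<langle>\<kappa>, \<kappa>\<rangle>\<close>.\<close>

lemma curvature_coefficient:
  assumes w: "w \<in> U"
  shows "dz U \<zeta> i (dzbar U \<zeta> j (\<lambda>x. ln (K x x))) w = curv \<kappa> (e i) (e j) (\<zeta> w) (\<zeta> w)"
proof -
  have D: "((\<lambda>\<tau>. \<langle>\<alpha> (\<zeta> x + \<tau> *s e k), \<kappa> (\<zeta> x + \<tau> *s e k)\<rangle>) has_derivative
      (\<lambda>\<tau>. \<tau> * \<langle>\<alpha> (\<zeta> x), dd \<kappa> (e k) (\<zeta> x)\<rangle> + cnj \<tau> * \<langle>dd \<alpha> (e k) (\<zeta> x), \<kappa> (\<zeta> x)\<rangle>)) (at 0)"
    if "x \<in> U" "antiholo \<alpha> V" for x k \<alpha>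
    using that by (intro inner_antiholo_diagonal[OF _ antiholo_\<kappa>]) auto
  have bar: "dzbar U \<zeta> j (\<lambda>x. ln (K x x)) x = \<langle>dd \<kappa> (e j) (\<zeta> x), \<kappa> (\<zeta> x)\<rangle> / \<langle>\<kappa> (\<zeta> x), \<kappa> (\<zeta> x)\<rangle>" if x: "x \<in> U" for x
  proof (rule wirtinger_local(2)[OF x, where g = "\<lambda>v. ln \<langle>\<kappa> v, \<kappa> v\<rangle>" and p = "\<langle>\<kappa> (\<zeta> x), dd \<kappa> (e j) (\<zeta> x)\<rangle> / \<langle>\<kappa> (\<zeta> x), \<kappa> (\<zeta> x)\<rangle>"])
    have "\<langle>\<kappa> (\<zeta> x), \<kappa> (\<zeta> x)\<rangle> \<notin> \<real>\<^sub>\<le>\<^sub>0"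
      using ker_self[of x] x U_sub by (auto simp: \<kappa>_\<zeta> complex_nonpos_Reals_iff)
    then have "(ln has_field_derivative inverse \<langle>\<kappa> (\<zeta> x), \<kappa> (\<zeta> x)\<rangle>) (at \<langle>\<kappa> (\<zeta> x), \<kappa> (\<zeta> x)\<rangle>)"
      by (rule has_field_derivative_Ln)
    then have "(ln has_derivative (*) (inverse \<langle>\<kappa> (\<zeta> x), \<kappa> (\<zeta> x)\<rangle>)) (at \<langle>\<kappa> (\<zeta> x + 0 *s e j), \<kappa> (\<zeta> x + 0 *s e j)\<rangle>)"
      by (simp add: has_field_derivative_def)
    from has_derivative_compose[OF D[OF x antiholo_\<kappa>, of j] this]
    show "((\<lambda>\<tau>. ln \<langle>\<kappa> (\<zeta> x + \<tau> *s e j), \<kappa> (\<zeta> x + \<tau> *s e j)\<rangle>) has_derivative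
        (\<lambda>\<tau>. \<tau> * (\<langle>\<kappa> (\<zeta> x), dd \<kappa> (e j) (\<zeta> x)\<rangle> / \<langle>\<kappa> (\<zeta> x), \<kappa> (\<zeta> x)\<rangle>) + cnj \<tau> * (\<langle>dd \<kappa> (e j) (\<zeta> x), \<kappa> (\<zeta> x)\<rangle> / \<langle>\<kappa> (\<zeta> x), \<kappa> (\<zeta> x)\<rangle>))) (at 0)"
      by (simp add: add_divide_distrib ring_distribs divide_inverse mult_ac)
  qed (simp add: K_eq)
  have w': "\<zeta> w \<in> V" using w by blast
  define P where "P = \<langle>dd \<kappa> (e j) (\<zeta> w), \<kappa> (\<zeta> w)\<rangle>"
  define Q where "Q = \<langle>\<kappa> (\<zeta> w), \<kappa> (\<zeta> w)\<rangle>"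
  have Q: "Q \<noteq> 0" using \<kappa>_self_nz[OF w'] by (simp add: Q_def)
  have "((\<lambda>\<tau>. \<langle>dd \<kappa> (e j) (\<zeta> w + \<tau> *s e i), \<kappa> (\<zeta> w + \<tau> *s e i)\<rangle> / \<langle>\<kappa> (\<zeta> w + \<tau> *s e i), \<kappa> (\<zeta> w + \<tau> *s e i)\<rangle>) has_derivative
      (\<lambda>\<tau>. ((\<tau> * \<langle>dd \<kappa> (e j) (\<zeta> w), dd \<kappa> (e i) (\<zeta> w)\<rangle> + cnj \<tau> * \<langle>dd (dd \<kappa> (e j)) (e i) (\<zeta> w), \<kappa> (\<zeta> w)\<rangle>) * Q -
        P * (\<tau> * \<langle>\<kappa> (\<zeta> w), dd \<kappa> (e i) (\<zeta> w)\<rangle> + cnj \<tau> * \<langle>dd \<kappa> (e i) (\<zeta> w), \<kappa> (\<zeta> w)\<rangle>)) / (Q * Q))) (at 0)"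
    using has_derivative_divide'[OF D[OF w antiholo_dd[OF antiholo_\<kappa>], of "e j" i] D[OF w antiholo_\<kappa>, of i]] Q
    by (simp add: P_def Q_def)
  also have "(\<lambda>\<tau>. ((\<tau> * \<langle>dd \<kappa> (e j) (\<zeta> w), dd \<kappa> (e i) (\<zeta> w)\<rangle> + cnj \<tau> * \<langle>dd (dd \<kappa> (e j)) (e i) (\<zeta> w), \<kappa> (\<zeta> w)\<rangle>) * Q -
        P * (\<tau> * \<langle>\<kappa> (\<zeta> w), dd \<kappa> (e i) (\<zeta> w)\<rangle> + cnj \<tau> * \<langle>dd \<kappa> (e i) (\<zeta> w), \<kappa> (\<zeta> w)\<rangle>)) / (Q * Q)) =
      (\<lambda>\<tau>. \<tau> * curv \<kappa> (e i) (e j) (\<zeta> w) (\<zeta> w) +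
        cnj \<tau> * ((\<langle>dd (dd \<kappa> (e j)) (e i) (\<zeta> w), \<kappa> (\<zeta> w)\<rangle> * Q - P * \<langle>dd \<kappa> (e i) (\<zeta> w), \<kappa> (\<zeta> w)\<rangle>) / (Q * Q)))"
    by (simp add: fun_eq_iff curv_def P_def[symmetric] Q_def[symmetric] power2_eq_square divide_simps Q) (simp add: algebra_simps)
  finally show ?thesis
    by (intro wirtinger_local(1)[OF w, where g = "\<lambda>v. \<langle>dd \<kappa> (e j) v, \<kappa> v\<rangle> / \<langle>\<kappa> v, \<kappa> v\<rangle>"] bar)
qed

lemma dd_linear:
  assumes v: "v \<in> V" and h: "h \<in> hcarrier M"
  shows "\<langle>h, dd \<kappa> b v\<rangle> = (\<Sum>i\<in>UNIV. b $ i * \<langle>h, dd \<kappa> (e i) v\<rangle>)"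
    and "\<langle>dd \<kappa> b v, h\<rangle> = (\<Sum>i\<in>UNIV. cnj (b $ i) * \<langle>dd \<kappa> (e i) v, h\<rangle>)"
proof -
  show 1: "\<langle>h, dd \<kappa> b v\<rangle> = (\<Sum>i\<in>UNIV. b $ i * \<langle>h, dd \<kappa> (e i) v\<rangle>)"
    unfolding inner_dd[OF antiholo_\<kappa> v h] by (rule ddir_linear[OF holo_inner_\<kappa>[OF h] v])
  show "\<langle>dd \<kappa> b v, h\<rangle> = (\<Sum>i\<in>UNIV. cnj (b $ i) * \<langle>dd \<kappa> (e i) v, h\<rangle>)"
    unfolding inner_commute[OF h dd_mem[OF antiholo_\<kappa> v]] 1 by simp
qed

lemma curv_sum:
  assumes v: "v \<in> V"
  shows "curv \<kappa> b c v v = (\<Sum>i\<in>UNIV. \<Sum>j\<in>UNIV. b $ i * cnj (c $ j) * curv \<kappa> (e i) (e j) v v)"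
proof -
  note mem = dd_mem[OF antiholo_\<kappa> v] \<kappa>_mem[OF v]
  have 1: "\<langle>dd \<kappa> c v, dd \<kappa> b v\<rangle> = (\<Sum>i\<in>UNIV. \<Sum>j\<in>UNIV. b $ i * cnj (c $ j) * \<langle>dd \<kappa> (e j) v, dd \<kappa> (e i) v\<rangle>)"
    by (subst dd_linear(1)[OF v mem(1)])
      (simp only: dd_linear(2)[OF v mem(1), of c] sum_distrib_left mult.assoc)
  have 2: "\<langle>dd \<kappa> c v, \<kappa> v\<rangle> * \<langle>\<kappa> v, dd \<kappa> b v\<rangle> =
      (\<Sum>i\<in>UNIV. \<Sum>j\<in>UNIV. b $ i * cnj (c $ j) * (\<langle>dd \<kappa> (e j) v, \<kappa> v\<rangle> * \<langle>\<kappa> v, dd \<kappa> (e i) v\<rangle>))"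
    unfolding dd_linear(1)[OF v mem(2), of b] dd_linear(2)[OF v mem(2), of c]
    by (subst sum.swap) (simp add: sum_product mult_ac, rule sum.swap)
  show ?thesis
    unfolding curv_def 1 2 sum_distrib_right sum_subtractf[symmetric] sum_divide_distrib
    by (intro sum.cong refl) (simp add: right_diff_distrib mult.assoc)
qed

end

context kernel_module
begin

lemma jet_eq: "h \<in> hcarrier M \<Longrightarrow> jet U \<zeta> \<nu> h = restrict0 U (\<lambda>z. vector [h z, \<langle>h, \<kappa>\<^sub>\<nu> (\<zeta> z)\<rangle>])"
  by (auto simp: jet_def restrict0_def fun_eq_iff dz_mem)

lemma mem_apply: "h \<in> hcarrier M \<Longrightarrow> z \<in> U \<Longrightarrow> h z = \<langle>h, \<kappa> (\<zeta> z)\<rangle>"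
  using inner_ker[of z h] U_sub by (auto simp: \<kappa>_\<zeta>)

lemma frame_eq:
  assumes w: "w \<in> U"
  shows "frame U \<zeta> \<nu> K w = jet U \<zeta> \<nu> (\<kappa> (\<zeta> w))" "dbar_frame U \<zeta> \<nu> K w = jet U \<zeta> \<nu> (\<kappa>\<^sub>\<nu> (\<zeta> w))"
proof -
  have w': "\<zeta> w \<in> V" using w by blast
  show "frame U \<zeta> \<nu> K w = jet U \<zeta> \<nu> (\<kappa> (\<zeta> w))"
    unfolding jet_eq[OF \<kappa>_mem[OF w']]
    by (auto simp: frame_def restrict0_def fun_eq_iff jet_kernel_eq[OF _ w] column_def vec_eq_iff forall_2
        mem_apply[OF \<kappa>_mem[OF w']])
  show "dbar_frame U \<zeta> \<nu> K w = jet U \<zeta> \<nu> (\<kappa>\<^sub>\<nu> (\<zeta> w))"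
    unfolding jet_eq[OF \<kappa>\<^sub>\<nu>_mem[OF w']]
    by (auto simp: dbar_frame_def restrict0_def fun_eq_iff jet_kernel_eq[OF _ w] column_def vec_eq_iff forall_2
        mem_apply[OF \<kappa>\<^sub>\<nu>_mem[OF w']])
qed

text \<open>The identity theorem on the domain \<open>\<Omega>\<close>; it makes the jet map injective, so that the inner product of \<open>J M\<close>,
  defined by transport, can be computed in \<open>M\<close>.\<close>

lemma eq_of_eq_on_U:
  assumes g: "g \<in> hcarrier M" and h: "h \<in> hcarrier M" and eq: "\<And>z. z \<in> U \<Longrightarrow> g z = h z"
  shows "g = h"
proof
  fix z
  have d: "g - h \<in> hcarrier M" using g h by simp
  show "g z = h z"
  proof (cases "z \<in> \<Omega>")
    case True
    obtain r where r: "r > 0" "ball w0 r \<subseteq> U" using open_U w0 open_contains_ball by blast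
    have L: "line_holo (g - h) \<Omega>" by (rule holo_on_line_holo[OF holo_mem[OF d]])
    have "(g - h) z = 0"
    proof (rule identity_theorem[of \<Omega> "g - h" UNIV w0 r])
      show "(\<lambda>\<tau>. (g - h) (v + \<tau> *s b)) field_differentiable at 0" if "v \<in> \<Omega>" for v b
        using L that unfolding line_holo_def by blast
      show "open \<Omega>" "connected (\<Omega> \<inter> UNIV)" using domain by (auto simp: bounded_domain_def)
      show "vec.subspace (UNIV :: (complex ^ 'm) set)" by (rule vec.subspace_UNIV)
      show "w0 \<in> \<Omega> \<inter> UNIV" using w0 U_sub by blast
      show "z \<in> \<Omega> \<inter> UNIV" using True by simp
      show "(g - h) v = 0" if "v \<in> ball w0 r \<inter> \<Omega> \<inter> UNIV" for v
        using eq[of v] that r by auto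
    qed (rule r(1))
    then show ?thesis by simp
  qed (use outside_0[OF g] outside_0[OF h] in simp)
qed

lemma inj_jet: "inj_on (jet U \<zeta> \<nu>) (hcarrier M)"
proof (rule inj_onI)
  fix g h assume gh: "g \<in> hcarrier M" "h \<in> hcarrier M" and eq: "jet U \<zeta> \<nu> g = jet U \<zeta> \<nu> h"
  show "g = h"
  proof (rule eq_of_eq_on_U[OF gh])
    fix z assume z: "z \<in> U"
    have "jet U \<zeta> \<nu> g z $ 1 = jet U \<zeta> \<nu> h z $ 1" using eq by simp
    then show "g z = h z" using z by (simp add: jet_def restrict0_def)
  qed
qed

lemma angle_eq:
  assumes w: "w \<in> U"
  shows "hinner (jet_space U \<zeta> \<nu> M) (dbar_frame U \<zeta> \<nu> K w) (frame U \<zeta> \<nu> K w) = \<langle>\<kappa>\<^sub>\<nu> (\<zeta> w), \<kappa> (\<zeta> w)\<rangle>"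
proof -
  have w': "\<zeta> w \<in> V" using w by blast
  show ?thesis
    by (simp add: jet_space_def frame_eq[OF w] inv_into_f_f[OF inj_jet] \<kappa>_mem[OF w'] \<kappa>\<^sub>\<nu>_mem[OF w'])
qed

end

section \<open>The quotient module\<close>

context kernel_module
begin

abbreviation M\<^sub>0 :: "(complex ^ 'm \<Rightarrow> complex) set" where "M\<^sub>0 \<equiv> submodule0 Z U \<zeta> \<nu> M"
abbreviation Q :: "(complex ^ 'm \<Rightarrow> complex) set" where "Q \<equiv> hcarrier (quotient_space Z U \<zeta> \<nu> M)"

text \<open>Vanishing to order two on the hypersurface is orthogonality to the vectors \<open>\<kappa>\<close> and \<open>\<kappa>\<^sub>\<nu>\<close> over it. Hence the
  submodule is closed and the quotient contains these vectors.\<close>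

lemma M\<^sub>0_eq: "M\<^sub>0 = {f \<in> hcarrier M. \<forall>g\<in>\<kappa> ` (V \<inter> L) \<union> \<kappa>\<^sub>\<nu> ` (V \<inter> L). \<langle>f, g\<rangle> = 0}"
  unfolding submodule0_def V_L by (auto simp: mem_apply dz_mem)

lemma Q_mem: "g \<in> Q \<longleftrightarrow> g \<in> hcarrier M \<and> (\<forall>m\<in>M\<^sub>0. \<langle>m, g\<rangle> = 0)"
proof -
  have "\<langle>g, m\<rangle> = 0 \<longleftrightarrow> \<langle>m, g\<rangle> = 0" if "g \<in> hcarrier M" "m \<in> hcarrier M" for m
    using inner_commute[OF that] by simp
  then show ?thesis by (auto simp: quotient_space_def horth_def submodule0_def)
qed

lemma \<kappa>_Q: "v \<in> V \<inter> L \<Longrightarrow> \<kappa> v \<in> Q" and \<kappa>\<^sub>\<nu>_Q: "v \<in> V \<inter> L \<Longrightarrow> \<kappa>\<^sub>\<nu> v \<in> Q"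
  unfolding Q_mem by (auto simp: M\<^sub>0_eq \<kappa>_mem \<kappa>\<^sub>\<nu>_mem)

lemma M\<^sub>0_subspace: "complex_vector.subspace M\<^sub>0" and M\<^sub>0_closed: "hclosed M M\<^sub>0"
  unfolding M\<^sub>0_eq by (intro subspace_annihilator; auto simp: \<kappa>_mem \<kappa>\<^sub>\<nu>_mem)+

lemma Q_decomposition:
  assumes "x \<in> hcarrier M" obtains m q where "m \<in> M\<^sub>0" "q \<in> Q" "x = m + q"
proof -
  obtain m where m: "m \<in> M\<^sub>0" "\<And>w. w \<in> M\<^sub>0 \<Longrightarrow> \<langle>x - m, w\<rangle> = 0"
    using orthogonal_decomposition[OF M\<^sub>0_subspace M\<^sub>0_closed assms] by blast
  have "x - m \<in> Q"
    using m assms by (auto simp: quotient_space_def horth_def submodule0_def)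
  then show ?thesis using that[of m "x - m"] m by simp
qed

lemma Q_subspace: "complex_vector.subspace Q"
  by (rule complex_vector.subspaceI) (auto simp: Q_mem inner_simps submodule0_def)

lemma hproj_Q:
  assumes x: "x \<in> hcarrier M"
  shows "hproj M Q x \<in> Q" "g \<in> Q \<Longrightarrow> \<langle>hproj M Q x, g\<rangle> = \<langle>x, g\<rangle>"
proof -
  obtain m q where mq: "m \<in> M\<^sub>0" "q \<in> Q" "x = m + q" using Q_decomposition[OF x] .
  have mH: "m \<in> hcarrier M" using mq by (simp add: submodule0_def)
  have orth: "\<langle>m, g\<rangle> = 0" if "g \<in> Q" for g using that mq(1) Q_mem by blast
  have "hproj M Q x = q"
    unfolding hproj_def
  proof (rule the_equality)
    show "q \<in> Q \<and> x - q \<in> horth M Q" using mq mH orth by (simp add: horth_def)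
    fix q' assume q': "q' \<in> Q \<and> x - q' \<in> horth M Q"
    then have d: "q - q' \<in> Q" using Q_subspace mq(2) by (simp add: complex_vector.subspace_diff)
    have qH: "q \<in> hcarrier M" "q' \<in> hcarrier M" using mq(2) q' Q_mem by blast+
    have "\<langle>x - q', q - q'\<rangle> = 0" using q' d by (simp add: horth_def)
    moreover have "x - q' = m + (q - q')" using mq by simp
    ultimately have "\<langle>q - q', q - q'\<rangle> = 0"
      using orth[OF d] inner_add_left[of m "q - q'" "q - q'"] mH qH by simp
    then show "q' = q" using inner_self_0[of "q - q'"] qH by simp
  qed
  then show "hproj M Q x \<in> Q" "g \<in> Q \<Longrightarrow> \<langle>hproj M Q x, g\<rangle> = \<langle>x, g\<rangle>"
    using mq(2,3) orth mH Q_mem inner_add_left[of m q g] by auto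
qed

lemma mult_mem: "f \<in> fun_algebra \<Omega> \<Longrightarrow> h \<in> hcarrier M \<Longrightarrow> pointwise_mult f h \<in> hcarrier M"
  using module by (simp add: holomorphic_hilbert_module_def pointwise_module_def)

lemma quotient_action_mem: "f \<in> fun_algebra \<Omega> \<Longrightarrow> h \<in> Q \<Longrightarrow> quotient_action Z U \<zeta> \<nu> M f h \<in> Q"
  unfolding quotient_action_def using hproj_Q(1) mult_mem Q_mem by blast

lemma holo_on_coordinate: "holo_on (\<lambda>z. z $ i) (S :: (complex ^ 'm) set)"
proof -
  have "((\<lambda>z. z $ i) has_derivative (\<lambda>z. z $ i)) (at z)" for z :: "complex ^ 'm" and i :: 'm
    by (rule bounded_linear_imp_has_derivative[OF bounded_linear_vec_nth])
  then show ?thesis unfolding holo_on_def by (auto intro!: exI[of _ "\<lambda>z. z $ i"])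
qed

lemma coordinate_fun_algebra: "(\<lambda>z. z $ i) \<in> fun_algebra \<Omega>"
  unfolding fun_algebra_def
  by (auto intro!: exI[of _ UNIV] exI[of _ "\<lambda>z. z $ i"] holo_on_coordinate)

abbreviation mult_coord :: "'m \<Rightarrow> (complex ^ 'm \<Rightarrow> complex) \<Rightarrow> complex ^ 'm \<Rightarrow> complex" where
  "mult_coord i \<equiv> pointwise_mult (\<lambda>z. z $ i)"

text \<open>In terms of adjoints: \<open>\<kappa> v\<close> is an eigenvector of the adjoint of a coordinate multiplication, and \<open>\<kappa>\<^sub>b v\<close> a
  generalized one. This is the product rule for \<open>z\<^sub>i h\<close>.\<close>

lemma inner_mult_coord:
  assumes v: "v \<in> V" and h: "h \<in> hcarrier M"
  shows "\<langle>mult_coord i h, \<kappa> v\<rangle> = \<psi> v $ i * \<langle>h, \<kappa> v\<rangle>"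
    and "\<langle>mult_coord i h, dd \<kappa> b v\<rangle> = ddir b (\<lambda>u. \<psi> u $ i) v * \<langle>h, \<kappa> v\<rangle> + \<psi> v $ i * \<langle>h, dd \<kappa> b v\<rangle>"
proof -
  have m: "mult_coord i h \<in> hcarrier M" by (rule mult_mem[OF coordinate_fun_algebra h])
  have 1: "\<langle>mult_coord i h, \<kappa> v\<rangle> = \<psi> v $ i * \<langle>h, \<kappa> v\<rangle>" if "v \<in> V" for v
    using that by (simp add: inner_\<kappa> m h) (simp add: pointwise_mult_def scaleC_complex_def)
  show "\<langle>mult_coord i h, \<kappa> v\<rangle> = \<psi> v $ i * \<langle>h, \<kappa> v\<rangle>" by (rule 1[OF v])
  have "line_holo (\<lambda>u. \<psi> u $ i) V"
    by (rule holo_on_line_holo[OF holo_on_\<psi>[OF holo_on_coordinate]])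
  from DERIV_mult[OF ddir_DERIV[OF this v, of b] antiholo_line_DERIV[OF antiholo_\<kappa> h, of v 0 b]]
  have "((\<lambda>\<tau>. \<psi> (v + \<tau> *s b) $ i * \<langle>h, \<kappa> (v + \<tau> *s b)\<rangle>) has_field_derivative
      (ddir b (\<lambda>u. \<psi> u $ i) v * \<langle>h, \<kappa> v\<rangle> + \<psi> v $ i * \<langle>h, dd \<kappa> b v\<rangle>)) (at 0)"
    using v by (simp add: add.commute mult.commute)
  then have "((\<lambda>\<tau>. \<langle>mult_coord i h, \<kappa> (v + \<tau> *s b)\<rangle>) has_field_derivative
      (ddir b (\<lambda>u. \<psi> u $ i) v * \<langle>h, \<kappa> v\<rangle> + \<psi> v $ i * \<langle>h, dd \<kappa> b v\<rangle>)) (at 0)"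
    by (rule has_field_derivative_transform_within_open[OF _ open_line[OF open_V, of v b]]) (use v 1 in auto)
  moreover have "((\<lambda>\<tau>. \<langle>mult_coord i h, \<kappa> (v + \<tau> *s b)\<rangle>) has_field_derivative \<langle>mult_coord i h, dd \<kappa> b v\<rangle>) (at 0)"
    using antiholo_line_DERIV[OF antiholo_\<kappa> m, of v 0 b] v by simp
  ultimately show "\<langle>mult_coord i h, dd \<kappa> b v\<rangle> = ddir b (\<lambda>u. \<psi> u $ i) v * \<langle>h, \<kappa> v\<rangle> + \<psi> v $ i * \<langle>h, dd \<kappa> b v\<rangle>"
    by (rule DERIV_unique[symmetric])
qed

lemma mult_coord_M\<^sub>0: "h \<in> M\<^sub>0 \<Longrightarrow> mult_coord i h \<in> M\<^sub>0"
  unfolding M\<^sub>0_eq using mult_mem[OF coordinate_fun_algebra] inner_mult_coord by auto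

text \<open>The kernel function itself is a joint eigenvector, and by the class \<open>B\<^sub>1\<close> the joint eigenspace is a line.\<close>

lemma joint_eigenvector:
  assumes B: "class_B 1 UNIV \<Omega> M (\<lambda>i. pointwise_mult (\<lambda>z. z $ i))"
    and x: "x \<in> \<Omega>" and g: "g \<in> hcarrier M"
    and eig: "\<And>i h. h \<in> hcarrier M \<Longrightarrow> \<langle>mult_coord i h, g\<rangle> = x $ i * \<langle>h, g\<rangle>"
  obtains c where "g = c *\<^sub>C ker x"
proof -
  define w where "w = (\<chi> i. cnj (x $ i))"
  define E where "E = ker_D UNIV M mult_coord w"
  have memE: "g \<in> E" if g: "g \<in> hcarrier M" and eig: "\<And>i h. h \<in> hcarrier M \<Longrightarrow> \<langle>mult_coord i h, g\<rangle> = x $ i * \<langle>h, g\<rangle>" for g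
  proof -
    have "hadjoint M (mult_coord i) g = w $ i *\<^sub>C g" for i
      unfolding hadjoint_def
    proof (rule the_equality)
      show "w $ i *\<^sub>C g \<in> hcarrier M \<and> (\<forall>k\<in>hcarrier M. \<langle>mult_coord i k, g\<rangle> = \<langle>k, w $ i *\<^sub>C g\<rangle>)"
        using g eig by (simp add: inner_simps w_def)
      fix g' assume g': "g' \<in> hcarrier M \<and> (\<forall>k\<in>hcarrier M. \<langle>mult_coord i k, g\<rangle> = \<langle>k, g'\<rangle>)"
      show "g' = w $ i *\<^sub>C g"
        by (rule eq_of_inner_eq) (use g g' eig in \<open>auto simp: inner_simps w_def\<close>)
    qed
    then show ?thesis using g by (simp add: E_def ker_D_def D_op_def fun_eq_iff)
  qed
  have "ker x \<in> E"
  proof (rule memE[OF ker_mem[OF x]])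
    show "\<langle>mult_coord i h, ker x\<rangle> = x $ i * \<langle>h, ker x\<rangle>" if "h \<in> hcarrier M" for i h
      using that mult_mem[OF coordinate_fun_algebra that] x
      by (simp add: inner_ker) (simp add: pointwise_mult_def scaleC_complex_def)
  qed
  moreover have "g \<in> E" by (rule memE[OF g eig])
  moreover have "complex_vector.dim E = 1"
    using B x by (auto simp: class_B_def conj_set_def E_def w_def)
  moreover have "ker x \<noteq> 0" using ker_self[OF x] hnorm_eq_0[of 0] by auto
  ultimately show ?thesis
  proof -
    assume E: "ker x \<in> E" "g \<in> E" "complex_vector.dim E = 1" and nz: "ker x \<noteq> 0"
    obtain B where B: "E \<subseteq> complex_vector.span B" "card B = 1"
      using complex_vector.basis_exists[of E] E(3) by metis
    obtain b where "B = {b}" using B(2) card_1_singletonE by blast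
    then have "E \<subseteq> range (\<lambda>k. k *\<^sub>C b)" using B(1) by (simp add: complex_vector.span_singleton)
    then obtain s t where st: "ker x = s *\<^sub>C b" "g = t *\<^sub>C b" using E(1,2) by blast
    have "s \<noteq> 0" using nz st(1) complex_vector.scale_zero_left by auto
    then have "g = (t / s) *\<^sub>C ker x" by (simp add: st scaleC_scaleC)
    then show ?thesis by (rule that)
  qed
qed

end

section \<open>Uniqueness of the space with a given matrix kernel\<close>

definition kernel_span :: "'x set \<Rightarrow> ('x \<Rightarrow> 'x \<Rightarrow> complex ^ 'r::finite ^ 'r) \<Rightarrow> ('x \<Rightarrow> complex ^ 'r) set" where
  "kernel_span X KK = complex_vector.span {restrict0 X (\<lambda>z. KK z w *v x) |w x. w \<in> X}"

lemma kernel_span_cong: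
  assumes "\<And>z w. z \<in> X \<Longrightarrow> w \<in> X \<Longrightarrow> KK z w = KK' z w"
  shows "kernel_span X KK = kernel_span X KK'"
proof -
  have "restrict0 X (\<lambda>z. KK z w *v x) = restrict0 X (\<lambda>z. KK' z w *v x)" if "w \<in> X" for w x
    using assms that by (auto simp: restrict0_def fun_eq_iff)
  then have "{restrict0 X (\<lambda>z. KK z w *v x) |w x. w \<in> X} = {restrict0 X (\<lambda>z. KK' z w *v x) |w x. w \<in> X}"
    by (intro Collect_cong) metis
  then show ?thesis by (simp add: kernel_span_def)
qed

lemma kernel_span_subset:
  assumes "matrix_rkhs X N KK" shows "kernel_span X KK \<subseteq> hcarrier N"
proof -
  interpret N: hilbert N using assms by unfold_locales (simp add: matrix_rkhs_def)
  show ?thesis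
    unfolding kernel_span_def
    by (rule complex_vector.span_minimal[OF _ N.subspace]) (use assms in \<open>auto simp: matrix_rkhs_def\<close>)
qed

lemma kernel_span_inner:
  assumes N: "matrix_rkhs X N KK" and N': "matrix_rkhs X N' KK'"
    and eq: "\<And>z w. z \<in> X \<Longrightarrow> w \<in> X \<Longrightarrow> KK z w = KK' z w"
    and F: "F \<in> hcarrier N" "F \<in> hcarrier N'" and G: "G \<in> kernel_span X KK"
  shows "hinner N F G = hinner N' F G"
proof -
  interpret N: hilbert N using N by unfold_locales (simp add: matrix_rkhs_def)
  interpret N': hilbert N' using N' by unfold_locales (simp add: matrix_rkhs_def)
  have "restrict0 X (\<lambda>z. KK z w *v x) \<in> {G \<in> hcarrier N \<inter> hcarrier N'. hinner N F G = hinner N' F G}"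
    if w: "w \<in> X" for w x
  proof -
    have eq': "restrict0 X (\<lambda>z. KK z w *v x) = restrict0 X (\<lambda>z. KK' z w *v x)"
      using eq w by (auto simp: restrict0_def fun_eq_iff)
    have "restrict0 X (\<lambda>z. KK z w *v x) \<in> hcarrier N"
      "hinner N F (restrict0 X (\<lambda>z. KK z w *v x)) = (\<Sum>l\<in>UNIV. F w $ l * cnj (x $ l))"
      using N F(1) w unfolding matrix_rkhs_def by blast+
    moreover have "restrict0 X (\<lambda>z. KK z w *v x) \<in> hcarrier N'"
      "hinner N' F (restrict0 X (\<lambda>z. KK z w *v x)) = (\<Sum>l\<in>UNIV. F w $ l * cnj (x $ l))"
      using N' F(2) w unfolding matrix_rkhs_def eq' by blast+
    ultimately show ?thesis by simp
  qed
  moreover have "complex_vector.subspace {G \<in> hcarrier N \<inter> hcarrier N'. hinner N F G = hinner N' F G}"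
    using F by (auto intro!: complex_vector.subspaceI simp: N.inner_simps N'.inner_simps)
  ultimately have "kernel_span X KK \<subseteq> {G \<in> hcarrier N \<inter> hcarrier N'. hinner N F G = hinner N' F G}"
    unfolding kernel_span_def by (intro complex_vector.span_minimal) auto
  then show ?thesis using G by blast
qed

lemma matrix_rkhs_component:
  assumes "matrix_rkhs X N KK" "w \<in> X" "F \<in> hcarrier N"
  shows "hinner N F (restrict0 X (\<lambda>z. KK z w *v axis l 1)) = F w $ l"
proof -
  have "hinner N F (restrict0 X (\<lambda>z. KK z w *v axis l 1)) = (\<Sum>l'\<in>UNIV. F w $ l' * cnj (axis l 1 $ l'))"
    using assms unfolding matrix_rkhs_def by blast
  also have "\<dots> = F w $ l"
    by (simp add: axis_def if_distrib[of cnj] if_distrib[of "(*) _"] cong: if_cong)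
  finally show ?thesis .
qed

text \<open>The kernel columns span a dense subspace, on which both inner products are given by the kernel. So a sequence from this
  span converging to \<open>F\<close> in one space is Cauchy in the other, and its limit there has the same values
  as \<open>F\<close>.\<close>

lemma matrix_rkhs_approx:
  assumes N: "matrix_rkhs X N KK" and N': "matrix_rkhs X N' KK'"
    and eq: "\<And>z w. z \<in> X \<Longrightarrow> w \<in> X \<Longrightarrow> KK z w = KK' z w" and F: "F \<in> hcarrier N"
  shows "F \<in> hcarrier N' \<and> (\<exists>s. (\<forall>n::nat. s n \<in> kernel_span X KK) \<and>
    (\<lambda>n. hnorm N (s n - F)) \<longlonglongrightarrow> 0 \<and> (\<lambda>n. hnorm N' (s n - F)) \<longlonglongrightarrow> 0)"
proof -
  interpret N: hilbert N using N by unfold_locales (simp add: matrix_rkhs_def)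
  interpret N': hilbert N' using N' by unfold_locales (simp add: matrix_rkhs_def)
  define W where "W = kernel_span X KK"
  define k where "k w l = restrict0 X (\<lambda>z. KK z w *v axis l 1)" for w l
  have W: "complex_vector.subspace W" "W \<subseteq> hcarrier N" "W \<subseteq> hcarrier N'"
    using kernel_span_subset[OF N] kernel_span_subset[OF N'] kernel_span_cong[of X KK KK'] eq
    by (simp_all add: W_def) (simp add: kernel_span_def)
  have kW: "k w l \<in> W" if "w \<in> X" for w l
    unfolding W_def kernel_span_def k_def using that by (intro complex_vector.span_base) blast
  have comp: "hinner N G (k w l) = G w $ l" if "G \<in> hcarrier N" "w \<in> X" for G w l
    unfolding k_def by (rule matrix_rkhs_component[OF N that(2,1)])
  have comp': "hinner N' G (k w l) = G w $ l" if "G \<in> hcarrier N'" "w \<in> X" for G w l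
  proof -
    have "k w l = restrict0 X (\<lambda>z. KK' z w *v axis l 1)"
      using eq that by (auto simp: k_def restrict0_def fun_eq_iff)
    then show ?thesis using matrix_rkhs_component[OF N' that(2,1)] by simp
  qed
  obtain p s where ps: "p \<in> hcarrier N" "\<And>n::nat. s n \<in> W" "(\<lambda>n. hnorm N (s n - p)) \<longlonglongrightarrow> 0"
    "\<And>w. w \<in> W \<Longrightarrow> hinner N (F - p) w = 0"
    using N.projection_limit[OF W(1,2) F] by blast
  have sN: "s n \<in> hcarrier N" "s n \<in> hcarrier N'" for n using ps(2) W by auto
  have out: "G z = 0" if "G \<in> hcarrier N \<or> G \<in> hcarrier N'" "z \<notin> X" for G z
    using that N N' unfolding matrix_rkhs_def by blast
  have p: "p = F"
  proof -
    have "(F - p) z = 0" for z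
    proof (cases "z \<in> X")
      case True
      then have "(F - p) z $ l = 0" for l
        using comp[of "F - p" z l] ps(1) ps(4)[OF kW[OF True]] F by simp
      then show ?thesis by (simp add: vec_eq_iff)
    next
      case False
      then show ?thesis using out[of "F - p" z] F ps(1) by simp
    qed
    then show ?thesis by (simp add: fun_eq_iff)
  qed
  have "\<exists>G\<in>hcarrier N'. (\<lambda>n. hnorm N' (s n - G)) \<longlonglongrightarrow> 0"
  proof (rule N'.complete[OF sN(2)])
    fix e :: real assume "e > 0"
    then obtain n0 where n0: "\<And>n. n \<ge> n0 \<Longrightarrow> hnorm N (s n - p) < e / 2"
      using order_tendstoD(2)[OF ps(3), of "e / 2"] unfolding eventually_sequentially by auto
    have "hnorm N' (s i - s j) < e" if "i \<ge> n0" "j \<ge> n0" for i j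
    proof -
      have "s i - s j \<in> W" using W(1) ps(2) by (simp add: complex_vector.subspace_diff)
      then have "hnorm N' (s i - s j) = hnorm N (s i - s j)"
        using kernel_span_inner[OF N N' eq, of "s i - s j" "s i - s j"] sN by (simp add: hnorm_def W_def)
      also have "\<dots> \<le> hnorm N (s i - p) + hnorm N (p - s j)" by (rule N.hnorm_triangle3[OF sN(1) ps(1) sN(1)])
      also have "\<dots> < e" using n0[OF that(1)] n0[OF that(2)] N.hnorm_diff_commute[OF ps(1) sN(1), of j] by simp
      finally show ?thesis .
    qed
    then show "\<exists>N. \<forall>i\<ge>N. \<forall>j\<ge>N. hnorm N' (s i - s j) < e" by blast
  qed
  then obtain G where G: "G \<in> hcarrier N'" "(\<lambda>n. hnorm N' (s n - G)) \<longlonglongrightarrow> 0" by blast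
  have "G = F"
  proof
    fix z show "G z = F z"
    proof (cases "z \<in> X")
      case True
      have "G z $ l = F z $ l" for l
      proof -
        have kz: "k z l \<in> hcarrier N" "k z l \<in> hcarrier N'" using W kW[OF True] by blast+
        have "(\<lambda>n. hinner N (s n) (k z l)) \<longlonglongrightarrow> hinner N F (k z l)"
          using N.inner_tendsto[of s "\<lambda>_. k z l" F "k z l" sequentially] sN F kz ps(3) p
            N.hnorm_eq_0[of 0] by simp
        moreover have "(\<lambda>n. hinner N' (s n) (k z l)) \<longlonglongrightarrow> hinner N' G (k z l)"
          using N'.inner_tendsto[of s "\<lambda>_. k z l" G "k z l" sequentially] sN G kz
            N'.hnorm_eq_0[of 0] by simp
        ultimately show ?thesis
          using comp[OF sN(1) True] comp'[OF sN(2) True] comp[OF F True] comp'[OF G(1) True]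
          by (simp add: LIMSEQ_unique)
      qed
      then show ?thesis by (simp add: vec_eq_iff)
    next
      case False
      then show ?thesis using out[of G z] out[of F z] F G(1) by simp
    qed
  qed
  then show ?thesis using ps(2,3) p G unfolding W_def by blast
qed

lemma matrix_rkhs_unique:
  assumes N: "matrix_rkhs X N KK" and N': "matrix_rkhs X N' KK'"
    and eq: "\<And>z w. z \<in> X \<Longrightarrow> w \<in> X \<Longrightarrow> KK z w = KK' z w"
  shows "hcarrier N = hcarrier N'"
    and "F \<in> hcarrier N \<Longrightarrow> G \<in> hcarrier N \<Longrightarrow> hinner N F G = hinner N' F G"
proof -
  interpret N: hilbert N using N by unfold_locales (simp add: matrix_rkhs_def)
  interpret N': hilbert N' using N' by unfold_locales (simp add: matrix_rkhs_def)
  have "hcarrier N \<subseteq> hcarrier N'" using matrix_rkhs_approx[OF N N' eq] by blast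
  moreover have "hcarrier N' \<subseteq> hcarrier N" using matrix_rkhs_approx[OF N' N eq[symmetric]] by blast
  ultimately show "hcarrier N = hcarrier N'" by blast
  assume F: "F \<in> hcarrier N" and G: "G \<in> hcarrier N"
  obtain s where s: "F \<in> hcarrier N'" "\<And>n::nat. s n \<in> kernel_span X KK"
    "(\<lambda>n. hnorm N (s n - F)) \<longlonglongrightarrow> 0" "(\<lambda>n. hnorm N' (s n - F)) \<longlonglongrightarrow> 0"
    using matrix_rkhs_approx[OF N N' eq F] by blast
  obtain t where t: "G \<in> hcarrier N'" "\<And>n::nat. t n \<in> kernel_span X KK"
    "(\<lambda>n. hnorm N (t n - G)) \<longlonglongrightarrow> 0" "(\<lambda>n. hnorm N' (t n - G)) \<longlonglongrightarrow> 0"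
    using matrix_rkhs_approx[OF N N' eq G] by blast
  have mem: "s n \<in> hcarrier N" "t n \<in> hcarrier N" "s n \<in> hcarrier N'" "t n \<in> hcarrier N'" for n
    using s(2) t(2) kernel_span_subset[OF N] kernel_span_subset[OF N'] kernel_span_cong[of X KK KK'] eq by auto
  have "(\<lambda>n. hinner N (s n) (t n)) \<longlonglongrightarrow> hinner N F G"
    by (rule N.inner_tendsto[OF mem(1,2) F G s(3) t(3)])
  moreover have "(\<lambda>n. hinner N (s n) (t n)) \<longlonglongrightarrow> hinner N' F G"
    using N'.inner_tendsto[OF mem(3,4) s(1) t(1) s(4) t(4)] kernel_span_inner[OF N N' eq mem(1,3) t(2)] by simp
  ultimately show "hinner N F G = hinner N' F G" by (rule LIMSEQ_unique)
qed

lemma isomorphic_through: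
  assumes 1: "isomorphic_modules A H a N b" and 2: "isomorphic_modules A H' a' N' b"
    and carrier: "hcarrier N = hcarrier N'"
    and inner: "\<And>F G. F \<in> hcarrier N \<Longrightarrow> G \<in> hcarrier N \<Longrightarrow> hinner N F G = hinner N' F G"
    and H': "complex_vector.subspace (hcarrier H')" and a': "\<And>f h. f \<in> A \<Longrightarrow> h \<in> hcarrier H' \<Longrightarrow> a' f h \<in> hcarrier H'"
  shows "isomorphic_modules A H a H' a'"
proof -
  obtain T where T: "unitary_map H N T" "\<And>f h. f \<in> A \<Longrightarrow> h \<in> hcarrier H \<Longrightarrow> T (a f h) = b f (T h)"
    using 1 unfolding isomorphic_modules_def by blast
  obtain T' where T': "unitary_map H' N' T'" "\<And>f h. f \<in> A \<Longrightarrow> h \<in> hcarrier H' \<Longrightarrow> T' (a' f h) = b f (T' h)"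
    using 2 unfolding isomorphic_modules_def by blast
  define S where "S = inv_into (hcarrier H') T'"
  have bij: "bij_betw T (hcarrier H) (hcarrier N)" "bij_betw T' (hcarrier H') (hcarrier N)"
    using T(1) T'(1) carrier by (auto simp: unitary_map_def)
  have inj': "inj_on T' (hcarrier H')" using bij(2) by (rule bij_betw_imp_inj_on)
  have ST: "S (T' h) = h" if "h \<in> hcarrier H'" for h unfolding S_def using inj' that by (rule inv_into_f_f)
  have TS: "T' (S F) = F" "S F \<in> hcarrier H'" if "F \<in> hcarrier N" for F
    unfolding S_def using bij(2) that by (auto simp: bij_betw_def intro: f_inv_into_f inv_into_into)
  have TN: "T h \<in> hcarrier N" if "h \<in> hcarrier H" for h using bij(1) that by (rule bij_betwE[THEN bspec])
  have lin: "T' (x + y) = T' x + T' y" "T' (c *\<^sub>C x) = c *\<^sub>C T' x" "hinner N' (T' x) (T' y) = hinner H' x y"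
    if "x \<in> hcarrier H'" "y \<in> hcarrier H'" for x y c
    using T'(1) that by (auto simp: unitary_map_def)
  have linT: "T (x + y) = T x + T y" "T (c *\<^sub>C x) = c *\<^sub>C T x" "hinner N (T x) (T y) = hinner H x y"
    if "x \<in> hcarrier H" "y \<in> hcarrier H" for x y c
    using T(1) that by (auto simp: unitary_map_def)
  have Sadd: "S (F + G) = S F + S G" if "F \<in> hcarrier N" "G \<in> hcarrier N" for F G
    using ST[of "S F + S G"] lin(1)[OF TS(2)[OF that(1)] TS(2)[OF that(2)]] TS that
      complex_vector.subspace_add[OF H'] by simp
  have Sscale: "S (c *\<^sub>C F) = c *\<^sub>C S F" if "F \<in> hcarrier N" for F c
    using ST[of "c *\<^sub>C S F"] lin(2)[OF TS(2)[OF that] TS(2)[OF that], of c] TS that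
      complex_vector.subspace_scale[OF H'] by simp
  have "unitary_map H H' (\<lambda>h. S (T h))"
    unfolding unitary_map_def
  proof (intro conjI ballI allI)
    have "bij_betw (S \<circ> T) (hcarrier H) (hcarrier H')"
      unfolding S_def by (rule bij_betw_trans[OF bij(1) bij_betw_inv_into[OF bij(2)]])
    then show "bij_betw (\<lambda>h. S (T h)) (hcarrier H) (hcarrier H')" by (simp add: o_def)
  next
    fix x y assume xy: "x \<in> hcarrier H" "y \<in> hcarrier H"
    show "S (T (x + y)) = S (T x) + S (T y)" using xy by (simp add: linT Sadd TN)
    have "hinner H' (S (T x)) (S (T y)) = hinner N' (T' (S (T x))) (T' (S (T y)))"
      using xy by (intro lin(3)[symmetric] TS TN)
    also have "\<dots> = hinner N (T x) (T y)" using xy by (simp add: TS TN inner)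
    finally show "hinner H' (S (T x)) (S (T y)) = hinner H x y" using linT(3)[OF xy] by simp
  next
    fix c x assume x: "x \<in> hcarrier H"
    show "S (T (c *\<^sub>C x)) = c *\<^sub>C S (T x)" using x by (simp add: linT(2)[OF x x] Sscale TN)
  qed
  moreover have "S (T (a f h)) = a' f (S (T h))" if f: "f \<in> A" and h: "h \<in> hcarrier H" for f h
  proof -
    have "T (a f h) = T' (a' f (S (T h)))" using T(2)[OF f h] T'(2)[OF f TS(2)[OF TN[OF h]]] TS(1)[OF TN[OF h]] by simp
    then show ?thesis using ST[OF a'[OF f TS(2)[OF TN[OF h]]]] by simp
  qed
  ultimately show ?thesis unfolding isomorphic_modules_def by blast
qed

section \<open>The jet kernel and the three conditions\<close>

text \<open>Tangential coordinate lines through a point of the hypersurface stay in it for a while.\<close>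

lemma (in chart) dz_cong_tangential:
  assumes i: "i \<noteq> \<nu>" and w: "w \<in> U \<inter> Z" and eq: "\<And>x. x \<in> U \<inter> Z \<Longrightarrow> f x = g x"
  shows "dz U \<zeta> i f w = dz U \<zeta> i g w" "dzbar U \<zeta> i f w = dzbar U \<zeta> i g w"
proof -
  have vd: "vector_derivative (\<lambda>t. f (shift_coord U \<zeta> i w (c * of_real t))) (at 0) =
      vector_derivative (\<lambda>t. g (shift_coord U \<zeta> i w (c * of_real t))) (at 0)" for c
  proof (rule vector_derivative_cong_eq)
    have ax: "axis i \<tau> = \<tau> *s e i" for \<tau> :: complex by (simp add: vec_eq_iff axis_def)
    define A where "A = {t :: real. \<zeta> w + (c * of_real t) *s e i \<in> V}"
    have "open ((\<lambda>t :: real. c * of_real t) -` {\<tau>. \<zeta> w + \<tau> *s e i \<in> V})"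
      by (intro open_vimage open_line open_V continuous_intros)
    then have "open A" by (simp add: A_def vimage_def)
    moreover have "0 \<in> A" using w by (simp add: A_def)
    ultimately have "\<forall>\<^sub>F t in nhds 0. t \<in> A" by (rule eventually_nhds_in_open)
    then show "\<forall>\<^sub>F t in nhds 0. t \<in> UNIV \<longrightarrow> f (shift_coord U \<zeta> i w (c * of_real t)) = g (shift_coord U \<zeta> i w (c * of_real t))"
    proof eventually_elim
      case (elim t)
      have "(\<zeta> w + (c * of_real t) *s e i) $ \<nu> = 0" using w i by (simp add: U_Z axis_def)
      then have "\<zeta> w + (c * of_real t) *s e i \<in> \<zeta> ` (U \<inter> Z)"
        using elim unfolding A_def V_L[symmetric] by simp
      then have "\<psi> (\<zeta> w + (c * of_real t) *s e i) \<in> U \<inter> Z" using \<psi>_\<zeta> by force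
      then show ?case using eq by (simp add: shift_coord_def ax[of "c * of_real t"])
    qed
  qed auto
  show "dz U \<zeta> i f w = dz U \<zeta> i g w" "dzbar U \<zeta> i f w = dzbar U \<zeta> i g w"
    unfolding dz_def dzbar_def using vd[of 1] vd[of \<i>] by simp_all
qed

text \<open>With \<open>v = e\<^sub>j\<close>, the value at \<open>u = e\<^sub>i\<close> is the difference of the coefficients at \<open>(i, j)\<close> and \<open>(j, i)\<close>, and
  the value at \<open>u = \<i> e\<^sub>i\<close> is \<open>\<i>\<close> times their sum.\<close>

lemma two_form_coefficients_eq:
  fixes a b :: "'m::finite \<Rightarrow> 'm \<Rightarrow> complex"
  assumes eq: "(\<lambda>u v. \<Sum>i\<in>I. \<Sum>j\<in>I. a i j * (u $ i * cnj (v $ j) - v $ i * cnj (u $ j))) =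
      (\<lambda>u v. \<Sum>i\<in>I. \<Sum>j\<in>I. b i j * (u $ i * cnj (v $ j) - v $ i * cnj (u $ j)))"
    and i: "i \<in> I" and j: "j \<in> I"
  shows "a i j = b i j"
proof -
  define A where "A a u v = (\<Sum>i\<in>I. \<Sum>j\<in>I. a i j * (u $ i * cnj (v $ j) - v $ i * cnj (u $ j)))"
    for a :: "'m \<Rightarrow> 'm \<Rightarrow> complex" and u v :: "complex ^ 'm"
  have ev: "A a (axis i s) (axis j 1) = a i j * s - a j i * cnj s" for a s
  proof -
    have "A a (axis i s) (axis j 1) =
        (\<Sum>k\<in>I. \<Sum>l\<in>I. (if k = i then (if l = j then a k l * s else 0) else 0)) -
        (\<Sum>k\<in>I. \<Sum>l\<in>I. (if k = j then (if l = i then a k l * cnj s else 0) else 0))"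
      unfolding A_def sum_subtractf[symmetric] by (intro sum.cong refl) (auto simp: axis_def algebra_simps)
    also have "\<dots> = a i j * s - a j i * cnj s"
    proof -
      have "(\<Sum>k\<in>I. \<Sum>l\<in>I. (if k = p then (if l = q then f k l else 0) else 0)) = f p q"
        if "p \<in> I" "q \<in> I" for p q and f :: "'m \<Rightarrow> 'm \<Rightarrow> complex"
      proof -
        have "(\<Sum>k\<in>I. \<Sum>l\<in>I. (if k = p then (if l = q then f k l else 0) else 0)) =
            (\<Sum>k\<in>I. if k = p then (\<Sum>l\<in>I. if l = q then f k l else 0) else 0)"
          by (intro sum.cong refl) simp
        then show ?thesis using that by simp
      qed
      then show ?thesis using i j by simp
    qed
    finally show ?thesis .
  qed
  have "A a = A b" unfolding A_def by (rule eq)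
  then have "a i j - a j i = b i j - b j i" "a i j * \<i> + a j i * \<i> = b i j * \<i> + b j i * \<i>"
    using ev[of a 1] ev[of b 1] ev[of a \<i>] ev[of b \<i>] by simp_all
  moreover from this(2) have "a i j + a j i = b i j + b j i" by (simp flip: distrib_right)
  ultimately have "2 * a i j = 2 * b i j" by algebra
  then show ?thesis by simp
qed

locale two_modules =
  A: kernel_module \<Omega> Z U \<zeta> \<nu> w0 M K + B: kernel_module \<Omega> Z U \<zeta> \<nu> w0 M' K'
  for \<Omega> Z U :: "(complex ^ 'm::finite) set"
    and \<zeta> :: "complex ^ 'm \<Rightarrow> complex ^ 'm" and \<nu> :: 'm and w0 :: "complex ^ 'm"
    and M M' :: "(complex ^ 'm \<Rightarrow> complex) hspace"
    and K K' :: "complex ^ 'm \<Rightarrow> complex ^ 'm \<Rightarrow> complex"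
begin

sublocale frames: two_frames M M' A.\<kappa> B.\<kappa> A.V A.L "\<zeta> w0"
proof unfold_locales
  show "A.antiholo A.\<kappa> A.V" "B.antiholo B.\<kappa> A.V" by (rule A.antiholo_\<kappa> B.antiholo_\<kappa>)+
  show "vec.subspace A.L" "connected (A.V \<inter> A.L)" by (rule A.subspace_L A.connected_V_L)+
  show "\<zeta> w0 \<in> A.V" "\<zeta> w0 \<in> A.L" using A.w0 A.U_Z by auto
  show "hinner M (A.\<kappa> (\<zeta> w0)) (A.\<kappa> z) = 1" "hinner M' (B.\<kappa> (\<zeta> w0)) (B.\<kappa> z) = 1" if "z \<in> A.V" for z
    using that by (rule A.normalised_\<kappa> B.normalised_\<kappa>)+
qed

definition jets_agree :: bool where
  "jets_agree \<longleftrightarrow> (\<forall>z \<in> A.V \<inter> A.L. \<forall>w \<in> A.V \<inter> A.L.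
     hinner M (A.\<kappa> w) (A.\<kappa> z) = hinner M' (B.\<kappa> w) (B.\<kappa> z) \<and>
     hinner M (A.\<kappa>\<^sub>\<nu> w) (A.\<kappa> z) = hinner M' (B.\<kappa>\<^sub>\<nu> w) (B.\<kappa> z) \<and>
     hinner M (A.\<kappa>\<^sub>\<nu> w) (A.\<kappa>\<^sub>\<nu> z) = hinner M' (B.\<kappa>\<^sub>\<nu> w) (B.\<kappa>\<^sub>\<nu> z))"

lemma jets_agree_flip:
  assumes jets_agree and z: "z \<in> A.V \<inter> A.L" and w: "w \<in> A.V \<inter> A.L"
  shows "hinner M (A.\<kappa> w) (A.\<kappa>\<^sub>\<nu> z) = hinner M' (B.\<kappa> w) (B.\<kappa>\<^sub>\<nu> z)"
proof -
  have "hinner M (A.\<kappa>\<^sub>\<nu> z) (A.\<kappa> w) = hinner M' (B.\<kappa>\<^sub>\<nu> z) (B.\<kappa> w)"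
    using assms unfolding jets_agree_def by blast
  then show ?thesis using z w by (simp add: A.inner_\<kappa>_\<kappa>\<^sub>\<nu> B.inner_\<kappa>_\<kappa>\<^sub>\<nu>)
qed

lemma kernel_eq_on_Z:
  assumes J: jets_agree and z: "z \<in> U \<inter> Z" and w: "w \<in> U \<inter> Z"
  shows "K z w = K' z w"
proof -
  have v: "\<zeta> z \<in> A.V \<inter> A.L" "\<zeta> w \<in> A.V \<inter> A.L" using z w A.V_L by auto
  have "K z w = hinner M (A.\<kappa> (\<zeta> w)) (A.\<kappa> (\<zeta> z))" using z w by (intro A.K_eq) auto
  also have "\<dots> = hinner M' (B.\<kappa> (\<zeta> w)) (B.\<kappa> (\<zeta> z))"
    using J v unfolding jets_agree_def by blast
  also have "\<dots> = K' z w" using z w by (intro B.K_eq[symmetric]) auto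
  finally show ?thesis .
qed

lemma jet_kernel_eq_on_Z:
  assumes J: jets_agree and z: "z \<in> U \<inter> Z" and w: "w \<in> U \<inter> Z"
  shows "jet_kernel U \<zeta> \<nu> K z w = jet_kernel U \<zeta> \<nu> K' z w"
proof -
  have v: "\<zeta> z \<in> A.V \<inter> A.L" "\<zeta> w \<in> A.V \<inter> A.L" using z w A.V_L by auto
  show ?thesis
    using J[unfolded jets_agree_def, rule_format, OF v] jets_agree_flip[OF J v] z w
    by (simp add: A.jet_kernel_eq B.jet_kernel_eq)
qed

text \<open>The tangential curvature needs only that \<open>K(x,x)\<close> is the same on the hypersurface; the transversal curvature and
  the angle are expressions in the entries of the jet kernel at \<open>(w, w)\<close>.\<close>

lemma conditions_of_jets_agree:
  assumes J: jets_agree and w: "w \<in> U \<inter> Z"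
  shows "curvature_tan U \<zeta> \<nu> K w = curvature_tan U \<zeta> \<nu> K' w"
    and "curvature_trans U \<zeta> \<nu> K w = curvature_trans U \<zeta> \<nu> K' w"
    and "hinner (jet_space U \<zeta> \<nu> M) (dbar_frame U \<zeta> \<nu> K w) (frame U \<zeta> \<nu> K w) =
      hinner (jet_space U \<zeta> \<nu> M') (dbar_frame U \<zeta> \<nu> K' w) (frame U \<zeta> \<nu> K' w)"
proof -
  have wU: "w \<in> U" and v: "\<zeta> w \<in> A.V \<inter> A.L" using w A.V_L by auto
  note J' = J[unfolded jets_agree_def, rule_format, OF v v] jets_agree_flip[OF J v v]
  have "dz U \<zeta> i (dzbar U \<zeta> j (\<lambda>x. ln (K x x))) w = dz U \<zeta> i (dzbar U \<zeta> j (\<lambda>x. ln (K' x x))) w"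
    if "i \<noteq> \<nu>" "j \<noteq> \<nu>" for i j
    by (intro A.dz_cong_tangential(1)[OF that(1) w] A.dz_cong_tangential(2)[OF that(2)])
      (simp_all add: kernel_eq_on_Z[OF J])
  then show "curvature_tan U \<zeta> \<nu> K w = curvature_tan U \<zeta> \<nu> K' w"
    unfolding curvature_tan_def curvature_part_def by (intro ext sum.cong refl) auto
  show "curvature_trans U \<zeta> \<nu> K w = curvature_trans U \<zeta> \<nu> K' w"
    unfolding curvature_trans_def curvature_part_def
    using J' by (simp add: A.curvature_coefficient[OF wU] B.curvature_coefficient[OF wU] A.curv_def B.curv_def)
  show "hinner (jet_space U \<zeta> \<nu> M) (dbar_frame U \<zeta> \<nu> K w) (frame U \<zeta> \<nu> K w) =
      hinner (jet_space U \<zeta> \<nu> M') (dbar_frame U \<zeta> \<nu> K' w) (frame U \<zeta> \<nu> K' w)"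
    using J' by (simp add: A.angle_eq[OF wU] B.angle_eq[OF wU])
qed

text \<open>The conditions are used in this order: the tangential one determines \<open>K\<close>, then the angle is the diagonal of
  \<open>\<langle>\<kappa>\<^sub>\<nu>, \<kappa>\<rangle>\<close>, and with both of these known the transversal one is an equation for \<open>\<langle>\<kappa>\<^sub>\<nu>, \<kappa>\<^sub>\<nu>\<rangle>\<close>.\<close>

lemma jets_agree_of_conditions:
  assumes tan: "\<And>w. w \<in> U \<inter> Z \<Longrightarrow> curvature_tan U \<zeta> \<nu> K w = curvature_tan U \<zeta> \<nu> K' w"
    and trans: "\<And>w. w \<in> U \<inter> Z \<Longrightarrow> curvature_trans U \<zeta> \<nu> K w = curvature_trans U \<zeta> \<nu> K' w"
    and angle: "\<And>w. w \<in> U \<inter> Z \<Longrightarrow> hinner (jet_space U \<zeta> \<nu> M) (dbar_frame U \<zeta> \<nu> K w) (frame U \<zeta> \<nu> K w) =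
      hinner (jet_space U \<zeta> \<nu> M') (dbar_frame U \<zeta> \<nu> K' w) (frame U \<zeta> \<nu> K' w)"
  shows jets_agree
proof -
  have \<psi>: "A.\<psi> v \<in> U \<inter> Z" "A.\<psi> v \<in> U" "\<zeta> (A.\<psi> v) = v" if "v \<in> A.V \<inter> A.L" for v
    using that A.\<psi>_\<zeta> unfolding A.V_L by auto
  have tan': "A.curv A.\<kappa> (axis i 1) (axis j 1) v v = B.curv B.\<kappa> (axis i 1) (axis j 1) v v"
    if ij: "i \<noteq> \<nu>" "j \<noteq> \<nu>" and v: "v \<in> A.V \<inter> A.L" for i j v
  proof -
    have "dz U \<zeta> i (dzbar U \<zeta> j (\<lambda>x. ln (K x x))) (A.\<psi> v) = dz U \<zeta> i (dzbar U \<zeta> j (\<lambda>x. ln (K' x x))) (A.\<psi> v)"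
      by (rule two_form_coefficients_eq[OF tan[OF \<psi>(1)[OF v], unfolded curvature_tan_def curvature_part_def[abs_def]]])
        (use ij in auto)
    then show ?thesis
      by (simp add: A.curvature_coefficient[OF \<psi>(2)[OF v]] B.curvature_coefficient[OF \<psi>(2)[OF v]] \<psi>(3)[OF v])
  qed
  have trans': "A.curv A.\<kappa> (axis \<nu> 1) (axis \<nu> 1) v v = B.curv B.\<kappa> (axis \<nu> 1) (axis \<nu> 1) v v"
    if v: "v \<in> A.V \<inter> A.L" for v
  proof -
    have "dz U \<zeta> \<nu> (dzbar U \<zeta> \<nu> (\<lambda>x. ln (K x x))) (A.\<psi> v) = dz U \<zeta> \<nu> (dzbar U \<zeta> \<nu> (\<lambda>x. ln (K' x x))) (A.\<psi> v)"
      by (rule two_form_coefficients_eq[OF trans[OF \<psi>(1)[OF v], unfolded curvature_trans_def curvature_part_def[abs_def]]]) auto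
    then show ?thesis
      by (simp add: A.curvature_coefficient[OF \<psi>(2)[OF v]] B.curvature_coefficient[OF \<psi>(2)[OF v]] \<psi>(3)[OF v])
  qed
  have 1: "hinner M (A.\<kappa> w) (A.\<kappa> z) = hinner M' (B.\<kappa> w) (B.\<kappa> z)"
    if z: "z \<in> A.V \<inter> A.L" and w: "w \<in> A.V \<inter> A.L" for z w
  proof (rule frames.kernel_eq_of_curv_eq[OF A.\<kappa>_self_nz B.\<kappa>_self_nz _ z w])
    fix b c v assume b: "b \<in> A.L" and c: "c \<in> A.L" and v: "v \<in> A.V \<inter> A.L"
    have vV: "v \<in> A.V" using v by blast
    show "A.curv A.\<kappa> b c v v = B.curv B.\<kappa> b c v v"
      unfolding A.curv_sum[OF vV, of b c] B.curv_sum[OF vV, of b c]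
    proof (intro sum.cong refl)
      fix i j
      show "b $ i * cnj (c $ j) * A.curv A.\<kappa> (axis i 1) (axis j 1) v v = b $ i * cnj (c $ j) * B.curv B.\<kappa> (axis i 1) (axis j 1) v v"
        using tan'[OF _ _ v, of i j] b c by (cases "i = \<nu> \<or> j = \<nu>") auto
    qed
  qed
  have 2: "hinner M (A.\<kappa>\<^sub>\<nu> w) (A.\<kappa> z) = hinner M' (B.\<kappa>\<^sub>\<nu> w) (B.\<kappa> z)"
    if z: "z \<in> A.V \<inter> A.L" and w: "w \<in> A.V \<inter> A.L" for z w
  proof (rule frames.polarized_eq[OF A.antiholo_\<kappa>\<^sub>\<nu> A.antiholo_\<kappa> B.antiholo_\<kappa>\<^sub>\<nu> B.antiholo_\<kappa> zero_less_one _ z w])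
    fix v assume "v \<in> ball (\<zeta> w0) 1 \<inter> A.V \<inter> A.L"
    then have v: "v \<in> A.V \<inter> A.L" by blast
    show "hinner M (A.\<kappa>\<^sub>\<nu> v) (A.\<kappa> v) = hinner M' (B.\<kappa>\<^sub>\<nu> v) (B.\<kappa> v)"
      using angle[OF \<psi>(1)[OF v]] by (simp add: A.angle_eq[OF \<psi>(2)[OF v]] B.angle_eq[OF \<psi>(2)[OF v]] \<psi>(3)[OF v])
  qed
  have flip: "hinner M (A.\<kappa> w) (A.\<kappa>\<^sub>\<nu> z) = hinner M' (B.\<kappa> w) (B.\<kappa>\<^sub>\<nu> z)"
    if z: "z \<in> A.V \<inter> A.L" and w: "w \<in> A.V \<inter> A.L" for z w
    using 2[OF w z] z w by (simp add: A.inner_\<kappa>_\<kappa>\<^sub>\<nu> B.inner_\<kappa>_\<kappa>\<^sub>\<nu>)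
  have 3: "hinner M (A.\<kappa>\<^sub>\<nu> w) (A.\<kappa>\<^sub>\<nu> z) = hinner M' (B.\<kappa>\<^sub>\<nu> w) (B.\<kappa>\<^sub>\<nu> z)"
    if z: "z \<in> A.V \<inter> A.L" and w: "w \<in> A.V \<inter> A.L" for z w
  proof (rule frames.polarized_eq[OF A.antiholo_\<kappa>\<^sub>\<nu> A.antiholo_\<kappa>\<^sub>\<nu> B.antiholo_\<kappa>\<^sub>\<nu> B.antiholo_\<kappa>\<^sub>\<nu> zero_less_one _ z w])
    fix v assume "v \<in> ball (\<zeta> w0) 1 \<inter> A.V \<inter> A.L"
    then have v: "v \<in> A.V \<inter> A.L" by blast
    then have "hinner M' (B.\<kappa> v) (B.\<kappa> v) \<noteq> 0" using B.\<kappa>_self_nz by blast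
    then show "hinner M (A.\<kappa>\<^sub>\<nu> v) (A.\<kappa>\<^sub>\<nu> v) = hinner M' (B.\<kappa>\<^sub>\<nu> v) (B.\<kappa>\<^sub>\<nu> v)"
      using trans'[OF v] by (simp add: A.curv_def B.curv_def 1[OF v v] 2[OF v v] flip[OF v v])
  qed
  show ?thesis unfolding jets_agree_def using 1 2 3 by blast
qed

end

section \<open>Isomorphic quotients\<close>

context two_modules
begin

text \<open>The adjoint of \<open>T\<close> is its inverse \<open>S\<close>, so \<open>S\<close> sends (generalized) eigenvectors of the adjoint action to such
  vectors with the same eigenvalues. The submodule is invariant under the coordinates, so it suffices to test
  eigenvector equations on the quotient although the eigenspace condition is one in \<open>M\<close>.\<close>

lemma jets_agree_of_isomorphic:
  assumes B1: "class_B 1 UNIV \<Omega> M (\<lambda>i. pointwise_mult (\<lambda>z. z $ i))"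
    and iso: "isomorphic_modules (fun_algebra \<Omega>) (quotient_space Z U \<zeta> \<nu> M) (quotient_action Z U \<zeta> \<nu> M)
      (quotient_space Z U \<zeta> \<nu> M') (quotient_action Z U \<zeta> \<nu> M')"
  shows jets_agree
proof -
  obtain T where T: "unitary_map (quotient_space Z U \<zeta> \<nu> M) (quotient_space Z U \<zeta> \<nu> M') T"
    and T_act: "\<And>f h. f \<in> fun_algebra \<Omega> \<Longrightarrow> h \<in> A.Q \<Longrightarrow> T (quotient_action Z U \<zeta> \<nu> M f h) = quotient_action Z U \<zeta> \<nu> M' f (T h)"
    using iso unfolding isomorphic_modules_def by blast
  have bij: "bij_betw T A.Q B.Q" and T_inner: "\<And>x y. x \<in> A.Q \<Longrightarrow> y \<in> A.Q \<Longrightarrow> hinner M' (T x) (T y) = hinner M x y"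
    using T by (simp_all add: unitary_map_def quotient_space_def)
  have TQ: "T x \<in> B.Q" if "x \<in> A.Q" for x using bij that by (rule bij_betwE[THEN bspec])
  define S where "S = inv_into A.Q T"
  have SQ: "S g \<in> A.Q" and TS: "T (S g) = g" if "g \<in> B.Q" for g
    using bij that bij_betw_inv_into[OF bij] unfolding S_def
    by (auto simp: bij_betw_inv_into_right dest: bij_betwE)
  have QM: "x \<in> hcarrier M" if "x \<in> A.Q" for x using that A.Q_mem by blast
  have QM': "x \<in> hcarrier M'" if "x \<in> B.Q" for x using that B.Q_mem by blast
  have S_inner: "hinner M (S g) (S g') = hinner M' g g'" if "g \<in> B.Q" "g' \<in> B.Q" for g g'
    using T_inner[OF SQ[OF that(1)] SQ[OF that(2)]] TS that by simp
  have adj: "hinner M q (S g) = hinner M' (T q) g" if "q \<in> A.Q" "g \<in> B.Q" for q g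
    using T_inner[OF that(1) SQ[OF that(2)]] TS[OF that(2)] by simp
  \<comment> \<open>the adjoint action on the quotient is the restriction of the one on \<open>M\<close>: the \<open>M\<^sub>0\<close>-component \<open>m\<close> drops out\<close>
  have key: "hinner M (A.mult_coord i h) (S g) = hinner M' (B.mult_coord i (T q)) g"
    "hinner M h (S g) = hinner M' (T q) g"
    if g: "g \<in> B.Q" and m: "m \<in> A.M\<^sub>0" and q: "q \<in> A.Q" and h: "h = m + q" for g h m q i
  proof -
    note c = A.coordinate_fun_algebra[of i]
    have mM: "m \<in> hcarrier M" using m by (simp add: submodule0_def)
    have mult: "A.mult_coord i h = A.mult_coord i m + A.mult_coord i q"
      by (simp add: h pointwise_mult_def fun_eq_iff scaleC_complex_def algebra_simps)
    have orth: "hinner M (A.mult_coord i m) (S g) = 0" "hinner M m (S g) = 0"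
      using SQ[OF g] A.mult_coord_M\<^sub>0[OF m] m A.Q_mem by blast+
    have mem: "A.mult_coord i m \<in> hcarrier M" "A.mult_coord i q \<in> hcarrier M" "B.mult_coord i (T q) \<in> hcarrier M'"
      using A.mult_mem[OF c] B.mult_mem[OF c] mM QM[OF q] QM'[OF TQ[OF q]] by auto
    have "hinner M (A.mult_coord i h) (S g) = hinner M (A.mult_coord i q) (S g)"
      unfolding mult using orth mem QM[OF SQ[OF g]] by (simp add: A.inner_add_left)
    also have "\<dots> = hinner M (quotient_action Z U \<zeta> \<nu> M (\<lambda>z. z $ i) q) (S g)"
      unfolding quotient_action_def by (rule A.hproj_Q(2)[OF mem(2) SQ[OF g], symmetric])
    also have "\<dots> = hinner M' (T (quotient_action Z U \<zeta> \<nu> M (\<lambda>z. z $ i) q)) g"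
      by (rule adj[OF A.quotient_action_mem[OF c q] g])
    also have "\<dots> = hinner M' (quotient_action Z U \<zeta> \<nu> M' (\<lambda>z. z $ i) (T q)) g"
      by (simp add: T_act[OF c q])
    also have "\<dots> = hinner M' (B.mult_coord i (T q)) g"
      unfolding quotient_action_def by (rule B.hproj_Q(2)[OF mem(3) g])
    finally show "hinner M (A.mult_coord i h) (S g) = hinner M' (B.mult_coord i (T q)) g" .
    have "hinner M h (S g) = hinner M q (S g)"
      unfolding h using orth mM QM[OF q] QM[OF SQ[OF g]] by (simp add: A.inner_add_left)
    then show "hinner M h (S g) = hinner M' (T q) g" by (simp add: adj[OF q g])
  qed
  have eigenvector: "\<exists>c. g = c *\<^sub>C A.\<kappa> v"
    if v: "v \<in> A.V" and g: "g \<in> hcarrier M"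
      and eig: "\<And>i h. h \<in> hcarrier M \<Longrightarrow> hinner M (A.mult_coord i h) g = A.\<psi> v $ i * hinner M h g" for v g
  proof -
    have "A.\<psi> v \<in> \<Omega>" using A.\<psi>_mem[OF v] A.U_sub by blast
    then show ?thesis using A.joint_eigenvector[OF B1 _ g eig] unfolding A.\<kappa>_def by metis
  qed
  have mult_B: "hinner M' (B.mult_coord i h) (B.\<kappa> v) = A.\<psi> v $ i * hinner M' h (B.\<kappa> v)"
    "hinner M' (B.mult_coord i h) (B.\<kappa>\<^sub>\<nu> v) = ddir (axis \<nu> 1) (\<lambda>u. A.\<psi> u $ i) v * hinner M' h (B.\<kappa> v) + A.\<psi> v $ i * hinner M' h (B.\<kappa>\<^sub>\<nu> v)"
    if "v \<in> A.V" "h \<in> hcarrier M'" for i h v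
    using B.inner_mult_coord[OF that] by auto
  have "\<exists>c. S (B.\<kappa> v) = c *\<^sub>C A.\<kappa> v" if v: "v \<in> A.V \<inter> A.L" for v
  proof (rule eigenvector)
    have gQ: "B.\<kappa> v \<in> B.Q" by (rule B.\<kappa>_Q[OF v])
    show vV: "v \<in> A.V" using v by blast
    show "S (B.\<kappa> v) \<in> hcarrier M" by (rule QM[OF SQ[OF gQ]])
    fix i h assume "h \<in> hcarrier M"
    then obtain m q where mq: "m \<in> A.M\<^sub>0" "q \<in> A.Q" "h = m + q" using A.Q_decomposition by blast
    show "hinner M (A.mult_coord i h) (S (B.\<kappa> v)) = A.\<psi> v $ i * hinner M h (S (B.\<kappa> v))"
      by (simp only: key[OF gQ mq] mult_B(1)[OF vV QM'[OF TQ[OF mq(2)]]])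
  qed
  then obtain c where c: "\<And>v. v \<in> A.V \<inter> A.L \<Longrightarrow> S (B.\<kappa> v) = c v *\<^sub>C A.\<kappa> v" by metis
  have "\<exists>d. S (B.\<kappa>\<^sub>\<nu> v) - c v *\<^sub>C A.\<kappa>\<^sub>\<nu> v = d *\<^sub>C A.\<kappa> v" if v: "v \<in> A.V \<inter> A.L" for v
  proof (rule eigenvector)
    have gQ: "B.\<kappa> v \<in> B.Q" "B.\<kappa>\<^sub>\<nu> v \<in> B.Q" by (rule B.\<kappa>_Q[OF v] B.\<kappa>\<^sub>\<nu>_Q[OF v])+
    show vV: "v \<in> A.V" using v by blast
    have mem: "S (B.\<kappa>\<^sub>\<nu> v) \<in> hcarrier M" "A.\<kappa>\<^sub>\<nu> v \<in> hcarrier M" "A.\<kappa> v \<in> hcarrier M"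
      using QM[OF SQ[OF gQ(2)]] A.\<kappa>\<^sub>\<nu>_mem[OF vV] A.\<kappa>_mem[OF vV] by auto
    then show "S (B.\<kappa>\<^sub>\<nu> v) - c v *\<^sub>C A.\<kappa>\<^sub>\<nu> v \<in> hcarrier M" by simp
    fix i h assume h: "h \<in> hcarrier M"
    then obtain m q where mq: "m \<in> A.M\<^sub>0" "q \<in> A.Q" "h = m + q" using A.Q_decomposition by blast
    define a where "a = ddir (axis \<nu> 1) (\<lambda>u. A.\<psi> u $ i) v"
    have "hinner M (A.mult_coord i h) (S (B.\<kappa>\<^sub>\<nu> v)) = a * hinner M h (S (B.\<kappa> v)) + A.\<psi> v $ i * hinner M h (S (B.\<kappa>\<^sub>\<nu> v))"
      by (simp only: key[OF gQ(1) mq] key[OF gQ(2) mq] mult_B(2)[OF vV QM'[OF TQ[OF mq(2)]]] a_def)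
    moreover have "hinner M (A.mult_coord i h) (A.\<kappa>\<^sub>\<nu> v) = a * hinner M h (A.\<kappa> v) + A.\<psi> v $ i * hinner M h (A.\<kappa>\<^sub>\<nu> v)"
      unfolding a_def by (rule A.inner_mult_coord(2)[OF vV h])
    ultimately show "hinner M (A.mult_coord i h) (S (B.\<kappa>\<^sub>\<nu> v) - c v *\<^sub>C A.\<kappa>\<^sub>\<nu> v) =
        A.\<psi> v $ i * hinner M h (S (B.\<kappa>\<^sub>\<nu> v) - c v *\<^sub>C A.\<kappa>\<^sub>\<nu> v)"
      using mem h A.mult_mem[OF A.coordinate_fun_algebra h, of i] c[OF v]
      by (simp add: A.inner_simps algebra_simps)
  qed
  then obtain d where d: "\<And>v. v \<in> A.V \<inter> A.L \<Longrightarrow> S (B.\<kappa>\<^sub>\<nu> v) - c v *\<^sub>C A.\<kappa>\<^sub>\<nu> v = d v *\<^sub>C A.\<kappa> v" by metis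
  have d': "S (B.\<kappa>\<^sub>\<nu> v) = c v *\<^sub>C A.\<kappa>\<^sub>\<nu> v + d v *\<^sub>C A.\<kappa> v" if "v \<in> A.V \<inter> A.L" for v
    using d[OF that] by (simp add: algebra_simps)
  have mem: "A.\<kappa> v \<in> hcarrier M" "A.\<kappa>\<^sub>\<nu> v \<in> hcarrier M" if "v \<in> A.V \<inter> A.L" for v
    using that A.\<kappa>_mem A.\<kappa>\<^sub>\<nu>_mem by auto
  have Kc: "hinner M' (B.\<kappa> w) (B.\<kappa> z) = c w * cnj (c z) * hinner M (A.\<kappa> w) (A.\<kappa> z)"
    if z: "z \<in> A.V \<inter> A.L" and w: "w \<in> A.V \<inter> A.L" for z w
    using S_inner[OF B.\<kappa>_Q[OF w] B.\<kappa>_Q[OF z]] mem[OF z] mem[OF w] by (simp add: c[OF z] c[OF w] A.inner_simps mult_ac)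
  \<comment> \<open>comparison with \<open>w0\<close>, where both kernels are \<open>1\<close>\<close>
  define v0 where "v0 = \<zeta> w0"
  have v0: "v0 \<in> A.V \<inter> A.L" using frames.v0 by (simp add: v0_def)
  have norm: "hinner M (A.\<kappa> v) (A.\<kappa> v0) = 1" "hinner M' (B.\<kappa> v) (B.\<kappa> v0) = 1" if "v \<in> A.V \<inter> A.L" for v
    using A.normalised_\<kappa>[of v] B.normalised_\<kappa>[of v] A.inner_commute[OF A.\<kappa>_mem A.\<kappa>_mem, of v0 v]
      B.inner_commute[OF B.\<kappa>_mem B.\<kappa>_mem, of v0 v] that v0 by (auto simp: v0_def)
  have c0: "c w * cnj (c v0) = 1" if "w \<in> A.V \<inter> A.L" for w
    using Kc[OF v0 that] norm[OF that] by simp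
  have cc: "c w * cnj (c z) = 1" if "z \<in> A.V \<inter> A.L" "w \<in> A.V \<inter> A.L" for z w
  proof -
    have "c v = c v0" if "v \<in> A.V \<inter> A.L" for v
      using c0[OF that] c0[OF v0] by (metis mult_cancel_right mult_zero_right zero_neq_one)
    then show ?thesis using c0[OF v0] that by simp
  qed
  have norm\<^sub>\<nu>: "hinner M (A.\<kappa>\<^sub>\<nu> v) (A.\<kappa> v0) = 0" "hinner M' (B.\<kappa>\<^sub>\<nu> v) (B.\<kappa> v0) = 0" if "v \<in> A.V \<inter> A.L" for v
    using that v0 A.dd_normalised[OF A.antiholo_\<kappa> _ A.normalised_\<kappa>[folded v0_def]]
      B.dd_normalised[OF B.antiholo_\<kappa> _ B.normalised_\<kappa>[folded v0_def]] by auto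
  have d0: "d w = 0" if w: "w \<in> A.V \<inter> A.L" for w
  proof -
    have "hinner M' (B.\<kappa>\<^sub>\<nu> w) (B.\<kappa> v0) = c w * cnj (c v0) * hinner M (A.\<kappa>\<^sub>\<nu> w) (A.\<kappa> v0) + d w * cnj (c v0) * hinner M (A.\<kappa> w) (A.\<kappa> v0)"
      using S_inner[OF B.\<kappa>\<^sub>\<nu>_Q[OF w] B.\<kappa>_Q[OF v0]] mem[OF v0] mem[OF w] by (simp add: c[OF v0] d'[OF w] A.inner_simps algebra_simps)
    then have "d w * cnj (c v0) = 0" using norm\<^sub>\<nu>[OF w] norm[OF w] by simp
    then show ?thesis using c0[OF v0] by auto
  qed
  have d'': "S (B.\<kappa>\<^sub>\<nu> v) = c v *\<^sub>C A.\<kappa>\<^sub>\<nu> v" if "v \<in> A.V \<inter> A.L" for v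
    using d'[OF that] d0[OF that] by (simp add: complex_vector.scale_zero_left)
  show ?thesis
    unfolding jets_agree_def
  proof (intro ballI conjI)
    fix z w assume z: "z \<in> A.V \<inter> A.L" and w: "w \<in> A.V \<inter> A.L"
    show "hinner M (A.\<kappa> w) (A.\<kappa> z) = hinner M' (B.\<kappa> w) (B.\<kappa> z)"
      using Kc[OF z w] cc[OF z w] by simp
    have "hinner M' (B.\<kappa>\<^sub>\<nu> w) (B.\<kappa> z) = c w * cnj (c z) * hinner M (A.\<kappa>\<^sub>\<nu> w) (A.\<kappa> z)"
      using S_inner[OF B.\<kappa>\<^sub>\<nu>_Q[OF w] B.\<kappa>_Q[OF z]] mem[OF z] mem[OF w] by (simp add: c[OF z] d''[OF w] A.inner_simps mult_ac)
    then show "hinner M (A.\<kappa>\<^sub>\<nu> w) (A.\<kappa> z) = hinner M' (B.\<kappa>\<^sub>\<nu> w) (B.\<kappa> z)" using cc[OF z w] by simp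
    have "hinner M' (B.\<kappa>\<^sub>\<nu> w) (B.\<kappa>\<^sub>\<nu> z) = c w * cnj (c z) * hinner M (A.\<kappa>\<^sub>\<nu> w) (A.\<kappa>\<^sub>\<nu> z)"
      using S_inner[OF B.\<kappa>\<^sub>\<nu>_Q[OF w] B.\<kappa>\<^sub>\<nu>_Q[OF z]] mem[OF z] mem[OF w] by (simp add: d''[OF z] d''[OF w] A.inner_simps mult_ac)
    then show "hinner M (A.\<kappa>\<^sub>\<nu> w) (A.\<kappa>\<^sub>\<nu> z) = hinner M' (B.\<kappa>\<^sub>\<nu> w) (B.\<kappa>\<^sub>\<nu> z)" using cc[OF z w] by simp
  qed
qed

lemma isomorphic_of_jets_agree:
  assumes J: jets_agree
    and N: "matrix_rkhs (U \<inter> Z) N (jet_kernel U \<zeta> \<nu> K)"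
      "isomorphic_modules (fun_algebra \<Omega>) (quotient_space Z U \<zeta> \<nu> M) (quotient_action Z U \<zeta> \<nu> M) N (jet_action Z U \<zeta> \<nu>)"
    and N': "matrix_rkhs (U \<inter> Z) N' (jet_kernel U \<zeta> \<nu> K')"
      "isomorphic_modules (fun_algebra \<Omega>) (quotient_space Z U \<zeta> \<nu> M') (quotient_action Z U \<zeta> \<nu> M') N' (jet_action Z U \<zeta> \<nu>)"
  shows "isomorphic_modules (fun_algebra \<Omega>) (quotient_space Z U \<zeta> \<nu> M) (quotient_action Z U \<zeta> \<nu> M)
    (quotient_space Z U \<zeta> \<nu> M') (quotient_action Z U \<zeta> \<nu> M')"
  using matrix_rkhs_unique[OF N(1) N'(1) jet_kernel_eq_on_Z[OF J]]
  by (intro isomorphic_through[OF N(2) N'(2)] B.Q_subspace B.quotient_action_mem)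

end

theorem mainTheorem1:
  fixes \<Omega> Z U :: "(complex ^ 'm::finite) set"
    and \<zeta> :: "complex ^ 'm \<Rightarrow> complex ^ 'm" and \<nu> :: 'm and w0 :: "complex ^ 'm"
    and \<phi> :: "complex ^ 'm \<Rightarrow> complex"
    and M M' :: "(complex ^ 'm \<Rightarrow> complex) hspace"
    and K K' :: "complex ^ 'm \<Rightarrow> complex ^ 'm \<Rightarrow> complex"
  assumes "bounded_domain \<Omega>"
    and "analytic_hypersurface \<Omega> Z"
    and "adapted_coordinates \<Omega> Z U \<zeta> \<nu> w0"
    and "local_defining_function U Z \<phi>"
    and "quotient_class_B2 \<Omega> Z U \<zeta> \<nu> \<phi> M K"
    and "quotient_class_B2 \<Omega> Z U \<zeta> \<nu> \<phi> M' K'"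
    and "normalised_at \<Omega> K w0"
    and "normalised_at \<Omega> K' w0"
  shows "isomorphic_modules (fun_algebra \<Omega>)
           (quotient_space Z U \<zeta> \<nu> M) (quotient_action Z U \<zeta> \<nu> M)
           (quotient_space Z U \<zeta> \<nu> M') (quotient_action Z U \<zeta> \<nu> M')
     \<longleftrightarrow>
       (\<forall>w\<in>U \<inter> Z. curvature_tan U \<zeta> \<nu> K w = curvature_tan U \<zeta> \<nu> K' w) \<and>
       (\<forall>w\<in>U \<inter> Z. curvature_trans U \<zeta> \<nu> K w = curvature_trans U \<zeta> \<nu> K' w) \<and>
       (\<forall>w\<in>U \<inter> Z.
          hinner (jet_space U \<zeta> \<nu> M) (dbar_frame U \<zeta> \<nu> K w) (frame U \<zeta> \<nu> K w) =
          hinner (jet_space U \<zeta> \<nu> M') (dbar_frame U \<zeta> \<nu> K' w) (frame U \<zeta> \<nu> K' w))"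
proof -
  interpret two_modules \<Omega> Z U \<zeta> \<nu> w0 M M' K K'
    using assms by unfold_locales (simp_all add: quotient_class_B2_def)
  obtain N N' where N: "matrix_rkhs (U \<inter> Z) N (jet_kernel U \<zeta> \<nu> K)"
      "isomorphic_modules (fun_algebra \<Omega>) (quotient_space Z U \<zeta> \<nu> M) (quotient_action Z U \<zeta> \<nu> M) N (jet_action Z U \<zeta> \<nu>)"
    and N': "matrix_rkhs (U \<inter> Z) N' (jet_kernel U \<zeta> \<nu> K')"
      "isomorphic_modules (fun_algebra \<Omega>) (quotient_space Z U \<zeta> \<nu> M') (quotient_action Z U \<zeta> \<nu> M') N' (jet_action Z U \<zeta> \<nu>)"
    using assms(5,6) unfolding quotient_class_B2_def by blast
  have B1: "class_B 1 UNIV \<Omega> M (\<lambda>i. pointwise_mult (\<lambda>z. z $ i))"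
    using assms(5) by (simp add: quotient_class_B2_def)
  show ?thesis
    using jets_agree_of_isomorphic[OF B1] conditions_of_jets_agree
      isomorphic_of_jets_agree[OF jets_agree_of_conditions N N'] by blast
qed

end
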